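(* Let $\mathrm{Vir}_{3,4}$ be the Ising model vertex algebra (the simple Virasoro vertex algebra of central charge $1/2$) and let $\chi_{\mathrm{Vir}_{3,4}}(q)=\sum_{n\ge 0}\dim\big((\mathrm{Vir}_{3,4})_n\big)q^n$ be its character. Then, as formal power series in $q$, $$\chi_{\mathrm{Vir}_{3,4}}(q)=\sum_{(k_1,k_2)\in\mathbb{Z}_{\ge 0}^2}\frac{q^{4k_1^2+3k_1k_2+k_2^2}}{(q)_{k_1}(q)_{k_2}}\left(1-q^{k_1}+q^{k_1+k_2}\right).$$
   Context: Notation: $(q)_n=\prod_{j=1}^n(1-q^j)$, with $(q)_0=1$. The Virasoro Lie algebra $\mathscr{L}$ has basis $\{L_n\}_{n\in\mathbb{Z}}\cup\{C\}$, with $C$ central and $[L_m,L_n]=(m-n)L_{m+n}+\frac{m^3-m}{12}\delta_{m,-n}C$. Let $\mathscr{L}_+$ be the subalgebra spanned by $\{L_n\}_{n\ge -1}\cup\{C\}$. For $c\in\mathbb{C}$ let $\mathbb{C}_c$ be the one-dimensional $\mathscr{L}_+$-module on which $C$ acts by $c$ and $L_n$ ($n\ge -1$) by $0$. The induced module $\mathrm{Vir}^c=U(\mathscr{L})\otimes_{U(\mathscr{L}_+)}\mathbb{C}_c$, with generator (vacuum) $|0\rangle$, carries the structure of a conformal vertex algebra. It has a basis of vectors $L_{-n_1}\cdots L_{-n_m}|0\rangle$ with $n_1\ge\dots\ge n_m\ge 2$; such a vector has degree (conformal weight) $n_1+\dots+n_m$. The Ising model $\mathrm{Vir}_{3,4}$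 is the quotient of $\mathrm{Vir}^{1/2}$ by its maximal proper $\mathscr{L}$-submodule, with the induced $\mathbb{Z}_{\ge 0}$-grading; $(\mathrm{Vir}_{3,4})_n$ is its degree $n$ component. *)

theory Defs
  imports "HOL-Analysis.Analysis" "HOL-Library.Poly_Mapping"
    "HOL-Computational_Algebra.Formal_Power_Series"
begin

section \<open>Complex scalars on finitely supported functions\<close>

definition fscale :: "complex \<Rightarrow> ('a \<Rightarrow>\<^sub>0 complex) \<Rightarrow> ('a \<Rightarrow>\<^sub>0 complex)" where
  "fscale a p = Poly_Mapping.map ((*) a) p"

lemma lookup_fscale [simp]: "Poly_Mapping.lookup (fscale a p) k = a * Poly_Mapping.lookup p k"
  unfolding fscale_def by transfer (simp add: when_def)

lemma vector_space_fscale: "vector_space fscale"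
  by unfold_locales (auto intro!: poly_mapping_eqI simp: lookup_add algebra_simps)


section \<open>The Virasoro Lie algebra\<close>

datatype vgen = L int | C

type_synonym virasoro = "vgen \<Rightarrow>\<^sub>0 complex"

definition vbasis :: "vgen \<Rightarrow> virasoro" where
  "vbasis g = Poly_Mapping.single g 1"

fun gen_bracket :: "vgen \<Rightarrow> vgen \<Rightarrow> virasoro" where
  "gen_bracket (L m) (L n) =
     fscale (of_int (m - n)) (vbasis (L (m + n))) +
     (if m = - n then fscale (of_int (m ^ 3 - m) / 12) (vbasis C) else 0)"
| "gen_bracket C g = 0"
| "gen_bracket g C = 0"

definition vbracket :: "virasoro \<Rightarrow> virasoro \<Rightarrow> virasoro" where
  "vbracket x y =
     (\<Sum>g\<in>Poly_Mapping.keys x. \<Sum>h\<in>Poly_Mapping.keys y.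
        fscale (Poly_Mapping.lookup x g * Poly_Mapping.lookup y h) (gen_bracket g h))"

interpretation virasoro: vector_space "fscale :: complex \<Rightarrow> virasoro \<Rightarrow> virasoro"
  by (rule vector_space_fscale)

definition virasoro_plus :: "virasoro set" where
  "virasoro_plus = virasoro.span (insert (vbasis C) {vbasis (L n) | n. n \<ge> -1})"


section \<open>The universal enveloping algebra\<close>

text \<open>
  Words form a monoid under concatenation (written additively, as \<^theory>\<open>HOL-Library.Poly_Mapping\<close>
  requires of exponents). The convolution ring of finitely supported functions on words in the
  basis is then the free associative algebra, that is, the tensor algebra of the Lie algebra.
\<close>

datatype 'a word = Word (letters: "'a list")

instantiation word :: (type) monoid_add
begin
definition zero_word :: "'a word" where "zero_word = Word []"
definition plus_word :: "'a word \<Rightarrow> 'a word \<Rightarrow> 'a word" where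
  "plus_word v w = Word (letters v @ letters w)"
instance by standard (simp_all add: zero_word_def plus_word_def)
end

type_synonym tensor_alg = "vgen word \<Rightarrow>\<^sub>0 complex"

definition tensor_incl :: "virasoro \<Rightarrow> tensor_alg" where
  "tensor_incl x =
     (\<Sum>g\<in>Poly_Mapping.keys x. Poly_Mapping.single (Word [g]) (Poly_Mapping.lookup x g))"

interpretation tensor: vector_space "fscale :: complex \<Rightarrow> tensor_alg \<Rightarrow> tensor_alg"
  by (rule vector_space_fscale)

definition env_ideal :: "tensor_alg set" where
  "env_ideal = tensor.span
     {u * (tensor_incl x * tensor_incl y - tensor_incl y * tensor_incl x
           - tensor_incl (vbracket x y)) * v | u x y v. True}"

lemma fscale_conv_mult:
  fixes p :: "'a::monoid_add \<Rightarrow>\<^sub>0 complex"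
  shows "fscale a p = Poly_Mapping.single 0 a * p" and "fscale a p = p * Poly_Mapping.single 0 a"
proof -
  have single: "fscale a (Poly_Mapping.single k b) = Poly_Mapping.single k (a * b)"
    for k :: 'a and b
    by (rule poly_mapping_eqI) (simp add: lookup_single when_def)
  have add: "fscale a (q + r) = fscale a q + fscale a r" for q r :: "'a \<Rightarrow>\<^sub>0 complex"
    by (rule vector_space.vector_space_assms(1)[OF vector_space_fscale])
  have zero: "fscale a 0 = (0 :: 'a \<Rightarrow>\<^sub>0 complex)"
    by (rule poly_mapping_eqI) simp
  have "fscale a p = Poly_Mapping.single 0 a * p \<and> fscale a p = p * Poly_Mapping.single 0 a"
  proof (induction p rule: update_induct)
    case const
    show ?case by (simp add: zero)
  next
    case (update f k b)
    have "Poly_Mapping.update k b f = Poly_Mapping.single k b + f"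
      using update.hyps(1)
      by (intro poly_mapping_eqI)
        (auto simp: lookup_update lookup_add lookup_single when_def in_keys_iff)
    moreover have "fscale a f = Poly_Mapping.single 0 a * f"
      and "f * Poly_Mapping.single 0 a = Poly_Mapping.single 0 a * f"
      using update.IH by (simp, metis)
    ultimately show ?case
      by (simp add: add single distrib_left distrib_right mult_single mult.commute)
  qed
  then show "fscale a p = Poly_Mapping.single 0 a * p" and "fscale a p = p * Poly_Mapping.single 0 a"
    by blast+
qed

lemma fscale_mult_left: "fscale a (p * q) = fscale a p * (q :: 'a::monoid_add \<Rightarrow>\<^sub>0 complex)"
  by (simp only: fscale_conv_mult(1) mult.assoc)

lemma fscale_mult_right:
  "fscale a (p * q) = p * fscale a (q :: 'a::monoid_add \<Rightarrow>\<^sub>0 complex)"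
  by (simp only: fscale_conv_mult(2) mult.assoc)

lemma env_ideal_mult_left: "p \<in> env_ideal \<Longrightarrow> r * p \<in> env_ideal"
  unfolding env_ideal_def
proof (induction rule: tensor.span_induct_alt)
  case base
  show ?case by (simp add: tensor.span_zero)
next
  case (step a x y)
  then obtain u s t v where x: "x = u * (tensor_incl s * tensor_incl t - tensor_incl t * tensor_incl s
           - tensor_incl (vbracket s t)) * v" by auto
  have "r * x = (r * u) * (tensor_incl s * tensor_incl t - tensor_incl t * tensor_incl s
           - tensor_incl (vbracket s t)) * v" by (simp only: x mult.assoc)
  then have "fscale a (r * x) \<in> env_ideal"
    unfolding env_ideal_def by (intro tensor.span_scale tensor.span_base) blast
  then show ?case using step.IH
    unfolding env_ideal_def by (simp add: distrib_left fscale_mult_right tensor.span_add)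
qed

lemma env_ideal_mult_right: "p \<in> env_ideal \<Longrightarrow> p * r \<in> env_ideal"
  unfolding env_ideal_def
proof (induction rule: tensor.span_induct_alt)
  case base
  show ?case by (simp add: tensor.span_zero)
next
  case (step a x y)
  then obtain u s t v where x: "x = u * (tensor_incl s * tensor_incl t - tensor_incl t * tensor_incl s
           - tensor_incl (vbracket s t)) * v" by auto
  have "x * r = u * (tensor_incl s * tensor_incl t - tensor_incl t * tensor_incl s
           - tensor_incl (vbracket s t)) * (v * r)" by (simp only: x mult.assoc)
  then have "fscale a (x * r) \<in> env_ideal"
    unfolding env_ideal_def by (intro tensor.span_scale tensor.span_base) blast
  then show ?case using step.IH
    unfolding env_ideal_def by (simp add: distrib_right fscale_mult_left tensor.span_add)
qed

lemma subspace_env_ideal: "tensor.subspace env_ideal"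
  by (simp add: env_ideal_def)

lemma (in module) equivp_diff_subspace: "subspace S \<Longrightarrow> equivp (\<lambda>x y. x - y \<in> S)"
proof (rule equivpI)
  assume S: "subspace S"
  show "reflp (\<lambda>x y. x - y \<in> S)" by (rule reflpI) (simp add: subspace_0 S)
  show "symp (\<lambda>x y. x - y \<in> S)"
    by (rule sympI) (metis S subspace_neg minus_diff_eq)
  show "transp (\<lambda>x y. x - y \<in> S)"
    by (rule transpI) (metis S subspace_add diff_add_cancel add_diff_eq)
qed

definition env_rel :: "tensor_alg \<Rightarrow> tensor_alg \<Rightarrow> bool" where
  "env_rel p q \<longleftrightarrow> p - q \<in> env_ideal"

quotient_type virasoro_env = tensor_alg / env_rel
  unfolding env_rel_def by (rule tensor.equivp_diff_subspace[OF subspace_env_ideal])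

lemma (in module) diff_add_mem:
  "subspace S \<Longrightarrow> a - b \<in> S \<Longrightarrow> c - d \<in> S \<Longrightarrow> (a + c) - (b + d) \<in> S"
  using subspace_add[of S "a - b" "c - d"] by (simp add: algebra_simps)

lemma (in module) diff_diff_mem:
  "subspace S \<Longrightarrow> a - b \<in> S \<Longrightarrow> c - d \<in> S \<Longrightarrow> (a - c) - (b - d) \<in> S"
  using subspace_diff[of S "a - b" "c - d"] by (simp add: algebra_simps)

lemma (in module) diff_uminus_mem:
  "subspace S \<Longrightarrow> a - b \<in> S \<Longrightarrow> (- a) - (- b) \<in> S"
  using subspace_neg[of S "a - b"] by (simp add: algebra_simps)

lemma (in module) diff_scale_mem:
  "subspace S \<Longrightarrow> a - b \<in> S \<Longrightarrow> scale k a - scale k b \<in> S"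
  using subspace_scale[of S "a - b" k] by (simp add: scale_right_diff_distrib)

instantiation virasoro_env :: "{ring, monoid_mult}"
begin
lift_definition zero_virasoro_env :: virasoro_env is 0 .
lift_definition one_virasoro_env :: virasoro_env is 1 .
lift_definition plus_virasoro_env :: "virasoro_env \<Rightarrow> virasoro_env \<Rightarrow> virasoro_env" is "(+)"
  unfolding env_rel_def by (rule tensor.diff_add_mem[OF subspace_env_ideal])
lift_definition minus_virasoro_env :: "virasoro_env \<Rightarrow> virasoro_env \<Rightarrow> virasoro_env" is "(-)"
  unfolding env_rel_def by (rule tensor.diff_diff_mem[OF subspace_env_ideal])
lift_definition uminus_virasoro_env :: "virasoro_env \<Rightarrow> virasoro_env" is uminus
  unfolding env_rel_def by (rule tensor.diff_uminus_mem[OF subspace_env_ideal])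
lift_definition times_virasoro_env :: "virasoro_env \<Rightarrow> virasoro_env \<Rightarrow> virasoro_env" is "(*)"
proof -
  fix a b c d :: tensor_alg
  assume "env_rel a b" "env_rel c d"
  then have "a * (c - d) + (a - b) * d \<in> env_ideal"
    unfolding env_rel_def
    by (intro tensor.subspace_add[OF subspace_env_ideal] env_ideal_mult_left env_ideal_mult_right)
  then show "env_rel (a * c) (b * d)"
    unfolding env_rel_def by (simp add: algebra_simps)
qed
instance
proof
  fix a b c :: virasoro_env
  show "a + b + c = a + (b + c)" by transfer (simp add: add.assoc equivp_reflp[OF virasoro_env_equivp])
  show "a + b = b + a" by transfer (simp add: add.commute equivp_reflp[OF virasoro_env_equivp])
  show "0 + a = a" by transfer (simp add: equivp_reflp[OF virasoro_env_equivp])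
  show "- a + a = 0" by transfer (simp add: equivp_reflp[OF virasoro_env_equivp])
  show "a - b = a + - b" by transfer (simp add: equivp_reflp[OF virasoro_env_equivp])
  show "a * b * c = a * (b * c)" by transfer (simp add: mult.assoc equivp_reflp[OF virasoro_env_equivp])
  show "(a + b) * c = a * c + b * c"
    by transfer (simp add: distrib_right equivp_reflp[OF virasoro_env_equivp])
  show "a * (b + c) = a * b + a * c"
    by transfer (simp add: distrib_left equivp_reflp[OF virasoro_env_equivp])
  show "1 * a = a" by transfer (simp add: equivp_reflp[OF virasoro_env_equivp])
  show "a * 1 = a" by transfer (simp add: equivp_reflp[OF virasoro_env_equivp])
qed
end

lift_definition env_scale :: "complex \<Rightarrow> virasoro_env \<Rightarrow> virasoro_env" is fscale
  unfolding env_rel_def by (rule tensor.diff_scale_mem[OF subspace_env_ideal])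

interpretation env: vector_space env_scale
proof
  fix a b :: complex and x y :: virasoro_env
  show "env_scale a (x + y) = env_scale a x + env_scale a y"
    by transfer (simp add: tensor.scale_right_distrib equivp_reflp[OF virasoro_env_equivp])
  show "env_scale (a + b) x = env_scale a x + env_scale b x"
    by transfer (simp add: tensor.scale_left_distrib equivp_reflp[OF virasoro_env_equivp])
  show "env_scale a (env_scale b x) = env_scale (a * b) x"
    by transfer (simp add: equivp_reflp[OF virasoro_env_equivp])
  show "env_scale 1 x = x"
    by transfer (simp add: equivp_reflp[OF virasoro_env_equivp])
qed

lemma env_scale_mult_right: "env_scale a (u * v) = u * env_scale a v"
  by transfer (simp add: fscale_mult_right equivp_reflp[OF virasoro_env_equivp])

lift_definition env_incl :: "virasoro \<Rightarrow> virasoro_env" is tensor_incl .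


section \<open>The vacuum module of central charge c\<close>

text \<open>
  An element \<open>x\<close> of \<^const>\<open>virasoro_plus\<close> acts on the one-dimensional module as the scalar
  \<open>vac_char c x\<close>.
\<close>

definition vac_char :: "complex \<Rightarrow> virasoro \<Rightarrow> complex" where
  "vac_char c x = c * Poly_Mapping.lookup x C"

text \<open>
  Since the module being induced is one-dimensional, the underlying space of its tensor product
  over the complex numbers with the enveloping algebra is the enveloping algebra itself
  (\<open>u\<close> standing for the tensor of \<open>u\<close> with the generator). Balancing over the enveloping algebra
  of \<^const>\<open>virasoro_plus\<close> identifies \<open>u * x\<close> with \<open>vac_char c x\<close> times \<open>u\<close>; it is enough to do
  so for the algebra generators \<open>x\<close> in \<^const>\<open>virasoro_plus\<close>.
\<close>

definition balance_space :: "complex \<Rightarrow> virasoro_env set" where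
  "balance_space c = env.span
     {u * env_incl x - env_scale (vac_char c x) u | u x. x \<in> virasoro_plus}"

lemma subspace_balance_space: "env.subspace (balance_space c)"
  by (simp add: balance_space_def)

lemma balance_space_mult_left: "p \<in> balance_space c \<Longrightarrow> r * p \<in> balance_space c"
  unfolding balance_space_def
proof (induction rule: env.span_induct_alt)
  case base
  show ?case by (simp add: env.span_zero)
next
  case (step a p q)
  then obtain u x where p: "p = u * env_incl x - env_scale (vac_char c x) u"
    and x: "x \<in> virasoro_plus" by auto
  have "r * p = (r * u) * env_incl x - env_scale (vac_char c x) (r * u)"
    by (simp add: p right_diff_distrib mult.assoc env_scale_mult_right)
  then have "env_scale a (r * p) \<in> balance_space c"
    unfolding balance_space_def using x by (intro env.span_scale env.span_base) blast
  then show ?case using step.IH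
    unfolding balance_space_def by (simp add: distrib_left env_scale_mult_right env.span_add)
qed

text \<open>The type below is the vacuum module of central charge \<open>1/2\<close>.\<close>

definition vir_rel :: "virasoro_env \<Rightarrow> virasoro_env \<Rightarrow> bool" where
  "vir_rel u v \<longleftrightarrow> u - v \<in> balance_space (1 / 2)"

quotient_type vir = virasoro_env / vir_rel
  unfolding vir_rel_def by (rule env.equivp_diff_subspace[OF subspace_balance_space])

instantiation vir :: ab_group_add
begin
lift_definition zero_vir :: vir is 0 .
lift_definition plus_vir :: "vir \<Rightarrow> vir \<Rightarrow> vir" is "(+)"
  unfolding vir_rel_def by (rule env.diff_add_mem[OF subspace_balance_space])
lift_definition minus_vir :: "vir \<Rightarrow> vir \<Rightarrow> vir" is "(-)"
  unfolding vir_rel_def by (rule env.diff_diff_mem[OF subspace_balance_space])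
lift_definition uminus_vir :: "vir \<Rightarrow> vir" is uminus
  unfolding vir_rel_def by (rule env.diff_uminus_mem[OF subspace_balance_space])
instance
proof
  fix a b c :: vir
  show "a + b + c = a + (b + c)" by transfer (simp add: add.assoc equivp_reflp[OF vir_equivp])
  show "a + b = b + a" by transfer (simp add: add.commute equivp_reflp[OF vir_equivp])
  show "0 + a = a" by transfer (simp add: equivp_reflp[OF vir_equivp])
  show "- a + a = 0" by transfer (simp add: equivp_reflp[OF vir_equivp])
  show "a - b = a + - b" by transfer (simp add: equivp_reflp[OF vir_equivp])
qed
end

lift_definition vir_scale :: "complex \<Rightarrow> vir \<Rightarrow> vir" is env_scale
  unfolding vir_rel_def by (rule env.diff_scale_mem[OF subspace_balance_space])

interpretation vir: vector_space vir_scale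
proof
  fix a b :: complex and x y :: vir
  show "vir_scale a (x + y) = vir_scale a x + vir_scale a y"
    by transfer (simp add: env.scale_right_distrib equivp_reflp[OF vir_equivp])
  show "vir_scale (a + b) x = vir_scale a x + vir_scale b x"
    by transfer (simp add: env.scale_left_distrib equivp_reflp[OF vir_equivp])
  show "vir_scale a (vir_scale b x) = vir_scale (a * b) x"
    by transfer (simp add: equivp_reflp[OF vir_equivp])
  show "vir_scale 1 x = x"
    by transfer (simp add: equivp_reflp[OF vir_equivp])
qed

definition env_act :: "virasoro_env \<Rightarrow> vir \<Rightarrow> vir" where
  "env_act u v = abs_vir (u * rep_vir v)"

lemma env_act_abs_vir: "env_act u (abs_vir w) = abs_vir (u * w)"
proof -
  have "vir_rel (rep_vir (abs_vir w)) w"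
    by (rule rep_abs_rsp_left[OF Quotient3_vir]) (rule equivp_reflp[OF vir_equivp])
  then have "u * (rep_vir (abs_vir w) - w) \<in> balance_space (1 / 2)"
    unfolding vir_rel_def by (rule balance_space_mult_left)
  then show ?thesis
    unfolding env_act_def vir.abs_eq_iff vir_rel_def by (simp add: right_diff_distrib)
qed

definition vir_act :: "virasoro \<Rightarrow> vir \<Rightarrow> vir" where
  "vir_act x v = env_act (env_incl x) v"

lift_definition vacuum :: vir is 1 .

fun vir_monomial :: "nat list \<Rightarrow> vir" where
  "vir_monomial [] = vacuum"
| "vir_monomial (n # ns) = vir_act (vbasis (L (- int n))) (vir_monomial ns)"

definition vir_component :: "nat \<Rightarrow> vir set" where
  "vir_component n = vir.span
     {vir_monomial ns | ns. sorted_wrt (\<ge>) ns \<and> (\<forall>k\<in>set ns. k \<ge> 2) \<and> sum_list ns = n}"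


section \<open>The simple quotient\<close>

definition vir_submodule :: "vir set \<Rightarrow> bool" where
  "vir_submodule N \<longleftrightarrow> vir.subspace N \<and> (\<forall>x. \<forall>v\<in>N. vir_act x v \<in> N)"

text \<open>
  Submodules are made into a type so that the element picked by the description operator
  below is a submodule by typing, and the quotient by it can be formed without first proving
  existence and uniqueness.
\<close>

typedef vir_submod = "{N. vir_submodule N}" morphisms submod_set Abs_vir_submod
  by (rule exI[of _ UNIV]) (simp add: vir_submodule_def vir.subspace_UNIV)

definition maximal_proper :: "vir_submod \<Rightarrow> bool" where
  "maximal_proper N \<longleftrightarrow> submod_set N \<noteq> UNIV \<and>
     (\<forall>N'. submod_set N' \<noteq> UNIV \<and> submod_set N \<subseteq> submod_set N' \<longrightarrow> N' = N)"

definition max_submod :: vir_submod where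
  "max_submod = (THE N. maximal_proper N)"

definition ising_rel :: "vir \<Rightarrow> vir \<Rightarrow> bool" where
  "ising_rel v w \<longleftrightarrow> v - w \<in> submod_set max_submod"

lemma subspace_submod_set: "vir.subspace (submod_set N)"
  using submod_set[of N] by (simp add: vir_submodule_def)

lemma submod_set_act: "v \<in> submod_set N \<Longrightarrow> vir_act x v \<in> submod_set N"
  using submod_set[of N] by (simp add: vir_submodule_def)

quotient_type ising = vir / ising_rel
  unfolding ising_rel_def by (rule vir.equivp_diff_subspace[OF subspace_submod_set])

instantiation ising :: ab_group_add
begin
lift_definition zero_ising :: ising is 0 .
lift_definition plus_ising :: "ising \<Rightarrow> ising \<Rightarrow> ising" is "(+)"
  unfolding ising_rel_def by (rule vir.diff_add_mem[OF subspace_submod_set])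
lift_definition minus_ising :: "ising \<Rightarrow> ising \<Rightarrow> ising" is "(-)"
  unfolding ising_rel_def by (rule vir.diff_diff_mem[OF subspace_submod_set])
lift_definition uminus_ising :: "ising \<Rightarrow> ising" is uminus
  unfolding ising_rel_def by (rule vir.diff_uminus_mem[OF subspace_submod_set])
instance
proof
  fix a b c :: ising
  show "a + b + c = a + (b + c)" by transfer (simp add: add.assoc equivp_reflp[OF ising_equivp])
  show "a + b = b + a" by transfer (simp add: add.commute equivp_reflp[OF ising_equivp])
  show "0 + a = a" by transfer (simp add: equivp_reflp[OF ising_equivp])
  show "- a + a = 0" by transfer (simp add: equivp_reflp[OF ising_equivp])
  show "a - b = a + - b" by transfer (simp add: equivp_reflp[OF ising_equivp])
qed
end

lift_definition ising_scale :: "complex \<Rightarrow> ising \<Rightarrow> ising" is vir_scale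
  unfolding ising_rel_def by (rule vir.diff_scale_mem[OF subspace_submod_set])

interpretation ising: vector_space ising_scale
proof
  fix a b :: complex and x y :: ising
  show "ising_scale a (x + y) = ising_scale a x + ising_scale a y"
    by transfer (simp add: vir.scale_right_distrib equivp_reflp[OF ising_equivp])
  show "ising_scale (a + b) x = ising_scale a x + ising_scale b x"
    by transfer (simp add: vir.scale_left_distrib equivp_reflp[OF ising_equivp])
  show "ising_scale a (ising_scale b x) = ising_scale (a * b) x"
    by transfer (simp add: equivp_reflp[OF ising_equivp])
  show "ising_scale 1 x = x"
    by transfer (simp add: equivp_reflp[OF ising_equivp])
qed

definition ising_proj :: "vir \<Rightarrow> ising" where
  "ising_proj = abs_ising"

definition ising_component :: "nat \<Rightarrow> ising set" where
  "ising_component n = ising_proj ` vir_component n"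

definition ising_character :: "rat fps" where
  "ising_character = Abs_fps (\<lambda>n. of_nat (ising.dim (ising_component n)))"

definition qfact :: "nat \<Rightarrow> rat fps" where
  "qfact n = (\<Prod>j=1..n. 1 - fps_X ^ j)"

end

(*
  The even part of the Fock space of a free fermion is a module over the Virasoro algebra of
  central charge 1/2. A cubic identity for the fermion modes determines the weight of a singular
  vector from its highest nonvanishing mode, which leaves the vacuum as the only even one.
  Together with the contravariant form this makes the even part a simple module generated by the
  vacuum, so it is the Ising model, and the character counts finite sets of natural numbers of
  even cardinality 2m: it is the sum of q^(2 m^2) / (q)_{2m}.

  For the q-series, put k = k1 and N = k1 + k2; the exponent becomes 2 k^2 + k N + N^2. Shifting N
  turns the factor 1 - q^k + q^N into 1 - q^(2k+2N+1). Expanding the q-binomial coefficient [N; k]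
  and resumming gives a double sum over i and b whose inner sum over b is a limiting case of the
  very-well-poised 6-phi-5 sum, and what remains is the sum of q^(2 i^2) / (q)_{2i}.
*)

theory Submission
  imports Defs "HOL-Library.Function_Algebras"
begin

text \<open>The Virasoro relations on Fock space come from a Schur-type argument: the defect of the
  Witt relation commutes with every fermion mode, hence is a scalar, and its vacuum value is the
  central term. The absence of even singular vectors is used twice, each time to descend: an even
  vector of positive weight has some L_k with k \<ge> 1 that does not kill it, so repeated lowering
  ends at the vacuum. In the vacuum module this puts the vacuum into every submodule that is not
  inside the kernel of \<open>vir_fock\<close>, so this kernel is the greatest proper submodule. In
  Fock space, transposed by the contravariant form, the same descent shows that no nonzero vector of
  an even weight space is orthogonal to all words, so \<open>vir_fock\<close> is onto. Parity enters
  as follows: the top mode of an even singular vector other than the vacuum yields an odd singular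
  vector with a smaller top mode, and the weights of the two are incompatible. Modes and weights are
  half-integral; \<open>fwt\<close> and every weight argument on the Fock side are twice the
  conformal weight.\<close>

unbundle no vec_syntax
unbundle fps_syntax

subsection \<open>Locally finite sums of formal power series\<close>

definition locally_finite :: "('i \<Rightarrow> 'a::comm_ring_1 fps) \<Rightarrow> 'i set \<Rightarrow> bool" where
  "locally_finite f A \<longleftrightarrow> (\<forall>n. finite {i\<in>A. f i $ n \<noteq> 0})"

text \<open>An algebraic counterpart of \<open>has_sum\<close>: for a locally finite family each
  coefficient is a finite sum; a coefficient with infinitely many contributions gets the default
  0.\<close>

definition fps_fsum :: "('i \<Rightarrow> 'a::comm_ring_1 fps) \<Rightarrow> 'i set \<Rightarrow> 'a fps" where
  "fps_fsum f A = Abs_fps (\<lambda>n. \<Sum>i\<in>{i\<in>A. f i $ n \<noteq> 0}. f i $ n)"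

lemma fps_fsum_nth:
  assumes "finite B" "B \<subseteq> A" "\<And>i. i \<in> A \<Longrightarrow> i \<notin> B \<Longrightarrow> f i $ n = 0"
  shows "fps_fsum f A $ n = (\<Sum>i\<in>B. f i $ n)"
  unfolding fps_fsum_def using assms by (auto intro!: sum.mono_neutral_left)

lemma fps_fsum_cong: "(\<And>i. i \<in> A \<Longrightarrow> f i = g i) \<Longrightarrow> fps_fsum f A = fps_fsum g A"
  unfolding fps_fsum_def by (intro arg_cong[where f = Abs_fps] ext sum.cong) auto

lemma locally_finite_X_power:
  fixes g :: "'i \<Rightarrow> 'a::comm_ring_1 fps"
  assumes "\<And>n. finite {i\<in>A. e i \<le> n}"
  shows "locally_finite (\<lambda>i. fps_X ^ e i * g i) A"
  unfolding locally_finite_def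
proof
  fix n
  have "{i\<in>A. (fps_X ^ e i * g i) $ n \<noteq> 0} \<subseteq> {i\<in>A. e i \<le> n}"
    by (auto simp: fps_X_power_mult_nth split: if_splits)
  then show "finite {i\<in>A. (fps_X ^ e i * g i) $ n \<noteq> 0}"
    using assms finite_subset by blast
qed

lemma locally_finite_diff:
  "locally_finite f A \<Longrightarrow> locally_finite g A \<Longrightarrow> locally_finite (\<lambda>i. f i - g i) A"
  unfolding locally_finite_def
proof
  fix n assume *: "\<forall>n. finite {i \<in> A. f i $ n \<noteq> 0}" "\<forall>n. finite {i \<in> A. g i $ n \<noteq> 0}"
  have "{i \<in> A. (f i - g i) $ n \<noteq> 0} \<subseteq> {i \<in> A. f i $ n \<noteq> 0} \<union> {i \<in> A. g i $ n \<noteq> 0}" by auto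
  then show "finite {i \<in> A. (f i - g i) $ n \<noteq> 0}" using * finite_subset by blast
qed

lemma fps_fsum_diff:
  assumes "locally_finite f A" "locally_finite g A"
  shows "fps_fsum (\<lambda>i. f i - g i) A = fps_fsum f A - fps_fsum g A"
proof (rule fps_ext)
  fix n
  let ?B = "{i \<in> A. f i $ n \<noteq> 0} \<union> {i \<in> A. g i $ n \<noteq> 0}"
  have B: "finite ?B" "?B \<subseteq> A" using assms by (auto simp: locally_finite_def)
  have "fps_fsum f A $ n = (\<Sum>i\<in>?B. f i $ n)" by (rule fps_fsum_nth[OF B]) auto
  moreover have "fps_fsum g A $ n = (\<Sum>i\<in>?B. g i $ n)" by (rule fps_fsum_nth[OF B]) auto
  moreover have "fps_fsum (\<lambda>i. f i - g i) A $ n = (\<Sum>i\<in>?B. (f i - g i) $ n)"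
    by (rule fps_fsum_nth[OF B]) auto
  ultimately show "fps_fsum (\<lambda>i. f i - g i) A $ n = (fps_fsum f A - fps_fsum g A) $ n"
    by (simp add: sum_subtractf)
qed

lemma locally_finite_cmult:
  assumes "locally_finite f A" shows "locally_finite (\<lambda>i. c * f i) A"
  unfolding locally_finite_def
proof
  fix n
  have "{i \<in> A. (c * f i) $ n \<noteq> 0} \<subseteq> (\<Union>m\<le>n. {i \<in> A. f i $ m \<noteq> 0})"
    by (force simp: fps_mult_nth dest: sum.not_neutral_contains_not_neutral)
  then show "finite {i \<in> A. (c * f i) $ n \<noteq> 0}"
    by (rule finite_subset) (use assms in \<open>simp add: locally_finite_def\<close>)
qed

lemma fps_fsum_cmult:
  assumes "locally_finite f A"
  shows "fps_fsum (\<lambda>i. c * f i) A = c * fps_fsum f A"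
proof (rule fps_ext)
  fix n
  let ?B = "\<Union>m\<le>n. {i \<in> A. f i $ m \<noteq> 0}"
  have B: "finite ?B" "?B \<subseteq> A" using assms by (auto simp: locally_finite_def)
  have *: "fps_fsum f A $ m = (\<Sum>i\<in>?B. f i $ m)" if "m \<le> n" for m
    using that by (intro fps_fsum_nth[OF B]) auto
  have "fps_fsum (\<lambda>i. c * f i) A $ n = (\<Sum>i\<in>?B. (c * f i) $ n)"
    by (rule fps_fsum_nth[OF B]) (auto simp: fps_mult_nth)
  also have "\<dots> = (\<Sum>m=0..n. c $ m * (\<Sum>i\<in>?B. f i $ (n - m)))"
    unfolding fps_mult_nth by (subst sum.swap) (simp add: sum_distrib_left)
  also have "\<dots> = (c * fps_fsum f A) $ n"
    unfolding fps_mult_nth by (intro sum.cong refl) (simp add: *)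
  finally show "fps_fsum (\<lambda>i. c * f i) A $ n = (c * fps_fsum f A) $ n" .
qed

lemma fps_fsum_reindex:
  assumes "inj_on h B"
  shows "fps_fsum f (h ` B) = fps_fsum (f \<circ> h) B"
proof (rule fps_ext)
  fix n
  have "{i \<in> h ` B. f i $ n \<noteq> 0} = h ` {i \<in> B. (f \<circ> h) i $ n \<noteq> 0}" by auto
  then show "fps_fsum f (h ` B) $ n = fps_fsum (f \<circ> h) B $ n"
    unfolding fps_fsum_def using assms
    by (simp add: sum.reindex[OF inj_on_subset[OF assms]] o_def)
qed

lemma fps_fsum_mono_neutral:
  assumes "B \<subseteq> A" "\<And>i. i \<in> A - B \<Longrightarrow> f i = 0"
  shows "fps_fsum f A = fps_fsum f B"
proof -
  have "{i\<in>A. f i $ n \<noteq> 0} = {i\<in>B. f i $ n \<noteq> 0}" for n using assms by fastforce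
  then show ?thesis by (simp add: fps_fsum_def)
qed

text \<open>Finite fibres make the inner sums ordinary ones. The triple sum in
  \<open>nahm_sum_eq\<close> is collected twice in this way.\<close>

lemma fps_fsum_group:
  assumes lf: "locally_finite f A" and K: "\<And>a. a \<in> A \<Longrightarrow> g a \<in> K"
    and fin: "\<And>c. c \<in> K \<Longrightarrow> finite {a\<in>A. g a = c}"
  shows "fps_fsum f A = fps_fsum (\<lambda>c. \<Sum>a\<in>{a\<in>A. g a = c}. f a) K"
proof (rule fps_ext)
  fix n
  let ?S = "{a\<in>A. f a $ n \<noteq> 0}"
  have S: "finite ?S" using lf by (simp add: locally_finite_def)
  have sub: "g ` ?S \<subseteq> K" using K by auto
  have inner: "(\<Sum>a\<in>{a\<in>A. g a = c}. f a) $ n = (\<Sum>a\<in>{a\<in>?S. g a = c}. f a $ n)" if "c \<in> K" for c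
    unfolding fps_sum_nth using fin[OF that] by (intro sum.mono_neutral_right) auto
  have "fps_fsum f A $ n = (\<Sum>a\<in>?S. f a $ n)"
    by (rule fps_fsum_nth[OF S]) auto
  also have "\<dots> = (\<Sum>c\<in>g ` ?S. \<Sum>a\<in>{a\<in>?S. g a = c}. f a $ n)"
    by (rule sum.group[symmetric]) (use S in auto)
  also have "\<dots> = (\<Sum>c\<in>g ` ?S. (\<Sum>a\<in>{a\<in>A. g a = c}. f a) $ n)"
    using sub by (intro sum.cong refl) (simp add: inner subset_iff)
  also have "\<dots> = fps_fsum (\<lambda>c. \<Sum>a\<in>{a\<in>A. g a = c}. f a) K $ n"
  proof (rule fps_fsum_nth[symmetric])
    show "finite (g ` ?S)" using S by simp
    fix c assume "c \<in> K" "c \<notin> g ` ?S"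
    then have "{a\<in>?S. g a = c} = {}" by auto
    then show "(\<Sum>a\<in>{a\<in>A. g a = c}. f a) $ n = 0" using inner[OF \<open>c \<in> K\<close>] by (simp only: sum.empty)
  qed (use sub in auto)
  finally show "fps_fsum f A $ n = fps_fsum (\<lambda>c. \<Sum>a\<in>{a\<in>A. g a = c}. f a) K $ n" .
qed

lemma fps_fsum_Sigma:
  assumes lf: "locally_finite f (A \<times> B)"
  shows "fps_fsum f (A \<times> B) = fps_fsum (\<lambda>a. fps_fsum (\<lambda>b. f (a, b)) B) A"
proof (rule fps_ext)
  fix n
  let ?S = "{x \<in> A \<times> B. f x $ n \<noteq> 0}"
  have S: "finite ?S" using lf by (simp add: locally_finite_def)
  have inner: "fps_fsum (\<lambda>b. f (a, b)) B $ n = (\<Sum>b\<in>{b. (a, b) \<in> ?S}. f (a, b) $ n)" if "a \<in> A" for a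
  proof -
    have "{b. (a, b) \<in> ?S} \<subseteq> snd ` ?S" by force
    then have "finite {b. (a, b) \<in> ?S}" using S finite_subset by blast
    then show ?thesis using that by (intro fps_fsum_nth) auto
  qed
  have "fps_fsum f (A \<times> B) $ n = (\<Sum>x\<in>?S. f x $ n)" by (rule fps_fsum_nth[OF S]) auto
  also have "?S = Sigma (fst ` ?S) (\<lambda>a. {b. (a, b) \<in> ?S})" by force
  also have "(\<Sum>x\<in>\<dots>. f x $ n) = (\<Sum>a\<in>fst ` ?S. \<Sum>b\<in>{b. (a, b) \<in> ?S}. f (a, b) $ n)"
  proof (subst sum.Sigma)
    show "\<forall>a\<in>fst ` ?S. finite {b. (a, b) \<in> ?S}"
    proof
      fix a
      have "{b. (a, b) \<in> ?S} \<subseteq> snd ` ?S" by force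
      then show "finite {b. (a, b) \<in> ?S}" using S finite_subset by blast
    qed
  qed (use S in auto)
  also have "\<dots> = (\<Sum>a\<in>fst ` ?S. fps_fsum (\<lambda>b. f (a, b)) B $ n)"
    by (intro sum.cong refl inner[symmetric]) auto
  also have "\<dots> = fps_fsum (\<lambda>a. fps_fsum (\<lambda>b. f (a, b)) B) A $ n"
  proof (rule fps_fsum_nth[symmetric])
    fix a assume a: "a \<in> A" "a \<notin> fst ` ?S"
    then have "{b. (a, b) \<in> ?S} = {}" by force
    then show "fps_fsum (\<lambda>b. f (a, b)) B $ n = 0" using inner[OF a(1)] by (simp only: sum.empty)
  qed (use S in auto)
  finally show "fps_fsum f (A \<times> B) $ n = fps_fsum (\<lambda>a. fps_fsum (\<lambda>b. f (a, b)) B) A $ n" .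
qed

text \<open>A basic neighbourhood of a power series fixes the coefficients below \<open>n\<close>;
  these are final once a partial sum contains the finitely many indices that contribute below
  \<open>n\<close>.\<close>

lemma has_sum_fps_fsum:
  assumes "locally_finite f A"
  shows "(f has_sum fps_fsum f A) A"
  unfolding has_sum_def tendsto_def
proof safe
  fix U :: "'b fps set" assume "open U" "fps_fsum f A \<in> U"
  then obtain n where n: "{G. fps_cutoff n G = fps_cutoff n (fps_fsum f A)} \<subseteq> U"
    unfolding open_fps_iff by blast
  let ?B = "\<Union>m<n. {i \<in> A. f i $ m \<noteq> 0}"
  have B: "finite ?B" "?B \<subseteq> A" using assms by (auto simp: locally_finite_def)
  show "\<forall>\<^sub>F F in finite_subsets_at_top A. sum f F \<in> U"
    unfolding eventually_finite_subsets_at_top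
  proof (intro exI conjI allI impI)
    fix F assume F: "finite F \<and> ?B \<subseteq> F \<and> F \<subseteq> A"
    have "sum f F $ m = fps_fsum f A $ m" if "m < n" for m
      unfolding fps_sum_nth using F that by (intro fps_fsum_nth[symmetric]) auto
    then have "fps_cutoff n (sum f F) = fps_cutoff n (fps_fsum f A)"
      by (simp add: fps_eq_iff)
    then show "sum f F \<in> U" using n by auto
  qed (use B in auto)
qed

subsection \<open>The q-series identity\<close>

definition iqfact :: "nat \<Rightarrow> rat fps" where
  "iqfact n = inverse (qfact n)"

lemma qfact_0 [simp]: "qfact 0 = 1"
  and qfact_Suc: "qfact (Suc n) = qfact n * (1 - fps_X ^ Suc n)"
  by (simp_all add: qfact_def)

lemma qfact_nth_0 [simp]: "qfact n $ 0 = 1"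
  by (induction n) (simp_all add: qfact_Suc)

lemma qfact_mult_iqfact [simp]: "qfact n * iqfact n = 1"
  unfolding iqfact_def by (rule inverse_mult_eq_1') simp

lemma iqfact_0 [simp]: "iqfact 0 = 1"
  using qfact_mult_iqfact[of 0] by simp

lemma iqfact_Suc: "(1 - fps_X ^ Suc n) * iqfact (Suc n) = iqfact n"
proof -
  have "(1 - fps_X ^ Suc n) * iqfact (Suc n) = (qfact (Suc n) * iqfact (Suc n)) * iqfact n"
    using qfact_mult_iqfact[of n] by (simp only: qfact_Suc mult_ac) (metis mult.assoc mult.commute mult_1)
  then show ?thesis by simp
qed

lemma one_minus_X_power_nonzero: "n > 0 \<Longrightarrow> 1 - fps_X ^ n \<noteq> (0 :: rat fps)"
  by (metis cancel_comm_monoid_add_class.diff_cancel diff_zero eq_iff_diff_eq_0 fps_X_power_nth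
      fps_one_nth less_not_refl zero_neq_one)

text \<open>The finite q-binomial theorem divided by (q)_n, homogeneous so that either variable can
  be set to 1. Splitting 1 - q^(n+1) as (1 - q^(n+1-l)) + q^(n+1-l) (1 - q^l), each bracket cancels
  the last factor of one inverse factorial and leaves z, respectively -y q^n, times the sum for
  n.\<close>

lemma q_binomial:
  "(\<Sum>l\<le>n. (-1) ^ l * fps_X ^ (l choose 2) * y ^ l * z ^ (n - l) * iqfact l * iqfact (n - l))
     = iqfact n * (\<Prod>j<n. z - y * fps_X ^ j)"
proof (induction n)
  case 0
  show ?case by (simp add: binomial_eq_0)
next
  case (Suc n)
  let ?a = "\<lambda>n l. (-1) ^ l * fps_X ^ (l choose 2) * y ^ l * z ^ (n - l) * iqfact l * iqfact (n - l)"
  let ?q = "\<lambda>k. fps_X ^ k :: rat fps"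
  have split: "(1 - ?q (Suc n)) * ?a (Suc n) l
      = (1 - ?q (Suc n - l)) * ?a (Suc n) l + ?q (Suc n - l) * (1 - ?q l) * ?a (Suc n) l"
    if "l \<le> Suc n" for l
  proof -
    have "?q (Suc n) = ?q (Suc n - l) * ?q l" using that by (simp flip: power_add)
    moreover have "(1 - u * v) * w = (1 - u) * w + u * (1 - v) * w" for u v w :: "rat fps"
      by (simp add: algebra_simps)
    ultimately show ?thesis by (simp only:)
  qed
  have first: "(1 - ?q (Suc n - l)) * ?a (Suc n) l = z * ?a n l" if "l \<le> n" for l
    by (subst iqfact_Suc[of "n - l", symmetric]) (simp only: Suc_diff_le[OF that] power_Suc mult_ac)
  have second: "?q (Suc n - Suc l) * (1 - ?q (Suc l)) * ?a (Suc n) (Suc l) = - y * ?q n * ?a n l"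
    if "l \<le> n" for l
  proof -
    have "?q n = ?q (n - l) * ?q l" using that by (simp flip: power_add)
    moreover have "Suc l choose 2 = (l choose 2) + l" by (simp add: numeral_2_eq_2)
    ultimately show ?thesis
      by (subst iqfact_Suc[of l, symmetric])
        (simp only: diff_Suc_Suc power_add power_Suc mult_ac minus_mult_left[symmetric] minus_mult_right[symmetric] mult_1)
  qed
  have "(1 - ?q (Suc n)) * (\<Sum>l\<le>Suc n. ?a (Suc n) l)
      = (\<Sum>l\<le>Suc n. (1 - ?q (Suc n - l)) * ?a (Suc n) l)
        + (\<Sum>l\<le>Suc n. ?q (Suc n - l) * (1 - ?q l) * ?a (Suc n) l)"
    unfolding sum_distrib_left by (subst sum.distrib[symmetric]) (intro sum.cong refl split, simp)
  also have "(\<Sum>l\<le>Suc n. (1 - ?q (Suc n - l)) * ?a (Suc n) l) = z * (\<Sum>l\<le>n. ?a n l)"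
    unfolding sum_distrib_left by (subst sum.atMost_Suc) (simp add: first)
  also have "(\<Sum>l\<le>Suc n. ?q (Suc n - l) * (1 - ?q l) * ?a (Suc n) l) = - y * ?q n * (\<Sum>l\<le>n. ?a n l)"
  proof -
    have "(\<Sum>l\<le>Suc n. ?q (Suc n - l) * (1 - ?q l) * ?a (Suc n) l)
        = (\<Sum>l\<le>n. ?q (Suc n - Suc l) * (1 - ?q (Suc l)) * ?a (Suc n) (Suc l))"
      by (subst sum.atMost_Suc_shift) simp
    also have "\<dots> = (\<Sum>l\<le>n. - y * ?q n * ?a n l)"
      by (intro sum.cong refl second) simp
    finally show ?thesis unfolding sum_distrib_left .
  qed
  finally have "(1 - ?q (Suc n)) * (\<Sum>l\<le>Suc n. ?a (Suc n) l)
      = iqfact n * (\<Prod>j<n. z - y * fps_X ^ j) * (z - y * ?q n)"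
    unfolding Suc.IH by (simp add: algebra_simps)
  also have "\<dots> = (1 - ?q (Suc n)) * (iqfact (Suc n) * (\<Prod>j<Suc n. z - y * fps_X ^ j))"
    by (simp add: iqfact_Suc[of n, symmetric] mult_ac)
  finally show ?case
    using one_minus_X_power_nonzero[of "Suc n"] by (simp only: mult_cancel_left) simp
qed

text \<open>Each factor is -q^j (1 - q^(N-j)): the powers collect to q^(k choose 2), and the
  brackets are the top k factors of (q)_N.\<close>

lemma prod_X_power_diff:
  assumes "k \<le> N"
  shows "iqfact N * (\<Prod>j<k. fps_X ^ N - fps_X ^ j) = (-1) ^ k * fps_X ^ (k choose 2) * iqfact (N - k)"
  using assms
proof (induction k)
  case (Suc k)
  have *: "fps_X ^ N - fps_X ^ k = - (fps_X ^ k * (1 - fps_X ^ Suc (N - Suc k)) :: rat fps)"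
    using Suc.prems by (simp add: right_diff_distrib Suc_diff_Suc del: power_Suc flip: power_add)
  have **: "(1 - fps_X ^ Suc (N - Suc k)) * iqfact (N - k) = iqfact (N - Suc k)"
    using iqfact_Suc[of "N - Suc k"] Suc.prems by (simp only: Suc_diff_Suc Suc_le_eq)
  have arith: "u * p = w \<Longrightarrow> u * (p * - (x * y)) = - (w * (x * y))" for u p w x y :: "rat fps"
    by (simp flip: mult.assoc)
  have "iqfact N * (\<Prod>j<k. fps_X ^ N - fps_X ^ j) = (-1) ^ k * fps_X ^ (k choose 2) * iqfact (N - k)"
    using Suc by simp
  then have "iqfact N * (\<Prod>j<Suc k. fps_X ^ N - fps_X ^ j)
      = - ((-1) ^ k * fps_X ^ (k choose 2) * iqfact (N - k) * (fps_X ^ k * (1 - fps_X ^ Suc (N - Suc k))))"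
    unfolding prod.lessThan_Suc * by (rule arith)
  also have "\<dots> = - ((-1) ^ k * (fps_X ^ (k choose 2) * fps_X ^ k) * ((1 - fps_X ^ Suc (N - Suc k)) * iqfact (N - k)))"
    by (simp only: mult_ac)
  also have "fps_X ^ (k choose 2) * fps_X ^ k = (fps_X ^ (Suc k choose 2) :: rat fps)"
    by (simp add: numeral_2_eq_2 add.commute flip: power_add)
  finally show ?case unfolding ** by simp
qed (simp add: binomial_eq_0)

lemma prod_one_minus_X_power:
  "(\<Prod>j<n. 1 - fps_X ^ (m + 1) * fps_X ^ j) = qfact (m + n) * iqfact m"
proof (induction n)
  case (Suc n)
  have "fps_X ^ (m + 1) * fps_X ^ n = (fps_X ^ Suc (m + n) :: rat fps)" by (simp flip: power_add)
  then show ?case using Suc.IH by (simp only: add_Suc_right qfact_Suc prod.lessThan_Suc mult_ac)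
qed simp

lemma choose_two_add: "(i + l) choose 2 = (i choose 2) + (l choose 2) + i * l" for i l :: nat
  by (induction i) (simp_all add: numeral_2_eq_2)

lemma choose_two_square: "l\<^sup>2 = 2 * (l choose 2) + l" for l :: nat
  by (induction l) (simp_all add: numeral_2_eq_2)

text \<open>The linear term records a shift: \<open>c = 0\<close> belongs to the summand 1 of the
  bracket in the theorem, \<open>c = 2\<close> to the rest after \<open>k2\<close> has been moved by
  one.\<close>

definition nahm_sum :: "nat \<Rightarrow> rat fps" where
  "nahm_sum c = fps_fsum (\<lambda>(k1, k2). fps_X ^ (4 * k1\<^sup>2 + 3 * k1 * k2 + k2\<^sup>2 + c * (2 * k1 + k2))
     * (iqfact k1 * iqfact k2)) UNIV"

text \<open>
  The triple sum below is obtained by expanding the q-binomial coefficient in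
  \<open>q_binomial\<close>; collecting its terms in two ways gives the two sides.
\<close>

lemma nahm_sum_eq:
  "nahm_sum c = fps_fsum (\<lambda>(i, b). fps_X ^ (2 * i\<^sup>2 + i * b + b\<^sup>2 + c * (i + b))
     * (iqfact i * iqfact b * qfact (2 * i + b) * iqfact (2 * i))) UNIV"
proof -
  \<comment> \<open>With k = i + l this is the exponent of \<open>s\<close> below plus (i choose 2)
    + N l minus (k choose 2), rewritten without subtraction.\<close>
  define E where "E = (\<lambda>(N, i, l). N\<^sup>2 + N * i + 2 * i\<^sup>2 + 2 * N * l + 3 * i * l + l\<^sup>2 + l + (l choose 2)
     + c * (i + l + N) :: nat)"
  define t where "t = (\<lambda>(N, i, l). fps_X ^ E (N, i, l)
     * ((-1) ^ l * iqfact N * iqfact i * iqfact l) :: rat fps)"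
  have lf: "locally_finite t UNIV"
  proof -
    have "finite {x. E x \<le> n}" for n
    proof (rule finite_subset)
      have E: "N \<le> E (N, i, l) \<and> i \<le> E (N, i, l) \<and> l \<le> E (N, i, l)" for N i l
      proof -
        have le: "N \<le> a \<Longrightarrow> i \<le> b \<Longrightarrow> N \<le> a + x + 2 * b + y + z + w + l + v + u
            \<and> i \<le> a + x + 2 * b + y + z + w + l + v + u \<and> l \<le> a + x + 2 * b + y + z + w + l + v + u"
          for a b x y z w v u :: nat
          by linarith
        show ?thesis
          unfolding E_def prod.case power2_eq_square by (rule le[OF le_square le_square])
      qed
      show "{x. E x \<le> n} \<subseteq> {..n} \<times> {..n} \<times> {..n}"
      proof
        fix x assume x: "x \<in> {x. E x \<le> n}"
        obtain N i l where "x = (N, i, l)" by (metis prod.exhaust)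
        then show "x \<in> {..n} \<times> {..n} \<times> {..n}" using x E[of N i l] by simp
      qed
    qed simp
    then show ?thesis
      using locally_finite_X_power[where A = UNIV and e = E
          and g = "\<lambda>(N, i, l). (-1) ^ l * iqfact N * iqfact i * iqfact l"]
      by (simp add: t_def case_prod_unfold)
  qed
  define s where "s = (\<lambda>(k, N). if k \<le> N then fps_X ^ (N\<^sup>2 + N * k + 2 * k\<^sup>2 + c * (k + N))
      * (iqfact k * iqfact (N - k)) else 0)"
  have s: "(\<Sum>a\<in>{a. (\<lambda>(N, i, l). (i + l, N)) a = kN}. t a) = s kN" for kN
  proof -
    obtain k N where kN: "kN = (k, N)" by force
    have fiber: "{a. (\<lambda>(N, i, l). (i + l, N)) a = kN} = (\<lambda>i. (N, i, k - i)) ` {..k}"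
      by (auto simp: kN image_iff)
    have ex: "(k choose 2) + E (N, i, k - i) = (N\<^sup>2 + N * k + 2 * k\<^sup>2 + c * (k + N)) + (i choose 2) + N * (k - i)"
      if "i \<le> k" for i
    proof -
      obtain l where l: "k = i + l" using \<open>i \<le> k\<close> le_Suc_ex by blast
      show ?thesis unfolding E_def l
        by (simp add: choose_two_add choose_two_square[of l] power2_sum algebra_simps)
    qed
    \<comment> \<open>The extra factor q^(k choose 2) keeps all exponents natural and is cancelled
      at the end. The sum over i is then \<open>q_binomial\<close> with y = 1 and z = q^N.\<close>
    have "fps_X ^ (k choose 2) * (\<Sum>a\<in>{a. (\<lambda>(N, i, l). (i + l, N)) a = kN}. t a)
        = (\<Sum>i\<le>k. fps_X ^ (k choose 2) * t (N, i, k - i))"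
      unfolding fiber sum_distrib_left by (subst sum.reindex) (auto simp: inj_on_def)
    also have "\<dots> = (\<Sum>i\<le>k. fps_X ^ (N\<^sup>2 + N * k + 2 * k\<^sup>2 + c * (k + N)) * (-1) ^ k * iqfact N
        * ((-1) ^ i * fps_X ^ (i choose 2) * 1 ^ i * (fps_X ^ N) ^ (k - i) * iqfact i * iqfact (k - i)))"
    proof (intro sum.cong refl)
      fix i assume "i \<in> {..k}"
      then have i: "i \<le> k" by simp
      have "(-1) ^ (k - i) = (-1) ^ k * (-1) ^ i * (1 :: rat fps)"
        using i by (cases "even i"; cases "even k") simp_all
      then have "fps_X ^ (k choose 2) * t (N, i, k - i)
          = fps_X ^ ((k choose 2) + E (N, i, k - i)) * ((-1) ^ k * (-1) ^ i * iqfact N * iqfact i * iqfact (k - i))"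
        by (simp add: t_def power_add mult_ac)
      then show "fps_X ^ (k choose 2) * t (N, i, k - i) = fps_X ^ (N\<^sup>2 + N * k + 2 * k\<^sup>2 + c * (k + N)) * (-1) ^ k * iqfact N
        * ((-1) ^ i * fps_X ^ (i choose 2) * 1 ^ i * (fps_X ^ N) ^ (k - i) * iqfact i * iqfact (k - i))"
        unfolding ex[OF i] by (simp only: power_add power_mult power_one mult_ac mult_1)
    qed
    also have "\<dots> = fps_X ^ (N\<^sup>2 + N * k + 2 * k\<^sup>2 + c * (k + N)) * (-1) ^ k * iqfact k
        * (iqfact N * (\<Prod>j<k. fps_X ^ N - fps_X ^ j))"
      unfolding sum_distrib_left[symmetric] q_binomial by (simp add: mult_ac)
    also have "\<dots> = fps_X ^ (k choose 2) * s kN"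
    proof (cases "k \<le> N")
      case True
      have "((-1) ^ k * (-1) ^ k :: rat fps) = 1" by (cases "even k") simp_all
      then have *: "a * (-1) ^ k * b * ((-1) ^ k * d * e) = d * (a * (b * e))" for a b d e :: "rat fps"
        by (metis (no_types, lifting) mult.assoc mult.commute mult_1)
      show ?thesis unfolding prod_X_power_diff[OF True] * using True by (simp add: s_def kN)
    next
      case False
      \<comment> \<open>The factor with j = N is zero.\<close>
      then have "(\<Prod>j<k. fps_X ^ N - fps_X ^ j :: rat fps) = 0" by (intro prod_zero) auto
      then show ?thesis using False by (simp add: s_def kN)
    qed
    finally show ?thesis by simp
  qed
  have "fps_fsum t UNIV = fps_fsum (\<lambda>c. \<Sum>a\<in>{a \<in> UNIV. (\<lambda>(N, i, l). (i + l, N)) a = c}. t a) UNIV"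
  proof (rule fps_fsum_group[OF lf])
    fix kN :: "nat \<times> nat"
    have "{a \<in> UNIV. (\<lambda>(N, i, l). (i + l, N)) a = kN} \<subseteq> {snd kN} \<times> {..fst kN} \<times> {..fst kN}"
      by auto
    then show "finite {a \<in> UNIV. (\<lambda>(N, i, l). (i + l, N)) a = kN}" by (rule finite_subset) simp
  qed simp
  also have "\<dots> = fps_fsum s UNIV" by (simp add: s)
  also have "\<dots> = fps_fsum s ((\<lambda>(k1, k2). (k1, k1 + k2)) ` UNIV)"
  proof (rule fps_fsum_mono_neutral)
    fix kN :: "nat \<times> nat" assume *: "kN \<in> UNIV - (\<lambda>(k1, k2). (k1, k1 + k2)) ` UNIV"
    obtain k N where kN: "kN = (k, N)" by force
    have "\<not> k \<le> N"
    proof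
      assume "k \<le> N"
      then have "kN = (\<lambda>(k1, k2). (k1, k1 + k2)) (k, N - k)" by (simp add: kN)
      then show False using * by blast
    qed
    then show "s kN = 0" by (simp add: s_def kN)
  qed simp
  also have "\<dots> = fps_fsum (s \<circ> (\<lambda>(k1, k2). (k1, k1 + k2))) UNIV"
    by (rule fps_fsum_reindex) (auto simp: inj_on_def)
  also have "\<dots> = nahm_sum c"
    unfolding nahm_sum_def
    by (rule fps_fsum_cong) (auto simp: s_def power2_eq_square algebra_simps)
  finally have left: "fps_fsum t UNIV = nahm_sum c" .
  \<comment> \<open>Collected by b = N + l instead, the sum over l is \<open>q_binomial\<close> with
    y = q^(2i+1) and z = 1, whose product is (q)_(2i+b) / (q)_(2i).\<close>
  have r: "(\<Sum>a\<in>{a. (\<lambda>(N, i, l). (i, N + l)) a = ib}. t a)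
     = (\<lambda>(i, b). fps_X ^ (2 * i\<^sup>2 + i * b + b\<^sup>2 + c * (i + b))
     * (iqfact i * iqfact b * qfact (2 * i + b) * iqfact (2 * i))) ib" for ib
  proof -
    obtain i b where ib: "ib = (i, b)" by force
    have fiber: "{a. (\<lambda>(N, i, l). (i, N + l)) a = ib} = (\<lambda>l. (b - l, i, l)) ` {..b}"
      by (auto simp: ib image_iff)
    have ex: "E (b - l, i, l) = (2 * i\<^sup>2 + i * b + b\<^sup>2 + c * (i + b)) + (l choose 2) + (2 * i + 1) * l"
      if "l \<le> b" for l
    proof -
      obtain N where N: "b = N + l" using \<open>l \<le> b\<close> by (metis le_add_diff_inverse2)
      show ?thesis unfolding E_def N by (simp add: power2_eq_square algebra_simps)
    qed
    have "(\<Sum>a\<in>{a. (\<lambda>(N, i, l). (i, N + l)) a = ib}. t a) = (\<Sum>l\<le>b. t (b - l, i, l))"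
      unfolding fiber by (subst sum.reindex) (auto simp: inj_on_def)
    also have "\<dots> = (\<Sum>l\<le>b. fps_X ^ (2 * i\<^sup>2 + i * b + b\<^sup>2 + c * (i + b)) * iqfact i
        * ((-1) ^ l * fps_X ^ (l choose 2) * (fps_X ^ (2 * i + 1)) ^ l * 1 ^ (b - l) * iqfact l * iqfact (b - l)))"
    proof (intro sum.cong refl)
      fix l assume "l \<in> {..b}"
      then have l: "l \<le> b" by simp
      show "t (b - l, i, l) = fps_X ^ (2 * i\<^sup>2 + i * b + b\<^sup>2 + c * (i + b)) * iqfact i
        * ((-1) ^ l * fps_X ^ (l choose 2) * (fps_X ^ (2 * i + 1)) ^ l * 1 ^ (b - l) * iqfact l * iqfact (b - l))"
        unfolding t_def prod.case ex[OF l] power_mult[symmetric, of fps_X "2 * i + 1" l]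
        by (simp only: power_add power_one mult_ac mult_1)
    qed
    also have "\<dots> = fps_X ^ (2 * i\<^sup>2 + i * b + b\<^sup>2 + c * (i + b)) * iqfact i
        * (iqfact b * (qfact (2 * i + b) * iqfact (2 * i)))"
      unfolding sum_distrib_left[symmetric] q_binomial prod_one_minus_X_power ..
    finally show ?thesis by (simp add: ib mult_ac)
  qed
  have "fps_fsum t UNIV = fps_fsum (\<lambda>c. \<Sum>a\<in>{a \<in> UNIV. (\<lambda>(N, i, l). (i, N + l)) a = c}. t a) UNIV"
  proof (rule fps_fsum_group[OF lf])
    fix ib :: "nat \<times> nat"
    have "{a \<in> UNIV. (\<lambda>(N, i, l). (i, N + l)) a = ib} \<subseteq> {..snd ib} \<times> {fst ib} \<times> {..snd ib}"
      by auto
    then show "finite {a \<in> UNIV. (\<lambda>(N, i, l). (i, N + l)) a = ib}" by (rule finite_subset) simp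
  qed simp
  then show ?thesis unfolding left by (simp add: r)
qed

text \<open>
  The sum of \<open>wz_term i b\<close> over \<open>b\<close> is a limiting case of the very-well-poised 6-phi-5
  summation; \<open>wz_cert\<close> is its Wilf-Zeilberger certificate with respect to \<open>i\<close>.
\<close>

definition wz_term :: "nat \<Rightarrow> nat \<Rightarrow> rat fps" where
  "wz_term i b = fps_X ^ (i * b + b\<^sup>2) * (qfact (2 * i + b) * iqfact b
     - (if b = 0 then 0 else fps_X ^ i * qfact (2 * i + b - 1) * iqfact (b - 1)))"

definition wz_cert :: "nat \<Rightarrow> nat \<Rightarrow> rat fps" where
  "wz_cert i b = (if b = 0 then 0 else fps_X ^ (i * b + b\<^sup>2) * (qfact (2 * i + b - 1) * iqfact (b - 1)
     * (1 - fps_X ^ Suc i) * (1 - fps_X ^ i - fps_X ^ (2 * i + b))))"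

text \<open>In x = q^i, y = q^b and q all four terms share the factor P, and a polynomial identity
  remains. The case b = 0 stands apart because b - 1 is truncated there.\<close>

lemma wz_pair: "wz_term (Suc i) b - (1 - fps_X ^ Suc i) * wz_term i b = wz_cert i (Suc b) - wz_cert i b"
proof (cases b)
  case 0
  show ?thesis
    unfolding 0 wz_term_def wz_cert_def
    by (simp add: qfact_Suc numeral_2_eq_2) (simp add: algebra_simps power_add)
next
  case (Suc d)
  define x :: "rat fps" where "x = fps_X ^ i"
  define y :: "rat fps" where "y = fps_X ^ b"
  define q :: "rat fps" where "q = fps_X"
  define P where "P = fps_X ^ (i * b + b\<^sup>2) * qfact (2 * i + d) * iqfact b"
  have id: "iqfact d = (1 - y) * iqfact b" using iqfact_Suc[of d] by (simp add: Suc y_def)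
  have q1: "qfact (2 * i + b) = qfact (2 * i + d) * (1 - x\<^sup>2 * y)"
  proof -
    have "fps_X ^ Suc (2 * i + d) = x\<^sup>2 * y"
      unfolding x_def y_def Suc power_mult[symmetric] power_add[symmetric] by (simp add: mult.commute)
    then show ?thesis by (simp only: Suc add_Suc_right qfact_Suc)
  qed
  have q2: "qfact (2 * i + b + 1) = qfact (2 * i + d) * (1 - x\<^sup>2 * y) * (1 - x\<^sup>2 * y * q)"
  proof -
    have "fps_X ^ Suc (2 * i + b) = x\<^sup>2 * y * q"
      unfolding x_def y_def q_def power_mult[symmetric] power_add[symmetric] power_Suc2 by (simp add: mult.commute)
    then show ?thesis by (simp only: add_Suc_right qfact_Suc q1 Suc_eq_plus1[symmetric])
  qed
  have q3: "qfact (2 * i + b + 2) = qfact (2 * i + b + 1) * (1 - x\<^sup>2 * y * q\<^sup>2)"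
  proof -
    have "fps_X ^ Suc (2 * i + b + 1) = x\<^sup>2 * y * q\<^sup>2"
      unfolding x_def y_def q_def power_mult[symmetric] power_add[symmetric] by (simp add: mult.commute)
    then show ?thesis using qfact_Suc[of "2 * i + b + 1"] by simp
  qed
  have X1: "fps_X ^ (Suc i * b + b\<^sup>2) = fps_X ^ (i * b + b\<^sup>2) * y"
    by (simp add: y_def power_add mult_ac)
  have X2: "fps_X ^ (i * Suc b + (Suc b)\<^sup>2) = fps_X ^ (i * b + b\<^sup>2) * (x * y\<^sup>2 * q)"
    by (simp add: x_def y_def q_def power2_eq_square flip: power_add power_Suc power_Suc2)
  have si: "fps_X ^ Suc i = x * q" by (simp add: x_def q_def mult.commute)
  have t1: "wz_term (Suc i) b = P * (y * (1 - x\<^sup>2 * y) * (1 - x\<^sup>2 * y * q) * ((1 - x\<^sup>2 * y * q\<^sup>2) - x * q * (1 - y)))"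
  proof -
    have "2 * Suc i + b = 2 * i + b + 2" "2 * Suc i + b - 1 = 2 * i + b + 1" "b - 1 = d" "b \<noteq> 0"
      using Suc by auto
    then show ?thesis
      unfolding wz_term_def X1 P_def si by (simp only: q3 q2 id if_False) (simp add: algebra_simps)
  qed
  have t2: "wz_term i b = P * ((1 - x\<^sup>2 * y) - x * (1 - y))"
  proof -
    have "2 * i + b - 1 = 2 * i + d" "b - 1 = d" "b \<noteq> 0" using Suc by auto
    then show ?thesis
      unfolding wz_term_def P_def x_def[symmetric] by (simp only: q1 id if_False) (simp add: algebra_simps)
  qed
  have c1: "wz_cert i (Suc b) = P * (x * y\<^sup>2 * q * (1 - x\<^sup>2 * y) * (1 - x * q) * (1 - x - x\<^sup>2 * y * q))"
  proof -
    have "fps_X ^ (2 * i + Suc b) = x\<^sup>2 * y * q"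
      unfolding x_def y_def q_def power_mult[symmetric] power_add[symmetric] power_Suc2[symmetric]
      by (simp add: mult.commute)
    moreover have "2 * i + Suc b - 1 = 2 * i + b" "Suc b - 1 = b" "Suc b \<noteq> 0" by auto
    ultimately show ?thesis
      unfolding wz_cert_def P_def X2 si by (simp only: q1 if_False x_def[symmetric]) (simp add: algebra_simps)
  qed
  have c2: "wz_cert i b = P * ((1 - y) * (1 - x * q) * (1 - x - x\<^sup>2 * y))"
  proof -
    have "fps_X ^ (2 * i + b) = x\<^sup>2 * y"
      unfolding x_def y_def power_mult[symmetric] power_add[symmetric] by (simp add: mult.commute)
    moreover have "2 * i + b - 1 = 2 * i + d" "b - 1 = d" "b \<noteq> 0" using Suc by auto
    ultimately show ?thesis
      unfolding wz_cert_def P_def si by (simp only: id if_False x_def[symmetric]) (simp add: algebra_simps)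
  qed
  show ?thesis
    unfolding t1 t2 c1 c2 si by (simp only: right_diff_distrib[symmetric] mult.left_commute[of _ P])
      (rule arg_cong[where f = "(*) P"], algebra)
qed

lemma locally_finite_wz_term: "locally_finite (wz_term i) UNIV"
proof -
  have "finite {b. i * b + b\<^sup>2 \<le> n}" for n
  proof (rule finite_subset)
    show "{b. i * b + b\<^sup>2 \<le> n} \<subseteq> {..n}"
    proof
      fix b assume "b \<in> {b. i * b + b\<^sup>2 \<le> n}"
      moreover have "b \<le> b\<^sup>2" by (simp add: power2_eq_square)
      ultimately show "b \<in> {..n}" by simp
    qed
  qed simp
  then show ?thesis
    unfolding wz_term_def[abs_def] by (intro locally_finite_X_power) simp
qed

text \<open>The exponent i b + b^2 is at least b, so in each fixed coefficient the telescoping sum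
  over b has no contribution from infinity.\<close>

lemma wz_cert_nth: "n < b \<Longrightarrow> wz_cert i b $ n = 0"
proof -
  assume "n < b"
  moreover have "b \<le> i * b + b\<^sup>2" by (simp add: power2_eq_square trans_le_add2)
  ultimately show ?thesis by (simp add: wz_cert_def fps_X_power_mult_nth del: power_Suc)
qed

text \<open>At i = 0 every term with b > 0 cancels. Summing \<open>wz_pair\<close> over b telescopes
  to zero, so the sums obey the recursion of (q)_i.\<close>

lemma fps_fsum_wz_term: "fps_fsum (wz_term i) UNIV = qfact i"
proof (induction i)
  case 0
  have "wz_term 0 b = 0" if "b > 0" for b
    using that qfact_mult_iqfact[of "b - 1"] by (simp add: wz_term_def)
  then have "fps_fsum (wz_term 0) UNIV = fps_fsum (wz_term 0) {0}"
    by (intro fps_fsum_mono_neutral) auto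
  also have "\<dots> = 1"
    by (rule fps_ext) (subst fps_fsum_nth[of "{0}"], auto simp: wz_term_def)
  finally show ?case by simp
next
  case (Suc i)
  have "fps_fsum (\<lambda>b. wz_term (Suc i) b - (1 - fps_X ^ Suc i) * wz_term i b) UNIV = 0"
  proof (rule fps_ext)
    fix n
    let ?t = "\<lambda>b. wz_term (Suc i) b - (1 - fps_X ^ Suc i) * wz_term i b"
    have zero: "?t b $ n = 0" if "n < b" for b
      unfolding wz_pair using that by (simp add: wz_cert_nth)
    have "fps_fsum ?t UNIV $ n = (\<Sum>b<Suc n. ?t b $ n)"
      by (rule fps_fsum_nth) (simp, simp, rule zero, simp)
    also have "\<dots> = (\<Sum>b<Suc n. wz_cert i (Suc b) $ n - wz_cert i b $ n)"
      unfolding wz_pair by simp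
    also have "\<dots> = wz_cert i (Suc n) $ n - wz_cert i 0 $ n"
      by (rule sum_lessThan_telescope)
    also have "\<dots> = 0" by (simp add: wz_cert_nth) (simp add: wz_cert_def)
    finally show "fps_fsum ?t UNIV $ n = 0 $ n" by simp
  qed
  moreover have "fps_fsum (\<lambda>b. wz_term (Suc i) b - (1 - fps_X ^ Suc i) * wz_term i b) UNIV
      = fps_fsum (wz_term (Suc i)) UNIV - (1 - fps_X ^ Suc i) * fps_fsum (wz_term i) UNIV"
    by (subst fps_fsum_diff) (simp_all add: fps_fsum_cmult locally_finite_cmult locally_finite_wz_term del: power_Suc)
  ultimately show ?case
    unfolding Suc.IH qfact_Suc by (metis mult.commute right_minus_eq)
qed

lemma finite_pairs_le:
  fixes e :: "nat \<times> nat \<Rightarrow> nat" and n :: nat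
  assumes "\<And>a b. a \<le> e (a, b)" "\<And>a b. b \<le> e (a, b)"
  shows "finite {x. e x \<le> n}"
proof (rule finite_subset)
  show "{x. e x \<le> n} \<subseteq> {..n} \<times> {..n}"
  proof
    fix x assume x: "x \<in> {x. e x \<le> n}"
    obtain a b where "x = (a, b)" by force
    then show "x \<in> {..n} \<times> {..n}" using x assms(1)[of a b] assms(2)[of b a] by simp
  qed
qed simp

text \<open>Shifting b by one in the second sum turns it into the subtracted part of
  \<open>wz_term\<close>, because e (i, b + 1) + i = e (i, b) + 2 (i + b) + 1. The sum over b is
  then (q)_i, which cancels 1 / (q)_i.\<close>

lemma nahm_sum_diff:
  "nahm_sum 0 - fps_X * nahm_sum 2 = fps_fsum (\<lambda>i. fps_X ^ (2 * i\<^sup>2) * iqfact (2 * i)) UNIV"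
proof -
  define e where "e = (\<lambda>(i, b). 2 * i\<^sup>2 + i * b + b\<^sup>2 :: nat)"
  have fin: "finite {x. e x \<le> n}" for n
  proof (rule finite_pairs_le)
    fix a b :: nat
    have "a \<le> a\<^sup>2" "b \<le> b\<^sup>2" by (simp_all add: power2_eq_square)
    then show "a \<le> e (a, b)" "b \<le> e (a, b)" by (simp_all add: e_def)
  qed
  define u where "u = (\<lambda>(i, b). fps_X ^ e (i, b) * (iqfact i * iqfact b * qfact (2 * i + b) * iqfact (2 * i)))"
  define v where "v = (\<lambda>(i, b). fps_X ^ e (i, b) * (if b = 0 then 0
     else fps_X ^ i * iqfact i * iqfact (b - 1) * qfact (2 * i + b - 1) * iqfact (2 * i)))"
  have lfu: "locally_finite u UNIV"
    using locally_finite_X_power[where A = UNIV and e = e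
        and g = "\<lambda>(i, b). iqfact i * iqfact b * qfact (2 * i + b) * iqfact (2 * i)"] fin
    by (simp add: u_def case_prod_unfold)
  have lfv: "locally_finite v UNIV"
    using locally_finite_X_power[where A = UNIV and e = e
        and g = "\<lambda>(i, b). if b = 0 then 0
           else fps_X ^ i * iqfact i * iqfact (b - 1) * qfact (2 * i + b - 1) * iqfact (2 * i)"] fin
    by (simp add: v_def case_prod_unfold)
  have n0: "nahm_sum 0 = fps_fsum u UNIV"
    unfolding nahm_sum_eq by (rule fps_fsum_cong) (auto simp: u_def e_def)
  define w where "w = (\<lambda>(i, b). fps_X ^ (2 * i\<^sup>2 + i * b + b\<^sup>2 + 2 * (i + b))
     * (iqfact i * iqfact b * qfact (2 * i + b) * iqfact (2 * i)))"
  have lfw: "locally_finite w UNIV"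
  proof -
    have "finite {x. (\<lambda>(i, b). 2 * (i::nat)\<^sup>2 + i * b + b\<^sup>2 + 2 * (i + b)) x \<le> n}" for n
      by (rule finite_subset[OF _ fin[of n]]) (auto simp: e_def)
    then show ?thesis
      using locally_finite_X_power[where A = UNIV and e = "\<lambda>(i, b). 2 * i\<^sup>2 + i * b + b\<^sup>2 + 2 * (i + b)"
        and g = "\<lambda>(i, b). iqfact i * iqfact b * qfact (2 * i + b) * iqfact (2 * i)"]
      by (simp add: w_def case_prod_unfold)
  qed
  have "fps_X * nahm_sum 2 = fps_X * fps_fsum w UNIV"
    unfolding nahm_sum_eq by (rule arg_cong[where f = "(*) fps_X"], rule fps_fsum_cong) (auto simp: w_def)
  also have "\<dots> = fps_fsum (\<lambda>x. fps_X * w x) UNIV"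
    by (rule fps_fsum_cmult[symmetric, OF lfw])
  also have "\<dots> = fps_fsum (v \<circ> (\<lambda>(i, b). (i, Suc b))) UNIV"
  proof (rule fps_fsum_cong)
    fix x :: "nat \<times> nat"
    obtain i b where x: "x = (i, b)" by force
    have "e (i, Suc b) + i = Suc (2 * i\<^sup>2 + i * b + b\<^sup>2 + 2 * (i + b))"
      by (simp add: e_def power2_eq_square)
    then have "fps_X ^ e (i, Suc b) * fps_X ^ i = fps_X * fps_X ^ (2 * i\<^sup>2 + i * b + b\<^sup>2 + 2 * (i + b))"
      by (simp only: power_add[symmetric] power_Suc[symmetric])
    note * = this[symmetric]
    show "fps_X * w x = (v \<circ> (\<lambda>(i, b). (i, Suc b))) x"
      unfolding x w_def v_def o_def prod.case by (simp only: nat.simps if_False mult.assoc[symmetric] diff_Suc_1 add_Suc_right *)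
  qed
  also have "\<dots> = fps_fsum v ((\<lambda>(i, b). (i, Suc b)) ` UNIV)"
    by (rule fps_fsum_reindex[symmetric]) (auto simp: inj_on_def)
  also have "\<dots> = fps_fsum v UNIV"
  proof (rule fps_fsum_mono_neutral[symmetric])
    fix x :: "nat \<times> nat" assume *: "x \<in> UNIV - (\<lambda>(i, b). (i, Suc b)) ` UNIV"
    obtain i b where x: "x = (i, b)" by force
    have "b = 0"
    proof (rule ccontr)
      assume "b \<noteq> 0"
      then have "x = (\<lambda>(i, b). (i, Suc b)) (i, b - 1)" by (simp add: x)
      then show False using * by blast
    qed
    then show "v x = 0" by (simp add: x v_def)
  qed simp
  finally have n2: "fps_X * nahm_sum 2 = fps_fsum v UNIV" .
  have "nahm_sum 0 - fps_X * nahm_sum 2 = fps_fsum (\<lambda>x. u x - v x) UNIV"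
    unfolding n0 n2 by (rule fps_fsum_diff[symmetric, OF lfu lfv])
  also have "\<dots> = fps_fsum (\<lambda>i. fps_fsum (\<lambda>b. u (i, b) - v (i, b)) UNIV) UNIV"
    using fps_fsum_Sigma[of "\<lambda>x. u x - v x" UNIV UNIV] locally_finite_diff[OF lfu lfv] by simp
  also have "\<dots> = fps_fsum (\<lambda>i. fps_X ^ (2 * i\<^sup>2) * iqfact (2 * i)) UNIV"
  proof (rule fps_fsum_cong)
    fix i
    have "fps_fsum (\<lambda>b. u (i, b) - v (i, b)) UNIV
        = fps_fsum (\<lambda>b. (fps_X ^ (2 * i\<^sup>2) * iqfact i * iqfact (2 * i)) * wz_term i b) UNIV"
    proof (rule fps_fsum_cong)
      fix b
      have *: "fps_X ^ e (i, b) = (fps_X ^ (2 * i\<^sup>2) * fps_X ^ (i * b + b\<^sup>2) :: rat fps)"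
        by (simp add: e_def add.assoc flip: power_add)
      show "u (i, b) - v (i, b) = (fps_X ^ (2 * i\<^sup>2) * iqfact i * iqfact (2 * i)) * wz_term i b"
        unfolding u_def v_def wz_term_def prod.case * by (cases "b = 0") (simp_all add: algebra_simps)
    qed
    also have "\<dots> = (fps_X ^ (2 * i\<^sup>2) * iqfact i * iqfact (2 * i)) * qfact i"
      unfolding fps_fsum_cmult[OF locally_finite_wz_term] fps_fsum_wz_term ..
    also have "\<dots> = fps_X ^ (2 * i\<^sup>2) * iqfact (2 * i) * (qfact i * iqfact i)"
      by (simp only: mult_ac)
    finally show "fps_fsum (\<lambda>b. u (i, b) - v (i, b)) UNIV = fps_X ^ (2 * i\<^sup>2) * iqfact (2 * i)" by simp
  qed
  finally show ?thesis .
qed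

text \<open>The bracket is 1 - q^k1 (1 - q^k2). The factor 1 - q^k2 lowers (q)_k2 to (q)_(k2-1);
  after replacing k2 by k2 + 1 the exponent, including q^k1, exceeds the quadratic form by 2 (2 k1 +
  k2) + 1.\<close>

lemma has_sum_nahm:
  "((\<lambda>(k1 :: nat, k2 :: nat).
      fps_X ^ (4 * k1\<^sup>2 + 3 * k1 * k2 + k2\<^sup>2) / (qfact k1 * qfact k2)
        * (1 - fps_X ^ k1 + fps_X ^ (k1 + k2)))
    has_sum fps_fsum (\<lambda>i. fps_X ^ (2 * i\<^sup>2) * iqfact (2 * i)) UNIV) UNIV"
proof -
  define Q where "Q = (\<lambda>x. 4 * (fst x)\<^sup>2 + 3 * fst x * snd x + (snd x)\<^sup>2 :: nat)"
  have fin: "finite {x. Q x \<le> n}" for n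
  proof (rule finite_pairs_le)
    fix a b :: nat
    have "a \<le> a\<^sup>2" "b \<le> b\<^sup>2" by (simp_all add: power2_eq_square)
    then show "a \<le> Q (a, b)" "b \<le> Q (a, b)" by (simp_all add: Q_def)
  qed
  define f where "f = (\<lambda>(k1 :: nat, k2 :: nat).
      fps_X ^ (4 * k1\<^sup>2 + 3 * k1 * k2 + k2\<^sup>2) / (qfact k1 * qfact k2)
        * (1 - fps_X ^ k1 + fps_X ^ (k1 + k2)) :: rat fps)"
  define a where "a = (\<lambda>x. fps_X ^ Q x * (iqfact (fst x) * iqfact (snd x)))"
  define b where "b = (\<lambda>x. fps_X ^ Q x * (fps_X ^ fst x * iqfact (fst x) * ((1 - fps_X ^ snd x) * iqfact (snd x))))"
  define w where "w = (\<lambda>x. fps_X ^ Q x * (fps_X ^ (2 * (2 * fst x + snd x)) * (iqfact (fst x) * iqfact (snd x))))"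
  have lfa: "locally_finite a UNIV" and lfb: "locally_finite b UNIV" and lfw: "locally_finite w UNIV"
    unfolding a_def b_def w_def using fin by (auto intro!: locally_finite_X_power)
  have f: "f x = a x - b x" for x
  proof -
    obtain k1 k2 where x: "x = (k1, k2)" by force
    have "fps_X ^ (4 * k1\<^sup>2 + 3 * k1 * k2 + k2\<^sup>2) / (qfact k1 * qfact k2)
        = fps_X ^ (4 * k1\<^sup>2 + 3 * k1 * k2 + k2\<^sup>2) * (iqfact k1 * iqfact k2)"
      by (subst fps_divide_unit) (simp_all add: fps_inverse_mult iqfact_def)
    then show ?thesis
      by (simp add: f_def a_def b_def Q_def x power_add algebra_simps)
  qed
  have "fps_fsum a UNIV = nahm_sum 0"
    unfolding nahm_sum_def by (rule fps_fsum_cong) (auto simp: a_def Q_def)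
  moreover have "fps_fsum b UNIV = fps_X * nahm_sum 2"
  proof -
    have "fps_fsum b UNIV = fps_fsum b ((\<lambda>(i, j). (i, Suc j)) ` UNIV)"
    proof (rule fps_fsum_mono_neutral)
      fix x :: "nat \<times> nat" assume *: "x \<in> UNIV - (\<lambda>(i, b). (i, Suc b)) ` UNIV"
      obtain i j where x: "x = (i, j)" by force
      have "j = 0"
      proof (rule ccontr)
        assume "j \<noteq> 0"
        then have "x = (\<lambda>(i, b). (i, Suc b)) (i, j - 1)" by (simp add: x)
        then show False using * by blast
      qed
      then show "b x = 0" by (simp add: x b_def)
    qed simp
    also have "\<dots> = fps_fsum (b \<circ> (\<lambda>(i, j). (i, Suc j))) UNIV"
      by (rule fps_fsum_reindex) (auto simp: inj_on_def)
    also have "\<dots> = fps_fsum (\<lambda>x. fps_X * w x) UNIV"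
    proof (rule fps_fsum_cong)
      fix x :: "nat \<times> nat"
      obtain i j where x: "x = (i, j)" by force
      have "Q (i, Suc j) + i = Suc (Q (i, j) + 2 * (2 * i + j))"
        by (simp add: Q_def power2_eq_square)
      then have "fps_X ^ Q (i, Suc j) * fps_X ^ i = (fps_X * fps_X ^ Q (i, j) * fps_X ^ (2 * (2 * i + j)) :: rat fps)"
        by (simp flip: power_add power_Suc)
      then show "(b \<circ> (\<lambda>(i, j). (i, Suc j))) x = fps_X * w x"
        unfolding x b_def w_def o_def prod.case fst_conv snd_conv iqfact_Suc
        by (simp only: mult.assoc[symmetric])
    qed
    also have "\<dots> = fps_X * fps_fsum w UNIV" by (rule fps_fsum_cmult[OF lfw])
    also have "fps_fsum w UNIV = nahm_sum 2"
      unfolding nahm_sum_def by (rule fps_fsum_cong) (auto simp: w_def Q_def power_add mult_ac)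
    finally show ?thesis .
  qed
  ultimately have "fps_fsum (\<lambda>x. a x - b x) UNIV = fps_fsum (\<lambda>i. fps_X ^ (2 * i\<^sup>2) * iqfact (2 * i)) UNIV"
    by (simp add: fps_fsum_diff[OF lfa lfb] nahm_sum_diff)
  moreover have "((\<lambda>x. a x - b x) has_sum fps_fsum (\<lambda>x. a x - b x) UNIV) UNIV"
    by (rule has_sum_fps_fsum[OF locally_finite_diff[OF lfa lfb]])
  moreover have "f = (\<lambda>x. a x - b x)" by (rule ext) (rule f)
  ultimately have "(f has_sum fps_fsum (\<lambda>i. fps_X ^ (2 * i\<^sup>2) * iqfact (2 * i)) UNIV) UNIV"
    by (simp only:)
  then show ?thesis unfolding f_def .
qed

section \<open>Counting finite sets of natural numbers by cardinality and sum\<close>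

definition sum_sets :: "nat \<Rightarrow> nat \<Rightarrow> nat set set" where
  "sum_sets k n = {S. finite S \<and> card S = k \<and> \<Sum>S = n}"

lemma finite_sum_sets: "finite (sum_sets k n)"
proof (rule finite_subset)
  show "sum_sets k n \<subseteq> Pow {..n}"
    by (auto simp: sum_sets_def intro: member_le_sum[where f = "\<lambda>x. x", THEN order_trans])
qed simp

lemma sum_Suc_image: "\<Sum>(Suc ` S) = \<Sum>S + card S" if "finite S"
  using that by induction (auto simp: image_iff)

text \<open>After removal of 0, if present, all elements can be lowered by one, which lowers the sum
  by the number of remaining elements: k + 1 of them if 0 was absent, k otherwise.\<close>

lemma card_sum_sets_Suc:
  "card (sum_sets (Suc k) n) = (if Suc k \<le> n then card (sum_sets (Suc k) (n - Suc k)) else 0)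
     + (if k \<le> n then card (sum_sets k (n - k)) else 0)"
proof -
  let ?A = "if Suc k \<le> n then sum_sets (Suc k) (n - Suc k) else {}"
  let ?B = "if k \<le> n then sum_sets k (n - k) else {}"
  let ?f = "\<lambda>S. Suc ` S" and ?g = "\<lambda>S. insert 0 (Suc ` S)"
  have eq: "sum_sets (Suc k) n = ?f ` ?A \<union> ?g ` ?B"
  proof (intro set_eqI iffI)
    fix S assume S: "S \<in> sum_sets (Suc k) n"
    define T where "T = {i. Suc i \<in> S}"
    have ST: "S - {0} = Suc ` T" by (auto simp: T_def image_iff) (metis not0_implies_Suc)
    have fin: "finite S" "finite T"
      using S finite_imageD[of Suc T] ST by (auto simp: sum_sets_def) (metis finite_Diff finite_imageD inj_Suc)
    show "S \<in> ?f ` ?A \<union> ?g ` ?B"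
    proof (cases "0 \<in> S")
      case True
      then have S': "S = ?g T" using ST by auto
      have "card T = k" "n = \<Sum>T + k"
        using S fin S' by (auto simp: sum_sets_def sum_Suc_image card_image)
      then have "T \<in> ?B" using fin by (simp add: sum_sets_def)
      then show ?thesis using S' by blast
    next
      case False
      then have S': "S = ?f T" using ST by auto
      have "card T = Suc k" "n = \<Sum>T + Suc k"
        using S fin S' by (auto simp: sum_sets_def sum_Suc_image card_image)
      then have "T \<in> ?A" using fin by (simp add: sum_sets_def)
      then show ?thesis using S' by blast
    qed
  next
    fix S assume "S \<in> ?f ` ?A \<union> ?g ` ?B"
    then consider T where "Suc k \<le> n" "T \<in> sum_sets (Suc k) (n - Suc k)" "S = ?f T"
      | T where "k \<le> n" "T \<in> sum_sets k (n - k)" "S = ?g T"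
      by (auto split: if_splits)
    then show "S \<in> sum_sets (Suc k) n"
    proof cases
      case 1
      then have "finite T" "card T = Suc k" "\<Sum>T = n - Suc k" by (simp_all add: sum_sets_def)
      then show ?thesis using 1 by (simp add: sum_sets_def sum_Suc_image card_image)
    next
      case 2
      then have "finite T" "card T = k" "\<Sum>T = n - k" by (simp_all add: sum_sets_def)
      moreover have "\<Sum>(insert 0 (Suc ` T)) = \<Sum>(Suc ` T)" using \<open>finite T\<close> by simp
      ultimately show ?thesis
        using 2 unfolding sum_sets_def mem_Collect_eq by (simp only: sum_Suc_image) (simp add: card_image)
    qed
  qed
  have injf: "inj_on ?f ?A" and injg: "inj_on ?g ?B"
    by (auto simp: inj_on_def inj_image_eq_iff)+
  have "card (sum_sets (Suc k) n) = card (?f ` ?A) + card (?g ` ?B)"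
    unfolding eq by (rule card_Un_disjoint) (auto simp: finite_sum_sets)
  then show ?thesis using card_image[OF injf] card_image[OF injg] by auto
qed

lemma sum_sets_genfun:
  "Abs_fps (\<lambda>n. of_nat (card (sum_sets k n))) = fps_X ^ (k choose 2) * iqfact k"
proof (induction k)
  case 0
  have "sum_sets 0 n = (if n = 0 then {{}} else {})" for n
    by (auto simp: sum_sets_def)
  then show ?case by (auto simp: fps_eq_iff binomial_eq_0)
next
  case (Suc k)
  let ?A = "\<lambda>k. Abs_fps (\<lambda>n. of_nat (card (sum_sets k n))) :: rat fps"
  have "?A (Suc k) = fps_X ^ Suc k * ?A (Suc k) + fps_X ^ k * ?A k"
    by (rule fps_ext) (simp add: card_sum_sets_Suc[of k] fps_X_power_mult_nth not_less del: power_Suc)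
  then have "(1 - fps_X ^ Suc k) * ?A (Suc k) = fps_X ^ k * (fps_X ^ (k choose 2) * iqfact k)"
    unfolding Suc.IH by (simp only: left_diff_distrib mult_1) (simp add: algebra_simps)
  also have "fps_X ^ k * (fps_X ^ (k choose 2) * iqfact k) = fps_X ^ (Suc k choose 2) * iqfact k"
    by (simp add: numeral_2_eq_2 power_add)
  also have "\<dots> = (1 - fps_X ^ Suc k) * (fps_X ^ (Suc k choose 2) * iqfact (Suc k))"
    unfolding iqfact_Suc[of k, symmetric] by (simp only: mult_ac)
  finally show ?case
    using one_minus_X_power_nonzero[of "Suc k"] by (simp only: mult_cancel_left) simp
qed

text \<open>An element \<open>i\<close> stands for an occupied fermion level of weight i + 1/2; the
  equation is doubled to stay integral.\<close>

definition even_sets :: "nat \<Rightarrow> nat set set" where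
  "even_sets n = {S. finite S \<and> even (card S) \<and> (\<Sum>i\<in>S. 2 * i + 1) = 2 * n}"

lemma even_sets_eq: "even_sets n = (\<Union>m\<le>n. sum_sets (2 * m) (n - m))"
proof -
  have eq: "(\<Sum>i\<in>S. 2 * i + 1) = 2 * \<Sum>S + card S" for S :: "nat set"
    by (cases "finite S") (simp_all only: sum.distrib sum_distrib_left card_eq_sum sum.infinite)
  show ?thesis
  proof (intro set_eqI iffI)
    fix S assume S: "S \<in> even_sets n"
    then obtain m where m: "card S = 2 * m" by (auto simp: even_sets_def)
    then have "\<Sum>S + m = n" using S unfolding even_sets_def eq by auto
    then have "m \<le> n" "S \<in> sum_sets (2 * m) (n - m)"
      using S m by (auto simp: sum_sets_def even_sets_def)
    then show "S \<in> (\<Union>m\<le>n. sum_sets (2 * m) (n - m))" by blast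
  next
    fix S assume "S \<in> (\<Union>m\<le>n. sum_sets (2 * m) (n - m))"
    then obtain m where "m \<le> n" "finite S" "card S = 2 * m" "\<Sum>S = n - m"
      by (auto simp: sum_sets_def)
    moreover from this have "(\<Sum>i\<in>S. 2 * i + 1) = 2 * n" unfolding eq by simp
    ultimately show "S \<in> even_sets n" by (simp add: even_sets_def)
  qed
qed

lemma finite_even_sets: "finite (even_sets n)"
  by (simp add: even_sets_eq finite_sum_sets)

lemma even_sets_genfun:
  "Abs_fps (\<lambda>n. of_nat (card (even_sets n))) = fps_fsum (\<lambda>m. fps_X ^ (2 * m\<^sup>2) * iqfact (2 * m)) UNIV"
proof (rule fps_ext)
  fix n
  have coeff: "(fps_X ^ (2 * m\<^sup>2) * iqfact (2 * m)) $ n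
      = (if m \<le> n then of_nat (card (sum_sets (2 * m) (n - m))) else 0)" for m
  proof -
    \<comment> \<open>The 2m halves contribute m, and (2m choose 2) is the least sum of 2m distinct
      naturals.\<close>
    have "2 * m\<^sup>2 = m + (2 * m choose 2)"
      using choose_two_square[of "2 * m"] by (simp add: power_mult_distrib)
    then have "fps_X ^ (2 * m\<^sup>2) * iqfact (2 * m) = fps_X ^ m * Abs_fps (\<lambda>n. of_nat (card (sum_sets (2 * m) n)))"
      unfolding sum_sets_genfun by (simp only: power_add mult.assoc)
    then show ?thesis by (simp only: fps_X_power_mult_nth fps_nth_Abs_fps not_less split: if_split) auto
  qed
  have "card (even_sets n) = (\<Sum>m\<le>n. card (sum_sets (2 * m) (n - m)))"
    unfolding even_sets_eq
    by (rule card_UN_disjoint) (auto simp: finite_sum_sets, auto simp: sum_sets_def)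
  moreover have "fps_fsum (\<lambda>m. fps_X ^ (2 * m\<^sup>2) * iqfact (2 * m)) UNIV $ n
      = (\<Sum>m\<le>n. (fps_X ^ (2 * m\<^sup>2) * iqfact (2 * m)) $ n)"
    by (rule fps_fsum_nth) (auto simp: coeff)
  ultimately show "Abs_fps (\<lambda>n. of_nat (card (even_sets n))) $ n
      = fps_fsum (\<lambda>m. fps_X ^ (2 * m\<^sup>2) * iqfact (2 * m)) UNIV $ n"
    by (simp add: coeff)
qed

subsection \<open>The fermionic Fock space\<close>

text \<open>
  Functions on finite sets of natural numbers; the operators act by pulling back, so that no
  finiteness of supports is needed. Values at infinite sets carry no information, and every
  operator makes them zero. The operator \<open>psi k\<close> is the fermion mode of index \<open>k + 1/2\<close>.
\<close>

type_synonym fock = "nat set \<Rightarrow> complex"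

definition fock_scale :: "complex \<Rightarrow> fock \<Rightarrow> fock" where
  "fock_scale a v = (\<lambda>S. a * v S)"

lemma fock_scale_apply [simp]: "fock_scale a v S = a * v S"
  by (simp add: fock_scale_def)

interpretation fock: vector_space fock_scale
  by unfold_locales (auto simp: fun_eq_iff algebra_simps)

lemma sum_fock_apply: "(\<Sum>a\<in>A. f a) S = (\<Sum>a\<in>A. f a S)" for f :: "'i \<Rightarrow> fock"
  by (induction A rule: infinite_finite_induct) auto

text \<open>The Jordan-Wigner sign, which makes the modes of different levels anticommute.\<close>

definition fsign :: "nat \<Rightarrow> nat set \<Rightarrow> complex" where
  "fsign i S = (-1) ^ card {j\<in>S. j < i}"

lemma fsign_square [simp]: "fsign i S * fsign i S = 1"
  by (cases "even (card {j\<in>S. j < i})") (simp_all add: fsign_def)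

lemma fsign_square_left [simp]: "fsign i S * (fsign i S * x) = x"
  by (simp flip: mult.assoc)

lemma fsign_nonzero [simp]: "fsign i S \<noteq> 0"
  by (simp add: fsign_def)

lemma fsign_insert:
  assumes "finite S" "j \<notin> S"
  shows "fsign i (insert j S) = (if j < i then - fsign i S else fsign i S)"
proof -
  have "{x \<in> insert j S. x < i} = (if j < i then insert j {x\<in>S. x < i} else {x\<in>S. x < i})" by auto
  then show ?thesis using assms by (auto simp: fsign_def)
qed

lemma fsign_remove:
  assumes "finite S" "j \<in> S"
  shows "fsign i (S - {j}) = (if j < i then - fsign i S else fsign i S)"
  using fsign_insert[of "S - {j}" j i] assms by (auto simp: insert_absorb)

text \<open>The unit of the Clifford relations: all modes vanish at infinite sets, so an
  anticommutator can be the identity at finite sets only.\<close>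

definition fcut :: "fock \<Rightarrow> fock" where
  "fcut v S = (if finite S then v S else 0)"

definition ann :: "nat \<Rightarrow> fock \<Rightarrow> fock" where
  "ann i v S = (if finite S \<and> i \<notin> S then fsign i S * v (insert i S) else 0)"

definition cre :: "nat \<Rightarrow> fock \<Rightarrow> fock" where
  "cre i v S = (if finite S \<and> i \<in> S then fsign i S * v (S - {i}) else 0)"

definition psi :: "int \<Rightarrow> fock \<Rightarrow> fock" where
  "psi k = (if k \<ge> 0 then ann (nat k) else cre (nat (- k - 1)))"

lemma ann_ann: "ann i (ann j v) S = - ann j (ann i v) S"
proof (cases "finite S \<and> i \<notin> S \<and> j \<notin> S \<and> i \<noteq> j")
  case True
  moreover have "insert i (insert j S) = insert j (insert i S)" by auto
  ultimately show ?thesis by (cases "i < j") (auto simp: ann_def fsign_insert)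
qed (auto simp: ann_def)

lemma cre_cre: "cre i (cre j v) S = - cre j (cre i v) S"
proof (cases "finite S \<and> i \<in> S \<and> j \<in> S \<and> i \<noteq> j")
  case True
  moreover have "S - {i} - {j} = S - {j} - {i}" by auto
  ultimately show ?thesis by (cases "i < j") (auto simp: cre_def fsign_remove)
qed (auto simp: cre_def)

lemma ann_cre: "ann i (cre j v) S = (if i = j then fcut v S else 0) - cre j (ann i v) S"
proof (cases "i = j")
  case True
  then show ?thesis
    by (auto simp: ann_def cre_def fcut_def fsign_insert fsign_remove insert_absorb)
next
  case False
  show ?thesis
  proof (cases "finite S \<and> i \<notin> S \<and> j \<in> S")
    case True
    moreover have "insert i S - {j} = insert i (S - {j})" using False by auto
    ultimately show ?thesis
      using False by (cases "i < j") (auto simp: ann_def cre_def fsign_insert fsign_remove)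
  qed (use False in \<open>auto simp: ann_def cre_def\<close>)
qed

text \<open>The indices stand for the modes j + 1/2 and k + 1/2, so opposite modes are those with j
  + k = -1.\<close>

lemma clifford_apply: "psi j (psi k v) S + psi k (psi j v) S = (if j + k = - 1 then fcut v S else 0)"
proof -
  consider "j \<ge> 0" "k \<ge> 0" | "j < 0" "k < 0" | "j \<ge> 0" "k < 0" | "j < 0" "k \<ge> 0" by linarith
  then show ?thesis
  proof cases
    case 1 then show ?thesis using ann_ann[of "nat j" "nat k" v S] by (simp add: psi_def)
  next
    case 2 then show ?thesis using cre_cre[of "nat (- j - 1)" "nat (- k - 1)" v S] by (simp add: psi_def)
  next
    case 3
    then have "nat j = nat (- k - 1) \<longleftrightarrow> j + k = - 1" by auto
    then show ?thesis using ann_cre[of "nat j" "nat (- k - 1)" v S] 3 by (simp add: psi_def)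
  next
    case 4
    then have "nat k = nat (- j - 1) \<longleftrightarrow> j + k = - 1" by auto
    then show ?thesis using ann_cre[of "nat k" "nat (- j - 1)" v S] 4 by (simp add: psi_def)
  qed
qed

lemma clifford: "psi j (psi k v) = (if j + k = - 1 then fcut v else 0) - psi k (psi j v)"
  using clifford_apply[of j k v] by (auto simp: fun_eq_iff algebra_simps)

lemma psi_add: "psi k (u + v) = psi k u + psi k v"
  and psi_diff: "psi k (u - v) = psi k u - psi k v"
  and psi_minus: "psi k (- v) = - psi k v"
  and psi_scale: "psi k (fock_scale a v) = fock_scale a (psi k v)"
  and psi_zero [simp]: "psi k 0 = 0"
  and psi_fcut [simp]: "psi k (fcut v) = psi k v"
  and fcut_psi [simp]: "fcut (psi k v) = psi k v"
  by (auto simp: psi_def ann_def cre_def fcut_def fun_eq_iff algebra_simps)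

lemma psi_sum: "psi k (\<Sum>a\<in>A. f a) = (\<Sum>a\<in>A. psi k (f a))"
  by (induction A rule: infinite_finite_induct)
    (simp_all only: sum.infinite sum.empty sum.insert psi_add psi_zero not_False_eq_True)

section \<open>Weight, parity, and the Virasoro modes as fermion bilinears\<close>

definition fwt :: "nat set \<Rightarrow> int" where
  "fwt S = (\<Sum>i\<in>S. 2 * int i + 1)"

lemma fwt_empty [simp]: "fwt {} = 0" by (simp add: fwt_def)

lemma fwt_insert: "finite S \<Longrightarrow> i \<notin> S \<Longrightarrow> fwt (insert i S) = fwt S + (2 * int i + 1)"
  by (simp add: fwt_def)

lemma fwt_remove: "finite S \<Longrightarrow> i \<in> S \<Longrightarrow> fwt (S - {i}) = fwt S - (2 * int i + 1)"
  by (simp add: fwt_def sum_diff1)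

lemma fwt_nonneg: "fwt S \<ge> 0" by (simp add: fwt_def sum_nonneg)

lemma fwt_bound: "finite S \<Longrightarrow> i \<in> S \<Longrightarrow> 2 * int i + 1 \<le> fwt S"
  unfolding fwt_def by (rule member_le_sum) auto

lemma fwt_eq_0: "finite S \<Longrightarrow> fwt S = 0 \<longleftrightarrow> S = {}"
  using fwt_bound by fastforce

text \<open>A mode reads a single coordinate of \<open>v\<close>, with a coefficient independent of
  \<open>v\<close>; hence pointwise arguments work for functions of arbitrary support. If the Pauli
  principle blocks the mode at \<open>S\<close>, then e = 0 and \<open>S'\<close> carries no
  information.\<close>

lemma psi_eval:
  assumes "finite S"
  obtains e S' where "finite S'" "\<And>v. psi k v S = e * v S'"
    "e \<noteq> 0 \<Longrightarrow> fwt S' = fwt S + (2 * k + 1) \<and> even (card S') \<noteq> even (card S)"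
proof (cases "k \<ge> 0")
  case True
  show thesis
  proof (rule that[of "insert (nat k) S" "if nat k \<in> S then 0 else fsign (nat k) S"])
    show "(if nat k \<in> S then 0 else fsign (nat k) S) \<noteq> 0 \<Longrightarrow>
       fwt (insert (nat k) S) = fwt S + (2 * k + 1) \<and> even (card (insert (nat k) S)) \<noteq> even (card S)"
      using assms True by (auto simp: fwt_insert split: if_splits)
  qed (use assms True in \<open>auto simp: psi_def ann_def\<close>)
next
  case False
  let ?i = "nat (- k - 1)"
  show thesis
  proof (rule that[of "S - {?i}" "if ?i \<in> S then fsign ?i S else 0"])
    show "(if ?i \<in> S then fsign ?i S else 0) \<noteq> 0 \<Longrightarrow>
       fwt (S - {?i}) = fwt S + (2 * k + 1) \<and> even (card (S - {?i})) \<noteq> even (card S)"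
      using assms False card.remove[OF assms, of ?i] by (auto simp: fwt_remove split: if_splits)
  qed (use assms False in \<open>auto simp: psi_def cre_def\<close>)
qed

text \<open>\<open>h\<close> is twice the conformal weight, and \<open>p = True\<close> means even
  fermion number.\<close>

definition homog :: "int \<Rightarrow> bool \<Rightarrow> fock \<Rightarrow> bool" where
  "homog h p v \<longleftrightarrow> (\<forall>S. v S \<noteq> 0 \<longrightarrow> finite S \<and> fwt S = h \<and> even (card S) = p)"

lemma homog_psi: "homog h p v \<Longrightarrow> homog (h - (2 * k + 1)) (\<not> p) (psi k v)"
  unfolding homog_def
proof (intro allI impI)
  fix S assume v: "\<forall>S. v S \<noteq> 0 \<longrightarrow> finite S \<and> fwt S = h \<and> even (card S) = p" and S: "psi k v S \<noteq> 0"
  have fin: "finite S" using S by (auto simp: psi_def ann_def cre_def split: if_splits)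
  obtain e S' where S': "psi k v S = e * v S'"
    "e \<noteq> 0 \<Longrightarrow> fwt S' = fwt S + (2 * k + 1) \<and> even (card S') \<noteq> even (card S)"
    using psi_eval[OF fin, of k] by metis
  have nz: "v S' \<noteq> 0" "e \<noteq> 0" using S S'(1) by auto
  have "fwt S' = h" "even (card S') = p" using v nz(1) by blast+
  then show "finite S \<and> fwt S = h - (2 * k + 1) \<and> even (card S) = (\<not> p)"
    using S'(2)[OF nz(2)] fin by auto
qed

lemma homog_zero: "homog h p 0"
  and homog_minus: "homog h p u \<Longrightarrow> homog h p (- u)"
  and homog_scale: "homog h p u \<Longrightarrow> homog h p (fock_scale a u)"
  by (simp_all add: homog_def)

lemma homog_add:
  assumes "homog h p u" "homog h p v" shows "homog h p (u + v)"
  unfolding homog_def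
proof (intro allI impI)
  fix S assume "(u + v) S \<noteq> 0"
  then have "u S \<noteq> 0 \<or> v S \<noteq> 0" by auto
  then show "finite S \<and> fwt S = h \<and> even (card S) = p" using assms unfolding homog_def by blast
qed

text \<open>Normal ordering: an annihilator \<open>b\<close> already stands on the right, and
  otherwise the factors are exchanged with a sign, which changes the operator only if a + b =
  -1.\<close>

definition nop :: "int \<Rightarrow> int \<Rightarrow> fock \<Rightarrow> fock" where
  "nop a b v = (if b \<ge> 0 then psi a (psi b v) else - psi b (psi a v))"

lemma nop_add: "nop a b (u + v) = nop a b u + nop a b v"
  and nop_scale: "nop a b (fock_scale c v) = fock_scale c (nop a b v)"
  by (auto simp: nop_def psi_add psi_scale fun_eq_iff)

text \<open>Normal ordering alters a product by at most a multiple of \<open>fcut\<close>, which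
  drops out of the commutator; so one formula serves both orders.\<close>

lemma nop_psi: "nop a b (psi s v) = psi s (nop a b v)
  + (if b + s = - 1 then psi a v else 0) - (if a + s = - 1 then psi b v else 0)"
proof -
  have 1: "psi x (psi y (psi s v)) = psi s (psi x (psi y v))
    + (if y + s = - 1 then psi x v else 0) - (if x + s = - 1 then psi y v else 0)" for x y
    by (subst clifford[of y s v], subst psi_diff, subst clifford[of x s]) (auto simp: algebra_simps)
  show ?thesis
    unfolding nop_def using 1[of a b] 1[of b a] by (auto simp: psi_minus)
qed

lemma homog_nop: "homog h p v \<Longrightarrow> homog (h - 2 * (a + b + 1)) p (nop a b v)"
  using homog_psi[OF homog_psi[of h p v b], of a] homog_minus[OF homog_psi[OF homog_psi[of h p v a], of b]]
  by (auto simp: nop_def algebra_simps)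

definition vbound :: "int \<Rightarrow> nat set \<Rightarrow> int" where
  "vbound n S = \<bar>n\<bar> + fwt S + 1"

text \<open>If the left factor of the ordered product creates, its level must be in
  \<open>S\<close>, so its index is at least - fwt S - 1. The other bound on \<open>a\<close> comes
  from the sign of n - 1 - a. The infinite sum for L_n is thus finite at every point, whatever
  \<open>v\<close> is.\<close>

lemma nop_bound:
  assumes S: "finite S" and nz: "nop a (n - 1 - a) v S \<noteq> 0"
  shows "a \<in> {- vbound n S .. vbound n S}"
proof -
  have neg: "psi k w S \<noteq> 0 \<Longrightarrow> k < 0 \<Longrightarrow> - k \<le> fwt S + 1" for k w
    using fwt_bound[OF S, of "nat (- k - 1)"] by (auto simp: psi_def cre_def split: if_splits)
  have "fwt S \<ge> 0" by (rule fwt_nonneg)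
  show ?thesis
  proof (cases "n - 1 - a \<ge> 0")
    case True
    then have "psi a (psi (n - 1 - a) v) S \<noteq> 0" using nz by (simp add: nop_def)
    then have "a < 0 \<Longrightarrow> - a \<le> fwt S + 1" by (rule neg)
    then show ?thesis using True \<open>fwt S \<ge> 0\<close> by (cases "a < 0") (auto simp: vbound_def)
  next
    case False
    then have "psi (n - 1 - a) (psi a v) S \<noteq> 0" using nz by (simp add: nop_def)
    then have "- (n - 1 - a) \<le> fwt S + 1" by (rule neg) (use False in simp)
    then show ?thesis using False \<open>fwt S \<ge> 0\<close> by (auto simp: vbound_def)
  qed
qed

text \<open>With r = a + 1/2 and s = n - r the coefficient is (s - r) / 4, the antisymmetrised form
  of the usual bilinear expression for L_n. By \<open>nop_bound\<close> the window contains all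
  nonzero terms.\<close>

definition vir_op :: "int \<Rightarrow> fock \<Rightarrow> fock" where
  "vir_op n v S = (if finite S then \<Sum>a\<in>{- vbound n S .. vbound n S}.
     of_int (n - 1 - 2 * a) / 4 * nop a (n - 1 - a) v S else 0)"

lemma vir_op_eq:
  assumes "finite S" "finite J" "\<And>a. nop a (n - 1 - a) v S \<noteq> 0 \<Longrightarrow> a \<in> J"
  shows "vir_op n v S = (\<Sum>a\<in>J. of_int (n - 1 - 2 * a) / 4 * nop a (n - 1 - a) v S)"
proof -
  let ?f = "\<lambda>a. of_int (n - 1 - 2 * a) / 4 * nop a (n - 1 - a) v S"
  let ?K = "{- vbound n S .. vbound n S}"
  have "sum ?f ?K = sum ?f (?K \<union> J)"
    by (rule sum.mono_neutral_left) (use assms nop_bound[OF assms(1)] in auto)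
  also have "\<dots> = sum ?f J"
    by (rule sum.mono_neutral_right) (use assms in auto)
  finally show ?thesis using assms by (simp add: vir_op_def)
qed

lemma vir_op_interval:
  assumes "finite S" "vbound n S \<le> K"
  shows "vir_op n v S = (\<Sum>a\<in>{- K .. K}. of_int (n - 1 - 2 * a) / 4 * nop a (n - 1 - a) v S)"
  using nop_bound[OF assms(1)] assms(2) by (intro vir_op_eq[OF assms(1)]) force+

lemma vir_op_infinite: "infinite S \<Longrightarrow> vir_op n v S = 0"
  by (simp add: vir_op_def)

lemma vir_op_add: "vir_op n (u + v) = vir_op n u + vir_op n v"
  and vir_op_scale: "vir_op n (fock_scale c v) = fock_scale c (vir_op n v)"
  by (auto simp: vir_op_def fun_eq_iff nop_add nop_scale sum.distrib algebra_simps sum_distrib_left)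

lemma vir_op_zero [simp]: "vir_op n 0 = 0"
  using vir_op_scale[of n 0 0] by (simp add: fun_eq_iff fock_scale_def zero_fun_def)

lemma vir_op_minus: "vir_op n (- v) = - vir_op n v"
  using vir_op_scale[of n "-1" v] by (simp add: fock_scale_def fun_Compl_def)

lemma vir_op_diff: "vir_op n (u - v) = vir_op n u - vir_op n v"
  using vir_op_add[of n u "- v"] by (simp add: vir_op_minus)

lemma homog_vir_op: "homog h p v \<Longrightarrow> homog (h - 2 * n) p (vir_op n v)"
  unfolding homog_def
proof (intro allI impI)
  fix S assume v: "\<forall>S. v S \<noteq> 0 \<longrightarrow> finite S \<and> fwt S = h \<and> even (card S) = p" and S: "vir_op n v S \<noteq> 0"
  have "finite S" using S vir_op_infinite by blast
  then have "(\<Sum>a\<in>{- vbound n S .. vbound n S}. of_int (n - 1 - 2 * a) / 4 * nop a (n - 1 - a) v S) \<noteq> 0"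
    using S by (simp add: vir_op_def)
  then obtain a where a: "of_int (n - 1 - 2 * a) / 4 * nop a (n - 1 - a) v S \<noteq> 0"
    by (rule sum.not_neutral_contains_not_neutral)
  have "homog (h - 2 * (a + (n - 1 - a) + 1)) p (nop a (n - 1 - a) v)"
    by (rule homog_nop) (use v in \<open>unfold homog_def, blast\<close>)
  then have "finite S \<and> fwt S = h - 2 * (a + (n - 1 - a) + 1) \<and> even (card S) = p"
    unfolding homog_def using a by (metis mult_zero_right)
  then show "finite S \<and> fwt S = h - 2 * n \<and> even (card S) = p" by simp
qed

text \<open>The fermion is primary of weight 1/2: [L_n, psi_r] = -(n/2 + r) psi_(n+r) with r = s +
  1/2. Only the summands a = n + s and a = -1 - s fail to commute with the mode, and they contribute
  equally.\<close>

lemma vir_op_psi: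
  "vir_op n (psi s v) = psi s (vir_op n v) - fock_scale (of_int (n + 2 * s + 1) / 2) (psi (n + s) v)"
proof
  fix S
  show "vir_op n (psi s v) S = (psi s (vir_op n v) - fock_scale (of_int (n + 2 * s + 1) / 2) (psi (n + s) v)) S"
  proof (cases "finite S")
    case True
    obtain e S' where S': "finite S'" "\<And>v. psi s v S = e * v S'"
      using psi_eval[OF True, of s] by metis
    \<comment> \<open>Wide enough for the windows at \<open>S\<close> and \<open>S'\<close> and for
      both exceptional indices.\<close>
    define K where "K = vbound n S + vbound n S' + \<bar>n\<bar> + \<bar>s\<bar>"
    have K: "vbound n S \<le> K" "vbound n S' \<le> K" "n + s \<in> {- K .. K}" "- 1 - s \<in> {- K .. K}"
      using fwt_nonneg[of S] fwt_nonneg[of S'] by (auto simp: K_def vbound_def)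
    let ?c = "\<lambda>a. of_int (n - 1 - 2 * a) / 4 :: complex"
    have "vir_op n (psi s v) S = (\<Sum>a\<in>{- K .. K}. ?c a * nop a (n - 1 - a) (psi s v) S)"
      by (rule vir_op_interval[OF True K(1)])
    also have "\<dots> = (\<Sum>a\<in>{- K .. K}. ?c a * psi s (nop a (n - 1 - a) v) S
        + (if n + s = a then ?c a * psi a v S else 0) - (if - 1 - s = a then ?c a * psi (n - 1 - a) v S else 0))"
    proof (intro sum.cong refl)
      fix a
      have iff: "n - 1 - a + s = - 1 \<longleftrightarrow> n + s = a" "a + s = - 1 \<longleftrightarrow> - 1 - s = a" by auto
      have if_apply: "(if b then f else 0) S = (if b then f S else 0)" for b and f :: fock by simp
      show "?c a * nop a (n - 1 - a) (psi s v) S = ?c a * psi s (nop a (n - 1 - a) v) S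
        + (if n + s = a then ?c a * psi a v S else 0) - (if - 1 - s = a then ?c a * psi (n - 1 - a) v S else 0)"
        unfolding nop_psi iff plus_fun_apply fun_diff_def if_apply
        by (simp only: ring_distribs mult_zero_right if_distrib[of "(*) (?c a)"])
    qed
    also have "\<dots> = (\<Sum>a\<in>{- K .. K}. ?c a * psi s (nop a (n - 1 - a) v) S)
        + ?c (n + s) * psi (n + s) v S - ?c (- 1 - s) * psi (n - 1 - (- 1 - s)) v S"
      using K(3,4) by (simp only: sum.distrib sum_subtractf sum.delta' sum.delta finite_atLeastAtMost_int if_True)
    also have "(\<Sum>a\<in>{- K .. K}. ?c a * psi s (nop a (n - 1 - a) v) S) = psi s (vir_op n v) S"
      unfolding S'(2) vir_op_interval[OF S'(1) K(2)] by (simp add: sum_distrib_left mult_ac)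
    also have "n - 1 - (- 1 - s) = n + s" by simp
    finally have "vir_op n (psi s v) S
        = psi s (vir_op n v) S + ?c (n + s) * psi (n + s) v S - ?c (- 1 - s) * psi (n + s) v S" .
    moreover have "?c (n + s) * x - ?c (- 1 - s) * x = - (of_int (n + 2 * s + 1) / 2 * x)" for x
      by (simp add: field_simps)
    ultimately show ?thesis
      by (simp only: fun_diff_def fock_scale_apply) (metis add_diff_eq uminus_add_conv_diff add.commute)
  qed (simp add: vir_op_infinite psi_def ann_def cre_def)
qed

definition evac :: "nat set \<Rightarrow> fock" where
  "evac T S = (if S = T then 1 else 0)"

lemma psi_evac_empty: "k \<ge> 0 \<Longrightarrow> psi k (evac {}) = 0"
  by (auto simp: psi_def ann_def evac_def fun_eq_iff)

lemma vir_op_vacuum: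
  assumes "n \<ge> - 1" shows "vir_op n (evac {}) = 0"
proof
  fix S
  have "of_int (n - 1 - 2 * a) / 4 * nop a (n - 1 - a) (evac {}) S = 0" for a
  proof -
    \<comment> \<open>In the last case both factors are the same creator, and the coefficient n - 1
      - 2a is 0.\<close>
    consider "n - 1 - a \<ge> 0" | "n - 1 - a < 0" "a \<ge> 0" | "n = - 1" "a = - 1" using assms by linarith
    then show ?thesis by cases (simp_all add: nop_def psi_evac_empty)
  qed
  then show "vir_op n (evac {}) S = 0 S" by (simp only: vir_op_def sum.neutral_const zero_fun_apply if_cancel)
qed

lemma psi_neg_at_empty: "k < 0 \<Longrightarrow> psi k v {} = 0"
  by (simp add: psi_def cre_def)

text \<open>Reads a coordinate through an annihilator; iterated, it reduces a value at a finite set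
  to values at \<open>{}\<close>.\<close>

lemma psi_at: "finite S \<Longrightarrow> i \<notin> S \<Longrightarrow> v (insert i S) = fsign i S * psi (int i) v S"
  by (simp add: psi_def ann_def)

subsection \<open>The Virasoro relations on Fock space\<close>

definition vir_defect :: "int \<Rightarrow> int \<Rightarrow> fock \<Rightarrow> fock" where
  "vir_defect m n v = vir_op m (vir_op n v) - vir_op n (vir_op m v)
     - fock_scale (of_int (m - n)) (vir_op (m + n) v)"

text \<open>The coefficients in \<open>vir_op_psi\<close> represent the Witt algebra on the modes,
  so the Jacobi identity leaves nothing of the commutator between the defect and a mode.\<close>

lemma vir_defect_psi: "vir_defect m n (psi s v) = psi s (vir_defect m n v)"
proof
  fix S
  have idx: "n + (m + s) = m + (n + s)" "m + n + s = m + (n + s)" by simp_all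
  let ?x = "psi (m + (n + s)) v S"
  have "vir_defect m n (psi s v) S - psi s (vir_defect m n v) S
     = (of_int (n + 2 * s + 1) / 2 * (of_int (m + 2 * (n + s) + 1) / 2)
       - of_int (m + 2 * s + 1) / 2 * (of_int (n + 2 * (m + s) + 1) / 2)
       + of_int (m - n) * (of_int (m + n + 2 * s + 1) / 2)) * ?x"
    unfolding vir_defect_def vir_op_psi vir_op_diff vir_op_scale psi_diff psi_scale idx
    unfolding minus_apply fock_scale_apply
    by (simp add: field_simps)
  also have "\<dots> = 0 * ?x"
    by (rule arg_cong[where f = "\<lambda>c. c * ?x"]) (simp add: field_simps)
  finally show "vir_defect m n (psi s v) S = psi s (vir_defect m n v) S" by simp
qed

lemma vir_defect_add: "vir_defect m n (u + v) = vir_defect m n u + vir_defect m n v"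
  and vir_defect_scale: "vir_defect m n (fock_scale c v) = fock_scale c (vir_defect m n v)"
  unfolding vir_defect_def vir_op_add vir_op_scale by (simp_all add: fun_eq_iff algebra_simps)

lemma vir_defect_zero: "vir_defect m n 0 = 0"
  by (simp add: vir_defect_def)

lemma vir_defect_sum: "vir_defect m n (\<Sum>a\<in>A. f a) = (\<Sum>a\<in>A. vir_defect m n (f a))"
  by (induction A rule: infinite_finite_induct)
    (simp_all only: sum.infinite sum.empty sum.insert vir_defect_add vir_defect_zero not_False_eq_True)

lemma psi_psi_local:
  assumes S: "finite S" and v: "\<And>T. finite T \<Longrightarrow> fwt T = fwt S + 2 * (a + b + 1) \<Longrightarrow> v T = 0"
  shows "psi a (psi b v) S = 0"
proof -
  obtain e S' where 1: "finite S'" "\<And>v. psi a v S = e * v S'" "e \<noteq> 0 \<Longrightarrow> fwt S' = fwt S + (2 * a + 1)"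
    using psi_eval[OF S, of a] by metis
  obtain e' S'' where 2: "finite S''" "\<And>v. psi b v S' = e' * v S''" "e' \<noteq> 0 \<Longrightarrow> fwt S'' = fwt S' + (2 * b + 1)"
    using psi_eval[OF 1(1), of b] by metis
  show ?thesis
  proof (cases "e = 0 \<or> e' = 0")
    case False
    then have "v S'' = 0" using 1(3) 2(1,3) by (intro v) auto
    then show ?thesis by (simp add: 1(2) 2(2))
  qed (auto simp: 1(2) 2(2))
qed

lemma vir_op_local:
  assumes S: "finite S" and v: "\<And>T. finite T \<Longrightarrow> fwt T = fwt S + 2 * n \<Longrightarrow> v T = 0"
  shows "vir_op n v S = 0"
proof -
  have "nop a (n - 1 - a) v S = 0" for a
    using psi_psi_local[OF S, of a "n - 1 - a" v] psi_psi_local[OF S, of "n - 1 - a" a v] v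
    by (simp add: nop_def)
  then show ?thesis by (simp add: vir_op_def)
qed

definition weight_sets :: "int \<Rightarrow> nat set set" where
  "weight_sets h = {T. finite T \<and> fwt T = h}"

lemma finite_weight_sets: "finite (weight_sets h)"
proof (rule finite_subset)
  show "weight_sets h \<subseteq> Pow {..nat h}"
    using fwt_bound by (fastforce simp: weight_sets_def)
qed simp

text \<open>Allows an arbitrary function to be replaced by a finite combination of basis vectors of
  weight 2 (m + n).\<close>

lemma vir_defect_local:
  assumes "\<And>T. finite T \<Longrightarrow> fwt T = 2 * (m + n) \<Longrightarrow> v T = 0"
  shows "vir_defect m n v {} = 0"
proof -
  have "vir_op m (vir_op n v) {} = 0"
    by (rule vir_op_local, simp, rule vir_op_local, simp) (rule assms, auto)
  moreover have "vir_op n (vir_op m v) {} = 0"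
    by (rule vir_op_local, simp, rule vir_op_local, simp) (rule assms, auto)
  moreover have "vir_op (m + n) v {} = 0"
    by (rule vir_op_local, simp) (rule assms, auto)
  ultimately show ?thesis by (simp add: vir_defect_def)
qed

lemma evac_psi:
  assumes "finite T" "i \<in> T"
  shows "evac T = fock_scale (fsign i T) (psi (- 1 - int i) (evac (T - {i})))"
proof
  fix S
  show "evac T S = fock_scale (fsign i T) (psi (- 1 - int i) (evac (T - {i}))) S"
    using assms by (auto simp: evac_def psi_def cre_def)
qed

text \<open>An occupied level is produced by a creator, which can be pulled out of the defect and
  vanishes at \<open>{}\<close>.\<close>

lemma vir_defect_evac: "finite T \<Longrightarrow> T \<noteq> {} \<Longrightarrow> vir_defect m n (evac T) {} = 0"
proof -
  assume "finite T" "T \<noteq> {}"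
  then obtain i where "i \<in> T" by blast
  then show ?thesis
    using \<open>finite T\<close> by (simp add: evac_psi[of T i] vir_defect_scale vir_defect_psi psi_neg_at_empty)
qed

lemma vir_op_at_empty:
  "vir_op m w {} = (\<Sum>a\<in>{0..m - 1}. of_int (m - 1 - 2 * a) / 4 * psi a (psi (m - 1 - a) w) {})"
proof -
  have "vir_op m w {} = (\<Sum>a\<in>{0..m - 1}. of_int (m - 1 - 2 * a) / 4 * nop a (m - 1 - a) w {})"
  proof (rule vir_op_eq)
    fix a assume *: "nop a (m - 1 - a) w {} \<noteq> 0"
    have "m - 1 - a \<ge> 0" using * psi_neg_at_empty[of "m - 1 - a"] by (auto simp: nop_def split: if_splits)
    moreover from this have "a \<ge> 0" using * psi_neg_at_empty[of a] by (force simp: nop_def)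
    ultimately show "a \<in> {0..m - 1}" by simp
  qed simp_all
  then show ?thesis by (simp add: nop_def)
qed

lemma sum_squares_arith:
  "3 * (\<Sum>a<k. (x - 2 * of_nat a)\<^sup>2) = 3 * of_nat k * x\<^sup>2 - 6 * x * of_nat k * (of_nat k - 1)
     + 2 * of_nat k * (of_nat k - 1) * (2 * of_nat k - 1)" for x :: complex
  by (induction k) (simp_all add: algebra_simps power2_eq_square)

text \<open>The pair of modes with index \<open>a\<close> in L_m contracts with L_(-m) on the vacuum
  to (m - 1 - 2a) / 2; with the coefficient (m - 1 - 2a) / 4 this leaves a sum of squares over
  8.\<close>

lemma vir_defect_vacuum:
  assumes "m \<ge> 0"
  shows "vir_defect m (- m) (evac {}) {} = of_int (m ^ 3 - m) / 24"
proof -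
  obtain k where k: "m = int k" using assms nonneg_int_cases by blast
  have mode: "psi a (psi (m - 1 - a) (vir_op (- m) (evac {}))) {} = of_int (m - 1 - 2 * a) / 2"
    if "a \<in> {0..m - 1}" for a
  proof -
    have "vir_op (- m) (psi (m - 1 - a) (evac {})) = 0"
      using that by (simp add: psi_evac_empty)
    then have "psi (m - 1 - a) (vir_op (- m) (evac {}))
        = fock_scale (of_int (- m + 2 * (m - 1 - a) + 1) / 2) (psi (- m + (m - 1 - a)) (evac {}))"
      unfolding vir_op_psi by simp
    moreover have "psi a (psi (- m + (m - 1 - a)) (evac {})) = fcut (evac {})"
      using that by (simp add: clifford[of a] psi_evac_empty)
    moreover have "fcut (evac {}) {} = 1" by (simp add: fcut_def evac_def)
    ultimately show ?thesis by (simp add: psi_scale)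
  qed
  have "vir_op m (vir_op (- m) (evac {})) {} = (\<Sum>a\<in>{0..m - 1}. of_int (m - 1 - 2 * a) / 4 * (of_int (m - 1 - 2 * a) / 2))"
    unfolding vir_op_at_empty[of m] by (intro sum.cong refl) (simp only: mode)
  also have "\<dots> = (\<Sum>a<k. (of_nat k - 1 - 2 * of_nat a)\<^sup>2 / 8)"
  proof (rule sum.reindex_bij_witness[of _ int nat])
  qed (auto simp: k power2_eq_square)
  also have "\<dots> = of_int (m ^ 3 - m) / 24"
    using sum_squares_arith[of "of_nat k - 1" k]
    by (simp add: k sum_divide_distrib[symmetric] field_simps power2_eq_square power3_eq_cube)
  finally show ?thesis
    using assms by (simp add: vir_defect_def vir_op_vacuum)
qed

text \<open>The central term at c = 1/2, where c / 12 = 1 / 24.\<close>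

definition vir_cocycle :: "int \<Rightarrow> int \<Rightarrow> complex" where
  "vir_cocycle m n = (if m = - n then of_int (m ^ 3 - m) / 24 else 0)"

lemma vir_defect_at_empty: "vir_defect m n v {} = vir_cocycle m n * v {}"
proof -
  \<comment> \<open>The part of \<open>v\<close> that the defect can see at
    \<open>{}\<close>.\<close>
  define w where "w = (\<Sum>T\<in>weight_sets (2 * (m + n)). fock_scale (v T) (evac T))"
  have w: "w T = v T" if "finite T" "fwt T = 2 * (m + n)" for T
  proof -
    have "T \<in> weight_sets (2 * (m + n))" using that by (simp add: weight_sets_def)
    then show ?thesis
      by (simp add: w_def sum_fock_apply evac_def finite_weight_sets if_distrib sum.delta cong: if_cong)
  qed
  have "vir_defect m n (v - w) {} = 0" by (rule vir_defect_local) (simp add: w)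
  moreover have "vir_defect m n v = vir_defect m n (v - w) + vir_defect m n w"
    by (simp flip: vir_defect_add)
  ultimately have "vir_defect m n v {} = (\<Sum>T\<in>weight_sets (2 * (m + n)). v T * vir_defect m n (evac T) {})"
    by (simp add: w_def vir_defect_sum vir_defect_scale sum_fock_apply)
  also have "\<dots> = (if m + n = 0 then v {} * vir_defect m n (evac {}) {} else 0)"
  proof -
    have "(\<Sum>T\<in>weight_sets (2 * (m + n)). v T * vir_defect m n (evac T) {})
       = (\<Sum>T\<in>weight_sets (2 * (m + n)). if T = {} then v T * vir_defect m n (evac T) {} else 0)"
      by (intro sum.cong) (auto simp: weight_sets_def vir_defect_evac)
    then show ?thesis by (simp add: finite_weight_sets) (simp add: weight_sets_def)
  qed
  also have "\<dots> = vir_cocycle m n * v {}"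
  proof (cases "m + n = 0")
    case True
    then have n: "n = - m" by simp
    show ?thesis
    proof (cases "m \<ge> 0")
      case True
      then show ?thesis by (simp add: n vir_defect_vacuum vir_cocycle_def)
    next
      case False
      have "vir_defect m n (evac {}) {} = - vir_defect (- m) (- (- m)) (evac {}) {}"
        by (simp add: vir_defect_def n algebra_simps)
      also have "\<dots> = of_int (m ^ 3 - m) / 24"
        using False by (subst vir_defect_vacuum) (simp_all add: field_simps)
      finally show ?thesis by (simp add: n vir_cocycle_def)
    qed
  qed (auto simp: vir_cocycle_def)
  finally show ?thesis .
qed

text \<open>The value at \<open>insert i S\<close> is read through the annihilator of
  \<open>i\<close>, which commutes with the defect; induction on \<open>S\<close> thus reduces to
  \<open>{}\<close>.\<close>

lemma vir_defect_eq: "vir_defect m n v = fock_scale (vir_cocycle m n) (fcut v)"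
proof
  fix S
  show "vir_defect m n v S = fock_scale (vir_cocycle m n) (fcut v) S"
  proof (cases "finite S")
    case True
    then have "vir_defect m n v S = vir_cocycle m n * v S"
    proof (induction S arbitrary: v rule: finite_induct)
      case (insert i S)
      have "psi (int i) (vir_defect m n v) S = vir_cocycle m n * psi (int i) v S"
        using insert.IH[of "psi (int i) v"] by (simp add: vir_defect_psi)
      then show ?case
        using insert.hyps by (simp add: psi_at[of S i])
    qed (rule vir_defect_at_empty)
    then show ?thesis using True by (simp add: fcut_def)
  qed (simp add: vir_defect_def vir_op_infinite fcut_def)
qed

lemma vir_op_commutator:
  "vir_op m (vir_op n v) - vir_op n (vir_op m v)
     = fock_scale (of_int (m - n)) (vir_op (m + n) v) + fock_scale (vir_cocycle m n) (fcut v)"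
  using vir_defect_eq[of m n v] unfolding vir_defect_def by (simp add: fun_eq_iff algebra_simps)

lemma vir_op_0: "finite S \<Longrightarrow> vir_op 0 v S = of_int (fwt S) / 2 * v S"
proof (induction S arbitrary: v rule: finite_induct)
  case empty
  show ?case by (simp add: vir_op_at_empty)
next
  case (insert i S)
  have "psi (int i) (vir_op 0 v) S = vir_op 0 (psi (int i) v) S + of_int (2 * int i + 1) / 2 * psi (int i) v S"
    by (simp add: vir_op_psi)
  also have "\<dots> = of_int (fwt (insert i S)) / 2 * psi (int i) v S"
    using insert by (simp add: fwt_insert field_simps)
  finally show ?case using insert.hyps by (simp add: psi_at[of S i])
qed

lemma nop_fcut [simp]: "nop a b (fcut v) = nop a b v"
  by (simp add: nop_def)

lemma vir_op_fcut [simp]: "vir_op n (fcut v) = vir_op n v"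
  by (simp add: vir_op_def fun_eq_iff)

lemma fcut_vir_op [simp]: "fcut (vir_op n v) = vir_op n v"
  by (auto simp: vir_op_def fcut_def fun_eq_iff)

subsection \<open>The contravariant form\<close>

text \<open>Bilinear rather than Hermitian, and confined to one weight, where there are only
  finitely many sets, because supports are arbitrary.\<close>

definition fpair :: "int \<Rightarrow> fock \<Rightarrow> fock \<Rightarrow> complex" where
  "fpair h u v = (\<Sum>S\<in>weight_sets h. u S * v S)"

lemma fpair_commute: "fpair h u v = fpair h v u"
  by (simp add: fpair_def mult.commute)

lemma fpair_ann: "fpair h u (ann i v) = fpair (h + 2 * int i + 1) (cre i u) v"
proof -
  have "fpair h u (ann i v) = (\<Sum>S\<in>{S\<in>weight_sets h. i \<notin> S}. u S * (fsign i S * v (insert i S)))"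
    unfolding fpair_def
    by (rule sum.mono_neutral_cong_right)
      (auto simp: finite_weight_sets[unfolded weight_sets_def] ann_def weight_sets_def)
  also have "\<dots> = (\<Sum>T\<in>{T\<in>weight_sets (h + 2 * int i + 1). i \<in> T}. fsign i T * u (T - {i}) * v T)"
    by (rule sum.reindex_bij_witness[of _ "\<lambda>T. T - {i}" "insert i"])
      (auto simp: weight_sets_def fwt_insert fwt_remove fsign_insert insert_absorb)
  also have "\<dots> = fpair (h + 2 * int i + 1) (cre i u) v"
    unfolding fpair_def
    by (rule sum.mono_neutral_cong_left)
      (auto simp: finite_weight_sets[unfolded weight_sets_def] cre_def weight_sets_def)
  finally show ?thesis .
qed

lemma fpair_psi: "fpair h u (psi a v) = fpair (h + 2 * a + 1) (psi (- 1 - a) u) v"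
proof (cases "a \<ge> 0")
  case True
  then show ?thesis using fpair_ann[of h u "nat a" v] by (simp add: psi_def)
next
  case False
  define i where "i = nat (- a - 1)"
  have i: "int i = - a - 1" "nat (- 1 - a) = i" using False by (simp_all add: i_def)
  have "fpair h u (psi a v) = fpair h (cre i v) u"
    using False by (simp add: psi_def i_def fpair_commute)
  also have "\<dots> = fpair (h + 2 * a + 1) v (ann i u)"
    using fpair_ann[of "h + 2 * a + 1" v i u] by (simp add: i)
  also have "\<dots> = fpair (h + 2 * a + 1) (psi (- 1 - a) u) v"
    using False i by (simp add: psi_def fpair_commute)
  finally show ?thesis .
qed

lemma fpair_minus: "fpair h u (- v) = - fpair h u v" "fpair h (- u) v = - fpair h u v"
  by (simp_all add: fpair_def sum_negf)

text \<open>Transposition reverses the product and sends index a to -1 - a. The order matters only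
  if a + b = -1; then -1 - a = b, so both sides are ordered by the same test.\<close>

lemma fpair_nop: "fpair h u (nop a b v) = fpair (h + 2 * (a + b + 1)) (nop (- 1 - b) (- 1 - a) u) v"
proof -
  have pp: "fpair h u (psi x (psi y v)) = fpair (h + 2 * (x + y + 1)) (psi (- 1 - y) (psi (- 1 - x) u)) v" for x y
    unfolding fpair_psi by (simp add: algebra_simps)
  have swap: "psi (- 1 - b) (psi (- 1 - a) u) = - psi (- 1 - a) (psi (- 1 - b) u)"
    if "a + b \<noteq> - 1" using that by (subst clifford) auto
  show ?thesis
  proof (cases "b \<ge> 0")
    case True
    then show ?thesis using swap pp[of a b] by (cases "a < 0") (auto simp: nop_def)
  next
    case False
    then have "fpair h u (nop a b v) = fpair (h + 2 * (a + b + 1)) (- psi (- 1 - a) (psi (- 1 - b) u)) v"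
      using pp[of b a] by (simp add: nop_def fpair_minus add.commute)
    then show ?thesis using swap False by (cases "a < 0") (auto simp: nop_def)
  qed
qed

lemma fpair_vir_op: "fpair h u (vir_op n v) = fpair (h + 2 * n) (vir_op (- n) u) v"
proof -
  define K where "K = 2 * \<bar>n\<bar> + \<bar>h\<bar> + \<bar>h + 2 * n\<bar> + 2"
  let ?c = "\<lambda>n a. of_int (n - 1 - 2 * a) / 4 :: complex"
  have 1: "vir_op n v S = (\<Sum>a\<in>{- K..K}. ?c n a * nop a (n - 1 - a) v S)" if "S \<in> weight_sets h" for S
    using that by (intro vir_op_interval) (auto simp: weight_sets_def vbound_def K_def)
  \<comment> \<open>The window is moved by \<open>n\<close> because transposition carries the
    summand \<open>a\<close> of L_n to the summand a - n of L_(-n).\<close>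
  have 2: "vir_op (- n) u S = (\<Sum>a\<in>{- K - n..K - n}. ?c (- n) a * nop a (- n - 1 - a) u S)"
    if "S \<in> weight_sets (h + 2 * n)" for S
  proof (rule vir_op_eq)
    fix a assume "nop a (- n - 1 - a) u S \<noteq> 0"
    then have "a \<in> {- vbound (- n) S .. vbound (- n) S}"
      using that by (intro nop_bound) (auto simp: weight_sets_def)
    then show "a \<in> {- K - n..K - n}" using that by (auto simp: weight_sets_def vbound_def K_def)
  qed (use that in \<open>auto simp: weight_sets_def\<close>)
  have "fpair h u (vir_op n v) = (\<Sum>a\<in>{- K..K}. ?c n a * fpair h u (nop a (n - 1 - a) v))"
    unfolding fpair_def sum_distrib_left
    by (subst sum.swap) (intro sum.cong refl, simp add: 1 sum_distrib_left mult_ac)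
  also have "\<dots> = (\<Sum>a\<in>{- K..K}. ?c n a * fpair (h + 2 * n) (nop (a - n) (- 1 - a) u) v)"
    unfolding fpair_nop by (simp add: algebra_simps)
  also have "\<dots> = (\<Sum>a\<in>{- K - n..K - n}. ?c (- n) a * fpair (h + 2 * n) (nop a (- n - 1 - a) u) v)"
    by (rule sum.reindex_bij_witness[of _ "\<lambda>a. a + n" "\<lambda>a. a - n"]) (auto simp: algebra_simps)
  also have "\<dots> = fpair (h + 2 * n) (vir_op (- n) u) v"
    unfolding fpair_def sum_distrib_left
    by (subst sum.swap) (intro sum.cong refl, simp add: 2 sum_distrib_left sum_distrib_right mult_ac)
  finally show ?thesis .
qed

subsection \<open>Singular vectors of Fock space\<close>

text \<open>
  Used with \<open>g x y z\<close> the value of \<open>psi x (psi y (psi z w))\<close> at a point: the box of indices is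
  stable under all permutations, so the Clifford relations evaluate the cubic sum.
\<close>

lemma box_triple_sum:
  fixes g :: "int \<Rightarrow> int \<Rightarrow> int \<Rightarrow> complex" and d :: "int \<Rightarrow> complex" and R :: int
  assumes g12: "\<And>x y z. g x y z + g y x z = (if x + y = - 1 then d z else 0)"
    and g23: "\<And>x y z. g x y z + g x z y = (if y + z = - 1 then d x else 0)"
    and R: "R \<ge> 0"
  defines "I \<equiv> {- R - 1..R}"
  defines "T \<equiv> {(x, y, z). x \<in> I \<and> y \<in> I \<and> z \<in> I \<and> x + y + z = R - 1}"
  shows "(\<Sum>(x, y, z)\<in>T. of_int (z - y) * g x y z) = of_int ((2 * R + 1) * (R + 1)) * d R"
proof -
  have finT: "finite T"
    by (rule finite_subset[of _ "I \<times> I \<times> I"]) (auto simp: T_def I_def)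
  define A where "A f = (\<Sum>(x, y, z)\<in>T. of_int (f x y z) * g x y z)" for f :: "int \<Rightarrow> int \<Rightarrow> int \<Rightarrow> int"
  have A_add: "A f1 + A f2 = A (\<lambda>x y z. f1 x y z + f2 x y z)" for f1 f2
    unfolding A_def sum.distrib[symmetric] by (intro sum.cong refl) (auto simp: algebra_simps)
  have A_cmult: "of_int k * A f = A (\<lambda>x y z. k * f x y z)" for k f
    unfolding A_def sum_distrib_left by (intro sum.cong refl) (auto simp: mult_ac)
  have A_cong: "A f1 = A f2" if "\<And>x y z. x + y + z = R - 1 \<Longrightarrow> f1 x y z = f2 x y z" for f1 f2
    unfolding A_def by (intro sum.cong refl) (auto simp: T_def that)
  \<comment> \<open>Within T the condition x + y = -1 forces z = R, so only \<open>d R\<close>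
    appears; \<open>swap23\<close> is the mirror image.\<close>
  have swap12: "A f + A (\<lambda>x y z. f y x z) = (\<Sum>x\<in>I. of_int (f x (- 1 - x) R)) * d R" for f
  proof -
    have "A (\<lambda>x y z. f y x z) = (\<Sum>(x, y, z)\<in>T. of_int (f x y z) * g y x z)"
      unfolding A_def by (rule sum.reindex_bij_witness[of _ "\<lambda>(x, y, z). (y, x, z)" "\<lambda>(x, y, z). (y, x, z)"])
        (auto simp: T_def)
    then have "A f + A (\<lambda>x y z. f y x z) = (\<Sum>(x, y, z)\<in>T. of_int (f x y z) * (g x y z + g y x z))"
      unfolding A_def by (simp add: sum.distrib[symmetric] case_prod_unfold algebra_simps)
    also have "\<dots> = (\<Sum>t\<in>(\<lambda>x. (x, - 1 - x, R)) ` I. case t of (x, y, z) \<Rightarrow> of_int (f x y z) * d z)"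
      using finT by (intro sum.mono_neutral_cong_right) (auto simp: g12 T_def I_def image_iff R)
    also have "\<dots> = (\<Sum>x\<in>I. of_int (f x (- 1 - x) R)) * d R"
      by (subst sum.reindex) (auto simp: inj_on_def sum_distrib_right)
    finally show ?thesis .
  qed
  have swap23: "A f + A (\<lambda>x y z. f x z y) = (\<Sum>y\<in>I. of_int (f R y (- 1 - y))) * d R" for f
  proof -
    have "A (\<lambda>x y z. f x z y) = (\<Sum>(x, y, z)\<in>T. of_int (f x y z) * g x z y)"
      unfolding A_def by (rule sum.reindex_bij_witness[of _ "\<lambda>(x, y, z). (x, z, y)" "\<lambda>(x, y, z). (x, z, y)"])
        (auto simp: T_def)
    then have "A f + A (\<lambda>x y z. f x z y) = (\<Sum>(x, y, z)\<in>T. of_int (f x y z) * (g x y z + g x z y))"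
      unfolding A_def by (simp add: sum.distrib[symmetric] case_prod_unfold algebra_simps)
    also have "\<dots> = (\<Sum>t\<in>(\<lambda>y. (R, y, - 1 - y)) ` I. case t of (x, y, z) \<Rightarrow> of_int (f x y z) * d x)"
      using finT by (intro sum.mono_neutral_cong_right) (auto simp: g23 T_def I_def image_iff R)
    also have "\<dots> = (\<Sum>y\<in>I. of_int (f R y (- 1 - y))) * d R"
      by (subst sum.reindex) (auto simp: inj_on_def sum_distrib_right)
    finally show ?thesis .
  qed
  have odd: "(\<Sum>x\<in>I. of_int (2 * x + 1)) = (0 :: complex)"
  proof -
    have "(\<Sum>x\<in>I. of_int (2 * x + 1)) = (\<Sum>x\<in>I. - of_int (2 * x + 1) :: complex)"
      by (rule sum.reindex_bij_witness[of _ "\<lambda>x. - 1 - x" "\<lambda>x. - 1 - x"]) (auto simp: I_def algebra_simps)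
    then show ?thesis by (simp only: sum_negf) (simp only: eq_neg_iff_add_eq_0 mult_2[symmetric] mult_eq_0_iff, simp)
  qed
  define A1 where "A1 = A (\<lambda>x y z. 2 * x + 1)"
  define A2 where "A2 = A (\<lambda>x y z. 2 * y + 1)"
  define A3 where "A3 = A (\<lambda>x y z. 2 * z + 1)"
  define P where "P = A (\<lambda>x y z. 1)"
  have 12: "A1 + A2 = 0" using swap12[of "\<lambda>x y z. 2 * x + 1"] odd by (simp add: A1_def A2_def)
  have 23: "A2 + A3 = 0" using swap23[of "\<lambda>x y z. 2 * y + 1"] odd by (simp add: A2_def A3_def)
  have "P + P = of_int (2 * (R + 1)) * d R"
    using swap12[of "\<lambda>x y z. 1"] R by (simp add: P_def I_def)
  then have "2 * P = 2 * (of_int (R + 1) * d R)" by (simp add: algebra_simps)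
  then have P: "P = of_int (R + 1) * d R" by (simp only: mult_cancel_left) simp
  \<comment> \<open>On T the three odd numbers 2x + 1, 2y + 1, 2z + 1 add up to 2R + 1, and z - y is
    half the difference of the last two.\<close>
  have "A1 + A2 + A3 = of_int (2 * R + 1) * P"
    unfolding A1_def A2_def A3_def P_def A_add A_cmult by (rule A_cong) simp
  then have "A3 = of_int (2 * R + 1) * (of_int (R + 1) * d R)" using 12 P by simp
  moreover have "A3 + of_int (- 1) * A2 = of_int 2 * A (\<lambda>x y z. z - y)"
    unfolding A2_def A3_def A_add A_cmult by (rule A_cong) simp
  moreover have "A2 = - A3" using 23 by (simp add: add_eq_0_iff2)
  ultimately have "A (\<lambda>x y z. z - y) = of_int (2 * R + 1) * (of_int (R + 1) * d R)" by (simp add: mult_ac)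
  then show ?thesis unfolding A_def by simp
qed

lemma psi_infinite: "infinite S \<Longrightarrow> psi k v S = 0"
  by (simp add: psi_def ann_def cre_def)

definition top_mode :: "int \<Rightarrow> fock \<Rightarrow> bool" where
  "top_mode R w \<longleftrightarrow> R \<ge> 0 \<and> psi R w \<noteq> 0 \<and> (\<forall>j>R. psi j w = 0)"

definition singular :: "int \<Rightarrow> bool \<Rightarrow> fock \<Rightarrow> bool" where
  "singular h p w \<longleftrightarrow> homog h p w \<and> (\<forall>n\<ge>1. vir_op n w = 0)"

lemma vir_op_0_homog: "homog h p w \<Longrightarrow> vir_op 0 w = fock_scale (of_int h / 2) w"
proof
  fix S assume w: "homog h p w"
  show "vir_op 0 w S = fock_scale (of_int h / 2) w S"
  proof (cases "w S = 0")
    case True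
    then show ?thesis by (cases "finite S") (simp_all add: vir_op_0 vir_op_infinite)
  next
    case False
    then have "finite S" "fwt S = h" using w by (auto simp: homog_def)
    then show ?thesis by (simp add: vir_op_0)
  qed
qed

text \<open>Q n is four times L_n w without normal ordering, both indices restricted to the box
  -R-1..R. As modes above R kill w, Q n = 0 for n \<ge> 1, while Q 0 differs from 4 L_0 w by the
  contractions 1 + 2a for a = 0..R, that is, by (R + 1)^2 w. The cubic sum of psi_c Q (R - c) over
  the box is then computed twice: only c = R survives, and the Clifford relations alone evaluate it
  by \<open>box_triple_sum\<close>. Both results are multiples of psi_R w.\<close>

lemma singular_weight:
  assumes w: "singular h p w" and top: "top_mode R w"
  shows "2 * h = (R + 1) * (3 * R + 2)"
proof -
  have hom: "homog h p w" and sing: "\<And>n. n \<ge> 1 \<Longrightarrow> vir_op n w = 0"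
    and R: "R \<ge> 0" and nz: "psi R w \<noteq> 0" and kill: "\<And>j. j > R \<Longrightarrow> psi j w = 0"
    using w top by (auto simp: singular_def top_mode_def)
  define I where "I = {- R - 1..R}"
  have finI: "finite I" by (simp add: I_def)
  define Q where "Q n = (\<Sum>a\<in>{a\<in>I. n - 1 - a \<in> I}. fock_scale (of_int (n - 1 - 2 * a)) (psi a (psi (n - 1 - a) w)))" for n
  have cutw: "fcut w = w" using hom by (auto simp: fcut_def homog_def fun_eq_iff)
  have wS: "infinite S \<Longrightarrow> w S = 0" for S using hom by (auto simp: homog_def)
  have killab: "psi a (psi b w) = 0" if "a > R \<or> b > R" "a + b \<noteq> - 1" for a b
  proof (cases "b > R")
    case False
    then show ?thesis using that kill by (subst clifford) auto
  qed (simp add: kill)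
  have Qpos: "Q n = 0" if n: "n \<ge> 1" for n
  proof
    fix S
    show "Q n S = 0 S"
    proof (cases "finite S")
      case True
      define K where "K = max (vbound n S) (R + 1)"
      have "4 * vir_op n w S = (\<Sum>a\<in>{- K..K}. of_int (n - 1 - 2 * a) * nop a (n - 1 - a) w S)"
        by (subst vir_op_interval[OF True, of _ K]) (simp_all add: K_def sum_distrib_left)
      also have "\<dots> = (\<Sum>a\<in>{- K..K}. of_int (n - 1 - 2 * a) * psi a (psi (n - 1 - a) w) S)"
      proof (intro sum.cong refl)
        fix a
        have "nop a (n - 1 - a) w = psi a (psi (n - 1 - a) w)"
          unfolding nop_def using n by (subst (2) clifford) auto
        then show "of_int (n - 1 - 2 * a) * nop a (n - 1 - a) w S = of_int (n - 1 - 2 * a) * psi a (psi (n - 1 - a) w) S"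
          by simp
      qed
      also have "\<dots> = (\<Sum>a\<in>{a\<in>I. n - 1 - a \<in> I}. of_int (n - 1 - 2 * a) * psi a (psi (n - 1 - a) w) S)"
      proof (rule sum.mono_neutral_right)
        show "{a \<in> I. n - 1 - a \<in> I} \<subseteq> {- K..K}" by (auto simp: I_def K_def)
        show "\<forall>a\<in>{- K..K} - {a \<in> I. n - 1 - a \<in> I}. of_int (n - 1 - 2 * a) * psi a (psi (n - 1 - a) w) S = 0"
        proof
          fix a assume "a \<in> {- K..K} - {a \<in> I. n - 1 - a \<in> I}"
          then have "a > R \<or> n - 1 - a > R" using n by (auto simp: I_def)
          then have "psi a (psi (n - 1 - a) w) = 0" using n by (intro killab) auto
          then show "of_int (n - 1 - 2 * a) * psi a (psi (n - 1 - a) w) S = 0" by simp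
        qed
      qed simp
      also have "\<dots> = Q n S" by (simp add: Q_def sum_fock_apply)
      finally show ?thesis using sing[OF n] by simp
    qed (simp add: Q_def sum_fock_apply psi_infinite)
  qed
  have Q0: "Q 0 S = of_int (2 * h - (R + 1)\<^sup>2) * w S" for S
  proof (cases "finite S")
    case True
    define K where "K = max (vbound 0 S) (R + 1)"
    have "4 * vir_op 0 w S = (\<Sum>a\<in>{- K..K}. of_int (- 1 - 2 * a) * nop a (- 1 - a) w S)"
      by (subst vir_op_interval[OF True, of _ K]) (simp_all add: K_def sum_distrib_left)
    also have "\<dots> = (\<Sum>a\<in>I. of_int (- 1 - 2 * a) * nop a (- 1 - a) w S)"
    proof (rule sum.mono_neutral_right)
      show "I \<subseteq> {- K..K}" by (auto simp: I_def K_def)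
      show "\<forall>a\<in>{- K..K} - I. of_int (- 1 - 2 * a) * nop a (- 1 - a) w S = 0"
        by (auto simp: I_def nop_def kill)
    qed simp
    also have "\<dots> = (\<Sum>a\<in>I. of_int (- 1 - 2 * a) * psi a (psi (- 1 - a) w) S
        + (if a \<in> {0..R} then of_int (1 + 2 * a) * w S else 0))"
    proof (intro sum.cong refl)
      fix a assume a: "a \<in> I"
      have p: "psi a (psi (- 1 - a) w) S = w S - psi (- 1 - a) (psi a w) S"
        by (subst clifford) (simp add: cutw)
      show "of_int (- 1 - 2 * a) * nop a (- 1 - a) w S = of_int (- 1 - 2 * a) * psi a (psi (- 1 - a) w) S
        + (if a \<in> {0..R} then of_int (1 + 2 * a) * w S else 0)"
      proof (cases "a \<ge> 0")
        case True
        then have "nop a (- 1 - a) w S = - psi (- 1 - a) (psi a w) S" "a \<in> {0..R}"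
          using a by (simp_all add: nop_def I_def)
        then show ?thesis unfolding p by (simp add: algebra_simps)
      next
        case False
        then show ?thesis by (simp add: nop_def)
      qed
    qed
    also have "\<dots> = Q 0 S + (\<Sum>a\<in>{0..R}. of_int (1 + 2 * a)) * w S"
    proof -
      have "{a \<in> I. 0 - 1 - a \<in> I} = I" by (auto simp: I_def)
      then have "Q 0 S = (\<Sum>a\<in>I. of_int (- 1 - 2 * a) * psi a (psi (- 1 - a) w) S)"
        by (simp add: Q_def sum_fock_apply)
      moreover have "(\<Sum>a\<in>I. if a \<in> {0..R} then of_int (1 + 2 * a) * w S else 0)
          = (\<Sum>a\<in>{0..R}. of_int (1 + 2 * a) * w S)"
        using finI by (intro sum.mono_neutral_cong_right) (auto simp: I_def)
      ultimately show ?thesis by (simp only: sum.distrib sum_distrib_right)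
    qed
    also have "(\<Sum>a\<in>{0..R}. of_int (1 + 2 * a)) = (of_int ((R + 1)\<^sup>2) :: complex)"
    proof -
      have "(\<Sum>a<k. of_nat (1 + 2 * a)) = (of_nat (k\<^sup>2) :: complex)" for k :: nat
        by (induction k) (simp_all add: power2_eq_square algebra_simps)
      from this[of "nat (R + 1)"] have "(\<Sum>a<nat (R + 1). of_nat (1 + 2 * a)) = (of_int ((R + 1)\<^sup>2) :: complex)"
        using R by (simp add: of_nat_nat)
      moreover have "(\<Sum>a\<in>{0..R}. of_int (1 + 2 * a)) = (\<Sum>a<nat (R + 1). of_nat (1 + 2 * a) :: complex)"
        by (rule sum.reindex_bij_witness[of _ int nat]) auto
      ultimately show ?thesis by simp
    qed
    finally have "4 * (of_int h / 2 * w S) = Q 0 S + of_int ((R + 1)\<^sup>2) * w S"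
      by (simp add: vir_op_0_homog[OF hom])
    then show ?thesis by (simp add: algebra_simps)
  qed (simp add: wS Q_def sum_fock_apply psi_infinite)
  define T where "T = {(x, y, z). x \<in> I \<and> y \<in> I \<and> z \<in> I \<and> x + y + z = R - 1}"
  have key: "of_int (2 * h - (R + 1)\<^sup>2) * psi R w S = of_int ((2 * R + 1) * (R + 1)) * psi R w S" for S
  proof -
    have "(\<Sum>c\<in>I. psi c (Q (R - c)) S) = psi R (Q 0) S"
    proof -
      have "(\<Sum>c\<in>I. psi c (Q (R - c)) S) = (\<Sum>c\<in>{R}. psi c (Q (R - c)) S)"
        using finI R by (intro sum.mono_neutral_right) (auto simp: I_def Qpos)
      then show ?thesis by simp
    qed
    also have "Q 0 = fock_scale (of_int (2 * h - (R + 1)\<^sup>2)) w" by (rule ext) (simp only: Q0 fock_scale_apply)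
    finally have 1: "(\<Sum>c\<in>I. psi c (Q (R - c)) S) = of_int (2 * h - (R + 1)\<^sup>2) * psi R w S"
      unfolding psi_scale by (simp only: fock_scale_apply)
    have "(\<Sum>c\<in>I. psi c (Q (R - c)) S)
        = (\<Sum>c\<in>I. \<Sum>a\<in>{a\<in>I. R - c - 1 - a \<in> I}. of_int (R - c - 1 - 2 * a) * psi c (psi a (psi (R - c - 1 - a) w)) S)"
      unfolding Q_def psi_sum psi_scale sum_fock_apply fock_scale_apply ..
    also have "\<dots> = (\<Sum>(c, a)\<in>Sigma I (\<lambda>c. {a\<in>I. R - c - 1 - a \<in> I}).
        of_int (R - c - 1 - 2 * a) * psi c (psi a (psi (R - c - 1 - a) w)) S)"
      by (rule sum.Sigma) (auto simp: finI)
    also have "\<dots> = (\<Sum>(x, y, z)\<in>T. of_int (z - y) * psi x (psi y (psi z w)) S)"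
      by (rule sum.reindex_bij_witness[of _ "\<lambda>(x, y, z). (x, y)" "\<lambda>(c, a). (c, a, R - c - 1 - a)"])
        (auto simp: T_def algebra_simps)
    also have "\<dots> = of_int ((2 * R + 1) * (R + 1)) * psi R w S"
      unfolding T_def I_def
    proof (rule box_triple_sum[OF _ _ R])
      show "psi x (psi y (psi z w)) S + psi y (psi x (psi z w)) S = (if x + y = - 1 then psi z w S else 0)" for x y z
        by (simp add: clifford_apply)
      show "psi x (psi y (psi z w)) S + psi x (psi z (psi y w)) S = (if y + z = - 1 then psi x w S else 0)" for x y z
        by (subst clifford[of y z w]) (simp add: psi_diff)
    qed
    finally show ?thesis using 1 by simp
  qed
  obtain S where S: "psi R w S \<noteq> 0" using nz by (auto simp: fun_eq_iff)
  have "(of_int (2 * h - (R + 1)\<^sup>2) :: complex) = of_int ((2 * R + 1) * (R + 1))"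
    using key[of S] S by simp
  then have "2 * h - (R + 1)\<^sup>2 = (2 * R + 1) * (R + 1)" by (simp only: of_int_eq_iff)
  then show ?thesis by (simp add: power2_eq_square algebra_simps)
qed

lemma top_mode_exists:
  assumes w: "homog h p w" "w S \<noteq> 0" "S \<noteq> {}"
  shows "\<exists>R. top_mode R w"
proof -
  define M where "M = {i. \<exists>S. w S \<noteq> 0 \<and> i \<in> S}"
  have "M \<subseteq> {..nat h}"
  proof
    fix i assume "i \<in> M"
    then obtain S where "w S \<noteq> 0" "i \<in> S" by (auto simp: M_def)
    moreover from this have "finite S" "fwt S = h" using w(1) by (auto simp: homog_def)
    ultimately show "i \<in> {..nat h}" using fwt_bound[of S i] by auto
  qed
  then have finM: "finite M" by (rule finite_subset) simp
  have "M \<noteq> {}" using w(2,3) by (auto simp: M_def)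
  then have "Max M \<in> M" using finM by simp
  then obtain S where S: "w S \<noteq> 0" "Max M \<in> S" by (auto simp: M_def)
  have "finite S" using S w(1) by (auto simp: homog_def)
  then have "psi (int (Max M)) w (S - {Max M}) \<noteq> 0"
    using S by (simp add: psi_def ann_def insert_absorb)
  then have "psi (int (Max M)) w \<noteq> 0" by auto
  moreover have "psi j w = 0" if "j > int (Max M)" for j
  proof
    fix S
    have "w (insert (nat j) S) = 0"
    proof (rule ccontr)
      assume "w (insert (nat j) S) \<noteq> 0"
      then have "nat j \<in> M" by (auto simp: M_def)
      then show False using Max_ge[OF finM] that by force
    qed
    then show "psi j w S = 0 S" using that by (simp add: psi_def ann_def)
  qed
  ultimately have "top_mode (int (Max M)) w" unfolding top_mode_def by simp
  then show ?thesis by blast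
qed

text \<open>For h \<noteq> 0 the vector u = psi_R w is again singular, because [L_n, psi_R] is a
  multiple of psi_(n+R), which kills w. Being odd, u is not a multiple of the vacuum, so it has a
  top mode R' < R. Four times its conformal weight is then at most R (3R - 1) by
  \<open>singular_weight\<close>, yet subtracting the weight of the mode from that of w gives R (3R
  + 1).\<close>

lemma no_even_singular:
  assumes w: "singular h True w" and nz: "w \<noteq> 0"
  shows "h = 0"
proof (rule ccontr)
  assume h: "h \<noteq> 0"
  have hom: "homog h True w" and sing: "\<And>n. n \<ge> 1 \<Longrightarrow> vir_op n w = 0" using w by (auto simp: singular_def)
  obtain S where S: "w S \<noteq> 0" using nz by (auto simp: fun_eq_iff)
  have "S \<noteq> {}" using S hom h by (auto simp: homog_def)
  then obtain R where R: "top_mode R w" using top_mode_exists[OF hom S] by blast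
  have R0: "R \<ge> 0" "psi R w \<noteq> 0" "\<And>j. j > R \<Longrightarrow> psi j w = 0" using R by (auto simp: top_mode_def)
  have h1: "2 * h = (R + 1) * (3 * R + 2)" by (rule singular_weight[OF w R])
  define u where "u = psi R w"
  have homu: "homog (h - (2 * R + 1)) False u" using homog_psi[OF hom, of R] by (simp add: u_def)
  have u: "singular (h - (2 * R + 1)) False u"
    unfolding singular_def
  proof (intro conjI allI impI)
    fix n :: int assume n: "n \<ge> 1"
    have "psi (n + R) w = 0" by (rule R0(3)) (use n in simp)
    then show "vir_op n u = 0"
      unfolding u_def vir_op_psi by (simp add: sing[OF n])
  qed (rule homu)
  obtain S' where S': "u S' \<noteq> 0" using R0(2) by (auto simp: u_def fun_eq_iff)
  have "S' \<noteq> {}" using S' homu by (auto simp: homog_def)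
  then obtain R' where R': "top_mode R' u" using top_mode_exists[OF homu S'] by blast
  have h2: "2 * (h - (2 * R + 1)) = (R' + 1) * (3 * R' + 2)" by (rule singular_weight[OF u R'])
  have R'0: "R' \<ge> 0" "psi R' u \<noteq> 0" using R' by (auto simp: top_mode_def)
  have "R' < R"
  proof (rule ccontr)
    assume "\<not> R' < R"
    then have "psi R' (psi R w) = - psi R (psi R' w)"
      using R0 by (subst clifford) auto
    moreover have "psi R' (psi R w) = 0"
    proof (cases "R' = R")
      case True
      then have "psi R (psi R w) S = 0" for S using clifford_apply[of R R w S] R0 by simp
      then show ?thesis using True by (auto simp: fun_eq_iff)
    next
      case False
      then show ?thesis using \<open>\<not> R' < R\<close> calculation R0(3)[of R'] by simp
    qed
    ultimately show False using R'0 by (simp add: u_def)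
  qed
  have "(R' + 1) * (3 * R' + 2) \<le> R * (3 * R - 1)"
    using \<open>R' < R\<close> R'0 by (intro mult_mono) auto
  moreover have "(R' + 1) * (3 * R' + 2) = R * (3 * R - 1) + 2 * R"
    using h1 h2 by (simp add: algebra_simps)
  ultimately show False using \<open>R' < R\<close> R'0 by simp
qed

subsection \<open>The action of the tensor algebra on Fock space\<close>

text \<open>\<open>C\<close> acts as 1/2 at finite sets only, so that
  \<open>vir_op_commutator\<close> matches the bracket on all functions.\<close>

fun gen_op :: "vgen \<Rightarrow> fock \<Rightarrow> fock" where
  "gen_op (L n) v = vir_op n v"
| "gen_op C v = fock_scale (1 / 2) (fcut v)"

lemma fcut_add: "fcut (u + v) = fcut u + fcut v"
  and fcut_scale: "fcut (fock_scale a v) = fock_scale a (fcut v)"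
  by (auto simp: fcut_def fun_eq_iff)

lemma gen_op_add: "gen_op g (u + v) = gen_op g u + gen_op g v"
  by (cases g) (simp_all add: vir_op_add fcut_add fock.scale_right_distrib)

lemma gen_op_scale: "gen_op g (fock_scale a v) = fock_scale a (gen_op g v)"
  by (cases g) (simp_all add: vir_op_scale fcut_scale fock.scale_left_commute)

lemma gen_op_zero [simp]: "gen_op g 0 = 0"
  using gen_op_scale[of g 0 0] by simp

lemma gen_op_sum: "gen_op g (\<Sum>a\<in>A. f a) = (\<Sum>a\<in>A. gen_op g (f a))"
  by (induction A rule: infinite_finite_induct)
    (simp_all only: sum.infinite sum.empty sum.insert gen_op_add gen_op_zero not_False_eq_True)

definition lin_ext :: "('k \<Rightarrow> fock) \<Rightarrow> ('k \<Rightarrow>\<^sub>0 complex) \<Rightarrow> fock" where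
  "lin_ext f p = (\<Sum>k\<in>Poly_Mapping.keys p. fock_scale (Poly_Mapping.lookup p k) (f k))"

lemma lin_ext_superset:
  assumes "finite A" "Poly_Mapping.keys p \<subseteq> A"
  shows "lin_ext f p = (\<Sum>k\<in>A. fock_scale (Poly_Mapping.lookup p k) (f k))"
  unfolding lin_ext_def using assms
  by (intro sum.mono_neutral_left) (auto simp: in_keys_iff)

lemma lin_ext_add: "lin_ext f (p + q) = lin_ext f p + lin_ext f q"
proof -
  let ?A = "Poly_Mapping.keys p \<union> Poly_Mapping.keys q"
  have "lin_ext f (p + q) = (\<Sum>k\<in>?A. fock_scale (Poly_Mapping.lookup (p + q) k) (f k))"
    by (rule lin_ext_superset) (use Poly_Mapping.keys_add[of p q] in auto)
  also have "\<dots> = (\<Sum>k\<in>?A. fock_scale (Poly_Mapping.lookup p k) (f k))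
      + (\<Sum>k\<in>?A. fock_scale (Poly_Mapping.lookup q k) (f k))"
    by (simp only: lookup_add fock.scale_left_distrib sum.distrib)
  also have "\<dots> = lin_ext f p + lin_ext f q"
    by (subst (1 2) lin_ext_superset[of ?A]) auto
  finally show ?thesis .
qed

lemma lin_ext_fscale: "lin_ext f (fscale a p) = fock_scale a (lin_ext f p)"
proof -
  have "Poly_Mapping.keys (fscale a p) \<subseteq> Poly_Mapping.keys p" by (auto simp: in_keys_iff)
  then show ?thesis
    by (subst lin_ext_superset[of "Poly_Mapping.keys p"]) (auto simp: lin_ext_def fock.scale_sum_right)
qed

lemma lin_ext_single: "lin_ext f (Poly_Mapping.single k a) = fock_scale a (f k)"
  by (subst lin_ext_superset[of "{k}"]) auto

lemma lin_ext_zero [simp]: "lin_ext f 0 = 0"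
  by (simp add: lin_ext_def)

lemma lin_ext_minus: "lin_ext f (- p) = - lin_ext f p"
  using lin_ext_add[of f p "- p"] by (simp add: eq_neg_iff_add_eq_0 add.commute)

lemma lin_ext_diff: "lin_ext f (p - q) = lin_ext f p - lin_ext f q"
  using lin_ext_add[of f p "- q"] by (simp add: lin_ext_minus)

lemma lin_ext_sum: "lin_ext f (\<Sum>a\<in>A. h a) = (\<Sum>a\<in>A. lin_ext f (h a))"
  by (induction A rule: infinite_finite_induct)
    (simp_all only: sum.infinite sum.empty sum.insert lin_ext_add lin_ext_zero not_False_eq_True)

lemma poly_mapping_single_induct [case_names zero plus]:
  fixes p :: "'k \<Rightarrow>\<^sub>0 complex"
  assumes zero: "P 0" and plus: "\<And>k b p. P p \<Longrightarrow> P (Poly_Mapping.single k b + p)"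
  shows "P p"
proof (induction p rule: update_induct)
  case (update f k b)
  have "Poly_Mapping.update k b f = Poly_Mapping.single k b + f"
    using update.hyps(1)
    by (intro poly_mapping_eqI)
      (auto simp: lookup_update lookup_add lookup_single when_def in_keys_iff)
  then show ?case using plus[OF update.IH] by simp
qed (rule zero)

definition lie_op :: "virasoro \<Rightarrow> fock \<Rightarrow> fock" where
  "lie_op x v = lin_ext (\<lambda>g. gen_op g v) x"

definition word_op :: "vgen word \<Rightarrow> fock \<Rightarrow> fock" where
  "word_op w v = foldr gen_op (letters w) v"

definition tensor_op :: "tensor_alg \<Rightarrow> fock \<Rightarrow> fock" where
  "tensor_op p v = lin_ext (\<lambda>w. word_op w v) p"

lemma word_op_0 [simp]: "word_op 0 v = v"
  by (simp add: word_op_def zero_word_def)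

lemma word_op_plus: "word_op (w + w') v = word_op w (word_op w' v)"
  by (simp add: word_op_def plus_word_def)

lemma foldr_gen_op_add: "foldr gen_op gs (u + v) = foldr gen_op gs u + foldr gen_op gs v"
  by (induction gs) (simp_all only: foldr.simps o_apply id_apply gen_op_add)

lemma foldr_gen_op_scale: "foldr gen_op gs (fock_scale a v) = fock_scale a (foldr gen_op gs v)"
  by (induction gs) (simp_all only: foldr.simps o_apply id_apply gen_op_scale)

lemma word_op_scale: "word_op w (fock_scale a v) = fock_scale a (word_op w v)"
  unfolding word_op_def by (rule foldr_gen_op_scale)

lemma lin_ext_fun_add: "lin_ext (\<lambda>k. f k + g k) p = lin_ext f p + lin_ext g p"
  by (simp only: lin_ext_def fock.scale_right_distrib sum.distrib)

lemma lin_ext_fun_scale: "lin_ext (\<lambda>k. fock_scale a (f k)) p = fock_scale a (lin_ext f p)"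
  by (simp add: lin_ext_def fock.scale_sum_right mult.commute)

lemma tensor_op_add_right: "tensor_op p (u + v) = tensor_op p u + tensor_op p v"
  by (simp only: tensor_op_def word_op_def foldr_gen_op_add lin_ext_fun_add)

lemma tensor_op_scale_right: "tensor_op p (fock_scale a v) = fock_scale a (tensor_op p v)"
  by (simp only: tensor_op_def word_op_def foldr_gen_op_scale lin_ext_fun_scale)

lemma tensor_op_zero_right [simp]: "tensor_op p 0 = 0"
  using tensor_op_scale_right[of p 0 0] by simp

lemma tensor_op_add: "tensor_op (p + q) v = tensor_op p v + tensor_op q v"
  and tensor_op_diff: "tensor_op (p - q) v = tensor_op p v - tensor_op q v"
  and tensor_op_fscale: "tensor_op (fscale a p) v = fock_scale a (tensor_op p v)"
  and tensor_op_single: "tensor_op (Poly_Mapping.single w a) v = fock_scale a (word_op w v)"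
  and tensor_op_zero [simp]: "tensor_op 0 v = 0"
  by (simp_all add: tensor_op_def lin_ext_add lin_ext_diff lin_ext_fscale lin_ext_single)

lemma tensor_op_mult: "tensor_op (p * q) v = tensor_op p (tensor_op q v)"
proof (induction p rule: poly_mapping_single_induct)
  case (plus w a p)
  have "tensor_op (Poly_Mapping.single w a * q) v = tensor_op (Poly_Mapping.single w a) (tensor_op q v)"
  proof (induction q rule: poly_mapping_single_induct)
    case (plus w' b q)
    then show ?case
      by (simp only: distrib_left tensor_op_add tensor_op_add_right mult_single tensor_op_single
          word_op_plus word_op_scale fock.scale_scale fock.scale_right_distrib)
  qed (simp only: mult_zero_right tensor_op_zero tensor_op_zero_right)
  then show ?case using plus by (simp only: distrib_right tensor_op_add)
qed (simp only: mult_zero_left tensor_op_zero)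

lemma tensor_op_incl: "tensor_op (tensor_incl x) v = lie_op x v"
  by (simp add: tensor_incl_def tensor_op_def lin_ext_sum lin_ext_single lie_op_def word_op_def)
    (simp add: lin_ext_def)

lemma lie_op_vbasis: "lie_op (vbasis g) v = gen_op g v"
  by (simp add: lie_op_def vbasis_def lin_ext_single)

lemma lie_op_gen_bracket:
  "lie_op (gen_bracket g h) v = gen_op g (gen_op h v) - gen_op h (gen_op g v)"
proof (cases g; cases h)
  fix m n assume gh: "g = L m" "h = L n"
  have "lie_op (gen_bracket g h) v = fock_scale (of_int (m - n)) (vir_op (m + n) v)
      + fock_scale (vir_cocycle m n) (fcut v)"
    by (auto simp: gh lie_op_def lin_ext_add lin_ext_fscale vbasis_def lin_ext_single vir_cocycle_def
        fun_eq_iff)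
  then show ?thesis using vir_op_commutator[of m n v] by (simp add: gh)
qed (auto simp: lie_op_def vir_op_scale fcut_scale)

lemma lie_op_vbracket: "lie_op (vbracket x y) v = lie_op x (lie_op y v) - lie_op y (lie_op x v)"
proof -
  let ?X = "Poly_Mapping.keys x" and ?Y = "Poly_Mapping.keys y"
  let ?x = "Poly_Mapping.lookup x" and ?y = "Poly_Mapping.lookup y"
  have "lie_op (vbracket x y) v
      = (\<Sum>g\<in>?X. \<Sum>h\<in>?Y. fock_scale (?x g * ?y h) (gen_op g (gen_op h v) - gen_op h (gen_op g v)))"
    unfolding vbracket_def lie_op_def lin_ext_sum lin_ext_fscale
    by (intro sum.cong refl) (simp only: lie_op_gen_bracket[unfolded lie_op_def])
  also have "\<dots> = (\<Sum>g\<in>?X. \<Sum>h\<in>?Y. fock_scale (?x g * ?y h) (gen_op g (gen_op h v)))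
      - (\<Sum>g\<in>?X. \<Sum>h\<in>?Y. fock_scale (?x g * ?y h) (gen_op h (gen_op g v)))"
    by (simp only: fock.scale_right_diff_distrib sum_subtractf)
  also have "(\<Sum>g\<in>?X. \<Sum>h\<in>?Y. fock_scale (?x g * ?y h) (gen_op g (gen_op h v))) = lie_op x (lie_op y v)"
    by (simp add: lie_op_def lin_ext_def gen_op_sum gen_op_scale fock.scale_sum_right)
  also have "(\<Sum>g\<in>?X. \<Sum>h\<in>?Y. fock_scale (?x g * ?y h) (gen_op h (gen_op g v))) = lie_op y (lie_op x v)"
    by (subst sum.swap) (simp add: lie_op_def lin_ext_def gen_op_sum gen_op_scale fock.scale_sum_right mult.commute)
  finally show ?thesis .
qed

lemma tensor_op_env_ideal: "p \<in> env_ideal \<Longrightarrow> tensor_op p v = 0"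
  unfolding env_ideal_def
proof (induction rule: tensor.span_induct_alt)
  case (step a p q)
  then obtain u x y t where p: "p = u * (tensor_incl x * tensor_incl y - tensor_incl y * tensor_incl x
           - tensor_incl (vbracket x y)) * t" by auto
  have "tensor_op p v = 0"
    unfolding p tensor_op_mult tensor_op_diff tensor_op_incl lie_op_vbracket by simp
  then show ?case using step.IH by (simp add: tensor_op_add tensor_op_fscale)
qed simp

lift_definition env_op :: "virasoro_env \<Rightarrow> fock \<Rightarrow> fock" is tensor_op
proof -
  fix p q assume "env_rel p q"
  then have "tensor_op (p - q) v = 0" for v
    unfolding env_rel_def by (rule tensor_op_env_ideal)
  then show "tensor_op p = tensor_op q" by (auto simp: tensor_op_diff)
qed

lemma env_op_add: "env_op (u + w) v = env_op u v + env_op w v"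
  by transfer (rule tensor_op_add)

lemma env_op_diff: "env_op (u - w) v = env_op u v - env_op w v"
  by transfer (rule tensor_op_diff)

lemma env_op_mult: "env_op (u * w) v = env_op u (env_op w v)"
  by transfer (rule tensor_op_mult)

lemma env_op_scale: "env_op (env_scale a u) v = fock_scale a (env_op u v)"
  by transfer (rule tensor_op_fscale)

lemma env_op_incl: "env_op (env_incl x) v = lie_op x v"
  by transfer (rule tensor_op_incl)

lemma env_op_zero [simp]: "env_op 0 v = 0"
  by transfer simp

lemma env_op_one [simp]: "env_op 1 v = v"
  by transfer (simp add: tensor_op_single flip: single_one)

lemma env_op_scale_right: "env_op u (fock_scale a v) = fock_scale a (env_op u v)"
  by transfer (rule tensor_op_scale_right)

abbreviation fvac :: fock where "fvac \<equiv> evac {}"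

lemma lie_op_vacuum:
  assumes "x \<in> virasoro_plus" shows "lie_op x fvac = fock_scale (vac_char (1 / 2) x) fvac"
  using assms unfolding virasoro_plus_def
proof (induction rule: virasoro.span_induct_alt)
  case base
  show ?case by (simp add: lie_op_def vac_char_def)
next
  case (step a x y)
  have "lie_op x fvac = fock_scale (vac_char (1 / 2) x) fvac"
  proof (cases "x = vbasis C")
    case True
    have "fcut fvac = fvac" by (auto simp: fcut_def evac_def fun_eq_iff)
    moreover have "Poly_Mapping.lookup (vbasis C) C = 1" by (simp add: vbasis_def)
    ultimately show ?thesis by (simp add: True lie_op_vbasis vac_char_def)
  next
    case False
    then obtain n where "x = vbasis (L n)" "n \<ge> - 1" using step by auto
    moreover have "Poly_Mapping.lookup (vbasis (L n)) C = 0" by (simp add: vbasis_def lookup_single)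
    ultimately show ?thesis by (simp add: lie_op_vbasis vir_op_vacuum vac_char_def)
  qed
  then show ?case using step.IH
    by (simp add: lie_op_def lin_ext_add lin_ext_fscale vac_char_def lookup_add algebra_simps
        fock.scale_left_distrib)
qed

lemma env_op_balance_space: "u \<in> balance_space (1 / 2) \<Longrightarrow> env_op u fvac = 0"
  unfolding balance_space_def
proof (induction rule: env.span_induct_alt)
  case (step a u w)
  then obtain t x where u: "u = t * env_incl x - env_scale (vac_char (1 / 2) x) t"
    and x: "x \<in> virasoro_plus" by auto
  have "env_op u fvac = 0"
    by (simp add: u env_op_diff env_op_mult env_op_incl env_op_scale lie_op_vacuum[OF x] env_op_scale_right)
  then show ?case using step.IH by (simp add: env_op_add env_op_scale)
qed simp

subsection \<open>The homomorphism from the vacuum module to Fock space\<close>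

text \<open>The universal property of the induced module: \<open>virasoro_plus\<close> acts on
  \<open>fvac\<close> through \<open>vac_char (1 / 2)\<close>.\<close>

lift_definition vir_fock :: "vir \<Rightarrow> fock" is "\<lambda>u. env_op u fvac"
proof -
  fix u w assume "vir_rel u w"
  then have "env_op (u - w) fvac = 0" unfolding vir_rel_def by (rule env_op_balance_space)
  then show "env_op u fvac = env_op w fvac" by (simp add: env_op_diff)
qed

lemma vir_fock_add: "vir_fock (u + v) = vir_fock u + vir_fock v"
  by transfer (rule env_op_add)

lemma vir_fock_diff: "vir_fock (u - v) = vir_fock u - vir_fock v"
  by transfer (rule env_op_diff)

lemma vir_fock_scale: "vir_fock (vir_scale a v) = fock_scale a (vir_fock v)"
  by transfer (rule env_op_scale)

lemma vir_fock_zero [simp]: "vir_fock 0 = 0"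
  by transfer simp

lemma vir_fock_vacuum [simp]: "vir_fock vacuum = fvac"
  by transfer simp

lemma vir_fock_act: "vir_fock (vir_act x v) = lie_op x (vir_fock v)"
proof (induction v rule: vir.abs_induct)
  case (1 w)
  show ?case
    by (simp add: vir_act_def env_act_abs_vir vir_fock.abs_eq env_op_mult env_op_incl)
qed

lemma linear_vir_fock: "Vector_Spaces.linear vir_scale fock_scale vir_fock"
  by unfold_locales (simp_all only: vir_fock_add vir_fock_scale)

subsection \<open>The vacuum module\<close>

definition vir_L :: "int \<Rightarrow> vir \<Rightarrow> vir" where
  "vir_L n = vir_act (vbasis (L n))"

lemma abs_vir_exhaust: obtains u where "v = abs_vir u"
  by (metis Quotient3_abs_rep Quotient3_vir)

lemma abs_virasoro_env_exhaust: obtains p where "u = abs_virasoro_env p"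
  by (metis Quotient3_abs_rep Quotient3_virasoro_env)

lemma env_incl_add: "env_incl (x + y) = env_incl x + env_incl y"
proof transfer
  fix x y
  have "tensor_incl (x + y) = tensor_incl x + tensor_incl y"
  proof -
    let ?A = "Poly_Mapping.keys x \<union> Poly_Mapping.keys y"
    have sup: "tensor_incl z = (\<Sum>g\<in>?A. Poly_Mapping.single (Word [g]) (Poly_Mapping.lookup z g))"
      if "Poly_Mapping.keys z \<subseteq> ?A" for z
      unfolding tensor_incl_def using that by (intro sum.mono_neutral_left) (auto simp: in_keys_iff)
    show ?thesis
      using Poly_Mapping.keys_add[of x y]
      by (subst (1 2 3) sup) (auto simp: lookup_add single_add sum.distrib)
  qed
  then show "env_rel (tensor_incl (x + y)) (tensor_incl x + tensor_incl y)"
    by (simp add: equivp_reflp[OF virasoro_env_equivp])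
qed

lemma env_incl_fscale: "env_incl (fscale a x) = env_scale a (env_incl x)"
proof transfer
  fix a x
  have "tensor_incl (fscale a x) = fscale a (tensor_incl x)"
  proof -
    have "Poly_Mapping.keys (fscale a x) \<subseteq> Poly_Mapping.keys x" by (auto simp: in_keys_iff)
    then have "tensor_incl (fscale a x)
        = (\<Sum>g\<in>Poly_Mapping.keys x. Poly_Mapping.single (Word [g]) (Poly_Mapping.lookup (fscale a x) g))"
      unfolding tensor_incl_def by (intro sum.mono_neutral_left) (auto simp: in_keys_iff)
    also have "\<dots> = (\<Sum>g\<in>Poly_Mapping.keys x. fscale a (Poly_Mapping.single (Word [g]) (Poly_Mapping.lookup x g)))"
      by (intro sum.cong refl poly_mapping_eqI) (simp add: lookup_single when_def)
    also have "\<dots> = fscale a (tensor_incl x)"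
      unfolding tensor_incl_def by (rule tensor.scale_sum_right[symmetric])
    finally show ?thesis .
  qed
  then show "env_rel (tensor_incl (fscale a x)) (fscale a (tensor_incl x))"
    by (simp add: equivp_reflp[OF virasoro_env_equivp])
qed

lemma env_incl_bracket: "env_incl x * env_incl y - env_incl y * env_incl x = env_incl (vbracket x y)"
proof transfer
  fix x y
  have "1 * (tensor_incl x * tensor_incl y - tensor_incl y * tensor_incl x - tensor_incl (vbracket x y)) * 1
      \<in> env_ideal"
    unfolding env_ideal_def by (rule tensor.span_base) blast
  then show "env_rel (tensor_incl x * tensor_incl y - tensor_incl y * tensor_incl x) (tensor_incl (vbracket x y))"
    by (simp add: env_rel_def)
qed

lemma env_scale_mult_left: "env_scale a (u * v) = env_scale a u * v"
  by transfer (simp add: fscale_mult_left equivp_reflp[OF virasoro_env_equivp])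

lemma env_act_add: "env_act u (v + w) = env_act u v + env_act u w"
  and env_act_scale: "env_act u (vir_scale a v) = vir_scale a (env_act u v)"
proof -
  obtain v' where v: "v = abs_vir v'" by (rule abs_vir_exhaust)
  obtain w' where w: "w = abs_vir w'" by (rule abs_vir_exhaust)
  show "env_act u (v + w) = env_act u v + env_act u w"
    by (simp only: v w env_act_abs_vir plus_vir.abs_eq distrib_left)
  show "env_act u (vir_scale a v) = vir_scale a (env_act u v)"
    by (simp only: v env_act_abs_vir vir_scale.abs_eq env_scale_mult_right)
qed

lemma env_act_add_left: "env_act (u + u') v = env_act u v + env_act u' v"
  and env_act_diff_left: "env_act (u - u') v = env_act u v - env_act u' v"
  and env_act_mult: "env_act (u * u') v = env_act u (env_act u' v)"
  and env_act_scale_left: "env_act (env_scale a u) v = vir_scale a (env_act u v)"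
proof -
  obtain v' where v: "v = abs_vir v'" by (rule abs_vir_exhaust)
  show "env_act (u + u') v = env_act u v + env_act u' v"
    by (simp only: v env_act_abs_vir plus_vir.abs_eq distrib_right)
  show "env_act (u - u') v = env_act u v - env_act u' v"
    by (simp only: v env_act_abs_vir minus_vir.abs_eq left_diff_distrib)
  show "env_act (u * u') v = env_act u (env_act u' v)"
    by (simp only: v env_act_abs_vir mult.assoc)
  show "env_act (env_scale a u) v = vir_scale a (env_act u v)"
    by (simp only: v env_act_abs_vir vir_scale.abs_eq env_scale_mult_left)
qed

lemma vir_act_add: "vir_act x (v + w) = vir_act x v + vir_act x w"
  and vir_act_scale: "vir_act x (vir_scale a v) = vir_scale a (vir_act x v)"
  and vir_act_add_left: "vir_act (x + y) v = vir_act x v + vir_act y v"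
  and vir_act_fscale_left: "vir_act (fscale a x) v = vir_scale a (vir_act x v)"
  by (simp_all only: vir_act_def env_act_add env_act_scale env_act_add_left env_act_scale_left
      env_incl_add env_incl_fscale)

lemma vir_act_zero [simp]: "vir_act x 0 = 0"
  using vir_act_scale[of x 0 0] by simp

lemma vir_act_minus: "vir_act x (- v) = - vir_act x v"
  using vir_act_scale[of x "- 1" v] by simp

lemma vir_act_diff: "vir_act x (v - w) = vir_act x v - vir_act x w"
  using vir_act_add[of x v "- w"] by (simp add: vir_act_minus)

lemma vir_act_bracket:
  "vir_act x (vir_act y v) - vir_act y (vir_act x v) = vir_act (vbracket x y) v"
  unfolding vir_act_def env_incl_bracket[symmetric] env_act_diff_left env_act_mult ..

lemma vbracket_vbasis: "vbracket (vbasis g) (vbasis h) = gen_bracket g h"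
  by (simp add: vbracket_def vbasis_def)

lemma vir_act_vacuum:
  assumes "x \<in> virasoro_plus"
  shows "vir_act x vacuum = vir_scale (vac_char (1 / 2) x) vacuum"
proof -
  have "1 * env_incl x - env_scale (vac_char (1 / 2) x) 1 \<in> balance_space (1 / 2)"
    unfolding balance_space_def using assms by (intro env.span_base) blast
  then show ?thesis
    unfolding vir_act_def vacuum_def env_act_abs_vir vir_scale.abs_eq vir.abs_eq_iff vir_rel_def by simp
qed

text \<open>The module is generated by the vacuum, and words in the generators span the tensor
  algebra.\<close>

lemma vir_induct_generators:
  assumes S: "vir.subspace S" and vac: "vacuum \<in> S"
    and gen: "\<And>g v. v \<in> S \<Longrightarrow> vir_act (vbasis g) v \<in> S"
  shows "v \<in> S"
proof -
  have incl: "abs_virasoro_env (Poly_Mapping.single (Word [g]) 1) = env_incl (vbasis g)" for g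
    by (simp add: env_incl.abs_eq tensor_incl_def vbasis_def)
  have word: "abs_vir (abs_virasoro_env (Poly_Mapping.single (Word gs) a)) \<in> S" for gs a
  proof (induction gs)
    case Nil
    have "Poly_Mapping.single (Word []) a = fscale a (1 :: tensor_alg)"
      unfolding zero_word_def[symmetric] fscale_conv_mult(1) by simp
    then have "abs_vir (abs_virasoro_env (Poly_Mapping.single (Word []) a)) = vir_scale a vacuum"
      by (simp add: vacuum_def vir_scale.abs_eq env_scale.abs_eq one_virasoro_env_def)
    then show ?case using vir.subspace_scale[OF S vac] by simp
  next
    case (Cons g gs)
    have "Poly_Mapping.single (Word (g # gs)) a
        = Poly_Mapping.single (Word [g]) 1 * Poly_Mapping.single (Word gs) a"
      by (simp add: mult_single plus_word_def)
    then have "abs_vir (abs_virasoro_env (Poly_Mapping.single (Word (g # gs)) a))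
        = vir_act (vbasis g) (abs_vir (abs_virasoro_env (Poly_Mapping.single (Word gs) a)))"
      by (simp only: vir_act_def env_act_abs_vir incl[symmetric] times_virasoro_env.abs_eq)
    then show ?case using gen[OF Cons.IH] by simp
  qed
  obtain u where u: "v = abs_vir u" by (rule abs_vir_exhaust)
  obtain p where p: "u = abs_virasoro_env p" by (rule abs_virasoro_env_exhaust)
  have "abs_vir (abs_virasoro_env p) \<in> S"
  proof (induction p rule: poly_mapping_single_induct)
    case zero
    then show ?case
      using vir.subspace_0[OF S] by (simp add: zero_vir_def zero_virasoro_env_def)
  next
    case (plus w b p)
    obtain gs where "w = Word gs" by (cases w)
    then show ?case
      using vir.subspace_add[OF S word[of gs b] plus.IH]
      by (simp add: plus_vir.abs_eq plus_virasoro_env.abs_eq)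
  qed
  then show ?thesis by (simp add: u p)
qed

lemma vir_act_C: "vir_act (vbasis C) v = vir_scale (1 / 2) v"
proof -
  have "v \<in> {v. vir_act (vbasis C) v = vir_scale (1 / 2) v}"
  proof (rule vir_induct_generators)
    show "vir.subspace {v. vir_act (vbasis C) v = vir_scale (1 / 2) v}"
      by (auto simp: vir.subspace_def vir_act_add vir_act_scale vir.scale_right_distrib)
    have "vbasis C \<in> virasoro_plus"
      unfolding virasoro_plus_def by (rule virasoro.span_base) simp
    moreover have "vac_char (1 / 2) (vbasis C) = 1 / 2"
      by (simp add: vac_char_def vbasis_def)
    ultimately show "vacuum \<in> {v. vir_act (vbasis C) v = vir_scale (1 / 2) v}"
      using vir_act_vacuum by simp
    fix g v assume v: "v \<in> {v. vir_act (vbasis C) v = vir_scale (1 / 2) v}"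
    have "vir_act (0 :: virasoro) v = 0" using vir_act_fscale_left[of 0 0 v] by simp
    then have "vir_act (vbasis C) (vir_act (vbasis g) v) = vir_act (vbasis g) (vir_act (vbasis C) v)"
      using vir_act_bracket[of "vbasis C" "vbasis g" v] by (simp add: vbracket_vbasis)
    then show "vir_act (vbasis g) v \<in> {v. vir_act (vbasis C) v = vir_scale (1 / 2) v}"
      using v by (simp add: vir_act_scale)
  qed
  then show ?thesis by simp
qed

lemma vir_L_commutator:
  "vir_L m (vir_L n v) - vir_L n (vir_L m v)
     = vir_scale (of_int (m - n)) (vir_L (m + n) v) + vir_scale (vir_cocycle m n) v"
proof -
  have "vir_L m (vir_L n v) - vir_L n (vir_L m v) = vir_act (gen_bracket (L m) (L n)) v"
    unfolding vir_L_def vir_act_bracket vbracket_vbasis ..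
  moreover have "vir_act (0 :: virasoro) v = 0" using vir_act_fscale_left[of 0 0 v] by simp
  ultimately show ?thesis
    by (simp add: vir_act_add_left vir_act_fscale_left vir_act_C vir_L_def vir_cocycle_def)
qed

lemma vir_L_vacuum: "n \<ge> - 1 \<Longrightarrow> vir_L n vacuum = 0"
proof -
  assume "n \<ge> - 1"
  then have "vbasis (L n) \<in> virasoro_plus"
    unfolding virasoro_plus_def by (intro virasoro.span_base) blast
  moreover have "vac_char (1 / 2) (vbasis (L n)) = 0"
    by (simp add: vac_char_def vbasis_def lookup_single)
  ultimately show ?thesis using vir_act_vacuum[of "vbasis (L n)"] by (simp add: vir_L_def)
qed

lemma vir_L_add: "vir_L n (u + v) = vir_L n u + vir_L n v"
  and vir_L_scale: "vir_L n (vir_scale a v) = vir_scale a (vir_L n v)"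
  and vir_L_diff: "vir_L n (u - v) = vir_L n u - vir_L n v"
  and vir_L_minus: "vir_L n (- u) = - vir_L n u"
  and vir_L_zero [simp]: "vir_L n 0 = 0"
  by (simp_all add: vir_L_def vir_act_add vir_act_scale vir_act_diff vir_act_minus)

subsection \<open>Straightening of monomials\<close>

text \<open>In contrast to \<open>vir_monomial\<close>, arbitrary integer letters in any order are
  allowed, so that words are stable under every L_m.\<close>

definition vir_word :: "int list \<Rightarrow> vir" where
  "vir_word ms = foldr vir_L ms vacuum"

lemma vir_word_simps [simp]: "vir_word [] = vacuum" "vir_word (m # ms) = vir_L m (vir_word ms)"
  by (simp_all add: vir_word_def)

lemma foldr_vir_L_add: "foldr vir_L xs (u + v) = foldr vir_L xs u + foldr vir_L xs v"
  by (induction xs) (simp_all add: vir_L_add)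

lemma foldr_vir_L_scale: "foldr vir_L xs (vir_scale a v) = vir_scale a (foldr vir_L xs v)"
  by (induction xs) (simp_all add: vir_L_scale)

lemma foldr_vir_L_diff: "foldr vir_L xs (u - v) = foldr vir_L xs u - foldr vir_L xs v"
  by (induction xs) (simp_all add: vir_L_diff)

lemma foldr_vir_L_zero: "foldr vir_L xs 0 = 0"
  by (induction xs) simp_all

text \<open>Integer degrees let L_m lower below 0, where nothing is left.\<close>

definition graded :: "int \<Rightarrow> vir set" where
  "graded h = (if h < 0 then {0} else vir_component (nat h))"

lemma subspace_graded: "vir.subspace (graded h)"
  by (simp add: graded_def vir_component_def vir.subspace_span vir.subspace_single_0)

lemma vir_word_swap:
  "vir_word (xs @ a # b # ys) - vir_word (xs @ b # a # ys)
     = vir_scale (of_int (a - b)) (vir_word (xs @ (a + b) # ys))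
       + vir_scale (vir_cocycle a b) (vir_word (xs @ ys))"
proof -
  have "vir_word (xs @ a # b # ys) - vir_word (xs @ b # a # ys)
      = foldr vir_L xs (vir_L a (vir_L b (vir_word ys)) - vir_L b (vir_L a (vir_word ys)))"
    by (simp add: vir_word_def foldr_vir_L_diff)
  then show ?thesis
    unfolding vir_L_commutator by (simp add: vir_word_def foldr_vir_L_add foldr_vir_L_scale)
qed

text \<open>Ascending order puts the largest letter next to the vacuum. If it is at least -1 the
  word vanishes; otherwise all letters are at most -2 and the word is an ordered monomial.\<close>

lemma vir_word_sorted:
  assumes "sorted ms"
  shows "vir_word ms \<in> graded (- sum_list ms)"
proof (cases "\<forall>m\<in>set ms. m \<le> - 2")
  case True
  let ?ns = "map (\<lambda>m. nat (- m)) ms"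
  have "vir_word ms = vir_monomial ?ns"
    using True by (induction ms) (simp_all add: vir_L_def)
  moreover have "sum_list ms \<le> 0"
    using True by (intro sum_list_nonpos) force
  moreover have "int (sum_list ?ns) = - sum_list ms"
    using True by (induction ms) simp_all
  moreover have "sorted_wrt (\<ge>) ?ns"
    using assms by (auto simp: sorted_wrt_map intro: sorted_wrt_mono_rel[rotated])
  moreover have "\<forall>k\<in>set ?ns. k \<ge> 2" using True by force
  ultimately show ?thesis
    unfolding graded_def vir_component_def
    by (auto intro!: vir.span_base exI[of _ ?ns])
next
  case False
  then have "ms \<noteq> []" by auto
  then obtain ms' m where ms: "ms = ms' @ [m]" by (metis rev_exhaust)
  have "m \<ge> - 1" using False assms by (force simp: ms sorted_append)
  then have "vir_word ms = 0"
    by (simp add: ms vir_word_def vir_L_vacuum foldr_vir_L_zero)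
  then show ?thesis using vir.subspace_0[OF subspace_graded] by simp
qed

text \<open>
  Transposing two neighbours changes a word by shorter words, so every word may be sorted.
\<close>

lemma vir_word_graded: "vir_word ms \<in> graded (- sum_list ms)"
proof (induction "length ms" arbitrary: ms rule: less_induct)
  case less
  have short: "vir_word xs \<in> graded h" if "length xs < length ms" "- sum_list xs = h" for xs h
    using less[OF that(1)] that(2) by simp
  note sub = vir.subspace_add[OF subspace_graded] vir.subspace_scale[OF subspace_graded]
  have ins: "vir_word (pre @ a # xs) - vir_word (pre @ insort a xs) \<in> graded (- sum_list (pre @ a # xs))"
    if "length (pre @ a # xs) = length ms" for pre a xs
    using that
  proof (induction xs arbitrary: pre)
    case Nil
    then show ?case using vir.subspace_0[OF subspace_graded] by simp
  next
    case (Cons x xs)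
    show ?case
    proof (cases "a \<le> x")
      case True
      then show ?thesis using vir.subspace_0[OF subspace_graded] by simp
    next
      case False
      have 1: "vir_word (pre @ a # x # xs) - vir_word (pre @ x # a # xs) \<in> graded (- sum_list (pre @ a # x # xs))"
        unfolding vir_word_swap
      \<comment> \<open>If a = -x, both shorter words have the degree of the original one; otherwise
        the cocycle vanishes and only the first of them occurs.\<close>
      proof (cases "a = - x")
        case True
        then show "vir_scale (of_int (a - x)) (vir_word (pre @ (a + x) # xs))
          + vir_scale (vir_cocycle a x) (vir_word (pre @ xs)) \<in> graded (- sum_list (pre @ a # x # xs))"
          using Cons.prems by (intro sub short) auto
      next
        case False
        then show "vir_scale (of_int (a - x)) (vir_word (pre @ (a + x) # xs))
          + vir_scale (vir_cocycle a x) (vir_word (pre @ xs)) \<in> graded (- sum_list (pre @ a # x # xs))"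
          using Cons.prems by (simp add: vir_cocycle_def) (intro sub short; auto)
      qed
      have 2: "vir_word ((pre @ [x]) @ a # xs) - vir_word ((pre @ [x]) @ insort a xs)
          \<in> graded (- sum_list ((pre @ [x]) @ a # xs))"
        by (rule Cons.IH) (use Cons.prems in simp)
      have "graded (- sum_list ((pre @ [x]) @ a # xs)) = graded (- sum_list (pre @ a # x # xs))"
        by (simp add: algebra_simps)
      then have "(vir_word (pre @ a # x # xs) - vir_word (pre @ x # a # xs))
          + (vir_word (pre @ x # a # xs) - vir_word (pre @ x # insort a xs)) \<in> graded (- sum_list (pre @ a # x # xs))"
        using 1 2 by (intro sub) simp_all
      then show ?thesis using False by simp
    qed
  qed
  have sort: "vir_word (pre @ xs) - vir_word (pre @ sort xs) \<in> graded (- sum_list (pre @ xs))"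
    if "length (pre @ xs) = length ms" for pre xs
    using that
  proof (induction xs arbitrary: pre)
    case Nil
    then show ?case using vir.subspace_0[OF subspace_graded] by simp
  next
    case (Cons a xs)
    have 1: "vir_word ((pre @ [a]) @ xs) - vir_word ((pre @ [a]) @ sort xs) \<in> graded (- sum_list ((pre @ [a]) @ xs))"
      by (rule Cons.IH) (use Cons.prems in simp)
    have 2: "vir_word (pre @ a # sort xs) - vir_word (pre @ insort a (sort xs)) \<in> graded (- sum_list (pre @ a # sort xs))"
      by (rule ins) (use Cons.prems in simp)
    have "sum_list (sort xs) = sum_list xs" by (metis mset_sort sum_mset_sum_list)
    then have "(vir_word (pre @ a # xs) - vir_word (pre @ a # sort xs))
        + (vir_word (pre @ a # sort xs) - vir_word (pre @ insort a (sort xs))) \<in> graded (- sum_list (pre @ a # xs))"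
      using 1 2 by (intro sub) simp_all
    then show ?case by simp
  qed
  have eq: "sum_list (sort ms) = sum_list ms" by (metis mset_sort sum_mset_sum_list)
  have "(vir_word ms - vir_word (sort ms)) + vir_word (sort ms) \<in> graded (- sum_list ms)"
    using sort[of "[]" ms] vir_word_sorted[of "sort ms"] unfolding eq by (intro sub) simp_all
  then show ?case by simp
qed

lemma vir_monomial_word: "vir_monomial ns = vir_word (map (\<lambda>n. - int n) ns)"
  by (induction ns) (simp_all add: vir_L_def)

lemma vir_component_induct [consumes 1, case_names zero add word]:
  assumes "v \<in> vir_component n" "P 0"
    and "\<And>a u v. P u \<Longrightarrow> P v \<Longrightarrow> P (vir_scale a u + v)"
    and "\<And>ms. sum_list ms = - int n \<Longrightarrow> P (vir_word ms)"
  shows "P v"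
  using assms(1) unfolding vir_component_def
proof (induction rule: vir.span_induct_alt)
  case (step c x y)
  then obtain ns where ns: "x = vir_monomial ns" "sum_list ns = n" by blast
  have "sum_list (map (\<lambda>n. - int n) ns) = - int (sum_list ns)" by (induction ns) simp_all
  then have "P x" using assms(4) ns by (simp add: vir_monomial_word)
  then show ?case using step assms(3) by blast
qed (rule assms(2))

lemma vir_L_component: "v \<in> vir_component n \<Longrightarrow> vir_L m v \<in> graded (int n - m)"
proof (induction rule: vir_component_induct)
  case zero
  show ?case using vir.subspace_0[OF subspace_graded] by simp
next
  case (add a u v)
  then show ?case
    using vir.subspace_add[OF subspace_graded] vir.subspace_scale[OF subspace_graded]
    by (simp add: vir_L_add vir_L_scale)
next
  case (word ms)
  then show ?case using vir_word_graded[of "m # ms"] by simp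
qed

lemma vir_L_0_word: "vir_L 0 (vir_word ms) = vir_scale (- of_int (sum_list ms)) (vir_word ms)"
proof (induction ms)
  case Nil
  show ?case by (simp add: vir_L_vacuum)
next
  case (Cons m ms)
  have "vir_L 0 (vir_L m (vir_word ms)) = vir_L m (vir_L 0 (vir_word ms)) + vir_scale (- of_int m) (vir_L m (vir_word ms))"
    using vir_L_commutator[of 0 m "vir_word ms"] by (simp add: vir_cocycle_def algebra_simps)
  then show ?case by (simp add: Cons.IH vir_L_scale vir_L_minus vir.scale_left_diff_distrib)
qed

lemma vir_L_0_component: "v \<in> vir_component n \<Longrightarrow> vir_L 0 v = vir_scale (of_nat n) v"
proof (induction rule: vir_component_induct)
  case (add a u v)
  then show ?case by (simp add: vir_L_add vir_L_scale vir.scale_right_distrib mult.commute)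
qed (simp_all add: vir_L_0_word)

text \<open>Finite sums of homogeneous vectors form a subspace that contains the vacuum and is
  stable under all generators.\<close>

lemma vir_component_sum:
  obtains f M where "\<And>n. f n \<in> vir_component n" "v = (\<Sum>n<M. f n)"
proof -
  define S where "S = {v. \<exists>f M. (\<forall>n. f n \<in> vir_component n) \<and> v = (\<Sum>n<(M::nat). f n)}"
  have zero: "(0 :: vir) \<in> vir_component n" for n by (simp add: vir_component_def vir.span_zero)
  have memI: "v \<in> S" if "v \<in> graded h" for v h
  proof (cases "h < 0")
    case True
    then have "v = (\<Sum>n<0. 0)" using that by (simp add: graded_def)
    then show ?thesis unfolding S_def using zero by (intro CollectI exI[of _ "\<lambda>_. 0"] exI[of _ 0]) auto
  next
    case False
    then have v: "v \<in> vir_component (nat h)" using that by (simp add: graded_def)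
    have "v = (\<Sum>n<Suc (nat h). if n = nat h then v else 0)" by simp
    then show ?thesis unfolding S_def using zero v
      by (intro CollectI exI[of _ "\<lambda>n. if n = nat h then v else 0"] exI[of _ "Suc (nat h)"]) auto
  qed
  have add: "u + v \<in> S" if "u \<in> S" "v \<in> S" for u v
  proof -
    from that obtain f M g M' where f: "\<forall>n. f n \<in> vir_component n" "u = (\<Sum>n<(M::nat). f n)"
      and g: "\<forall>n. g n \<in> vir_component n" "v = (\<Sum>n<(M'::nat). g n)"
      unfolding S_def by blast
    let ?h = "\<lambda>n. (if n < M then f n else 0) + (if n < M' then g n else 0)"
    have "(\<Sum>n<max M M'. if n < M then f n else 0) = u" "(\<Sum>n<max M M'. if n < M' then g n else 0) = v"
      unfolding f(2) g(2) by (rule sum.mono_neutral_cong_right; auto)+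
    then have "u + v = (\<Sum>n<max M M'. ?h n)" by (simp add: sum.distrib)
    moreover have "\<forall>n. ?h n \<in> vir_component n"
      using f(1) g(1) zero by (simp add: vir_component_def vir.span_add)
    ultimately show ?thesis unfolding S_def by (intro CollectI exI conjI)
  qed
  have scale: "vir_scale a u \<in> S" if "u \<in> S" for a u
  proof -
    from that obtain f M where f: "\<forall>n. f n \<in> vir_component n" "u = (\<Sum>n<(M::nat). f n)"
      unfolding S_def by blast
    have "vir_scale a u = (\<Sum>n<M. vir_scale a (f n))" by (simp add: f(2) vir.scale_sum_right)
    moreover have "\<forall>n. vir_scale a (f n) \<in> vir_component n"
      using f(1) by (simp add: vir_component_def vir.span_scale)
    ultimately show ?thesis unfolding S_def by (intro CollectI exI conjI)
  qed
  have "v \<in> S"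
  proof (rule vir_induct_generators)
    have "(0::vir) \<in> graded (- 1)" by (simp add: graded_def)
    then show "vir.subspace S" using add scale memI by (auto simp: vir.subspace_def)
    show "vacuum \<in> S" using memI[OF vir_word_graded[of "[]"]] by simp
    fix g v assume v: "v \<in> S"
    then obtain f M where f: "\<forall>n. f n \<in> vir_component n" "v = (\<Sum>n<(M::nat). f n)"
      unfolding S_def by blast
    show "vir_act (vbasis g) v \<in> S"
    proof (cases g)
      case C
      then show ?thesis using scale[OF v] by (simp add: vir_act_C)
    next
      case (L m)
      have "(\<Sum>n<M. vir_L m (f n)) \<in> S"
      proof (induction M)
        case 0
        have "(0::vir) \<in> graded (- 1)" by (simp add: graded_def)
        then show ?case using memI by simp
      next
        case (Suc M)
        have "vir_L m (f M) \<in> S" using memI[OF vir_L_component] f(1) by blast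
        then show ?case using Suc add by simp
      qed
      moreover have "vir_L m (\<Sum>n<M. f n) = (\<Sum>n<M. vir_L m (f n))"
        by (induction M) (simp_all add: vir_L_add)
      ultimately show ?thesis by (simp add: L f(2) vir_L_def)
    qed
  qed
  then show thesis using that unfolding S_def by blast
qed

subsection \<open>The image of the vacuum module\<close>

definition even_homog :: "nat \<Rightarrow> fock set" where
  "even_homog n = {v. homog (2 * int n) True v}"

lemma vir_fock_L: "vir_fock (vir_L n v) = vir_op n (vir_fock v)"
  by (simp add: vir_L_def vir_fock_act lie_op_vbasis)

lemma homog_vacuum: "homog 0 True fvac"
  by (auto simp: homog_def evac_def)

lemma vir_fock_word: "homog (- 2 * sum_list ms) True (vir_fock (vir_word ms))"
proof (induction ms)
  case (Cons m ms)
  have "homog (- 2 * sum_list ms - 2 * m) True (vir_op m (vir_fock (vir_word ms)))"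
    by (rule homog_vir_op[OF Cons.IH])
  moreover have "- 2 * sum_list (m # ms) = - 2 * sum_list ms - 2 * m" by simp
  ultimately show ?case unfolding vir_word_simps vir_fock_L by (simp only:)
qed (simp add: homog_vacuum)

lemma vir_fock_component: "v \<in> vir_component n \<Longrightarrow> vir_fock v \<in> even_homog n"
proof (induction rule: vir_component_induct)
  case (add a u v)
  then show ?case
    unfolding even_homog_def mem_Collect_eq vir_fock_add vir_fock_scale by (intro homog_add homog_scale)
next
  case (word ms)
  then show ?case using vir_fock_word[of ms] by (simp add: even_homog_def)
qed (unfold even_homog_def mem_Collect_eq vir_fock_zero, rule homog_zero)

lemma homog_weight_nonneg:
  assumes "homog h p v" "v \<noteq> 0" shows "h \<ge> 0"
proof -
  obtain S where "v S \<noteq> 0" using assms(2) by (auto simp: fun_eq_iff)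
  then show ?thesis using assms(1) fwt_nonneg[of S] by (auto simp: homog_def)
qed

lemma even_homog_lowering:
  assumes v: "v \<in> even_homog n" "v \<noteq> 0" and n: "n > 0"
  obtains k m where "k \<ge> 1" "int m = int n - k" "m < n" "vir_op k v \<in> even_homog m" "vir_op k v \<noteq> 0"
proof -
  have hom: "homog (2 * int n) True v" using v by (simp add: even_homog_def)
  have "\<not> singular (2 * int n) True v" using no_even_singular[of "2 * int n" v] v n by auto
  then obtain k where k: "k \<ge> 1" "vir_op k v \<noteq> 0" using hom by (auto simp: singular_def)
  have hk: "homog (2 * int n - 2 * k) True (vir_op k v)" by (rule homog_vir_op[OF hom])
  then have "int n - k \<ge> 0" using homog_weight_nonneg[OF hk k(2)] by simp
  define m where "m = nat (int n - k)"
  have m: "int m = int n - k" using \<open>int n - k \<ge> 0\<close> by (simp add: m_def)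
  then have "2 * int n - 2 * k = 2 * int m" by simp
  then have "homog (2 * int m) True (vir_op k v)" using hk by (simp only:)
  then show thesis
    using that[of k m] k m by (simp add: even_homog_def)
qed

text \<open>Lowering \<open>y\<close> repeatedly ends at a nonzero multiple of the vacuum.
  Transposed, the operators L_k used become L_(-k), and the word they form pairs with
  \<open>y\<close> to a nonzero value.\<close>

lemma fpair_words:
  assumes "y \<in> even_homog n" "y \<noteq> 0"
  shows "\<exists>ms. sum_list ms = - int n \<and> fpair (2 * int n) (vir_fock (vir_word ms)) y \<noteq> 0"
  using assms
proof (induction n arbitrary: y rule: less_induct)
  case (less n)
  show ?case
  proof (cases "n = 0")
    case True
    have y: "y S = 0" if "S \<noteq> {}" for S
    proof (rule ccontr)
      assume "y S \<noteq> 0"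
      then have "finite S" "fwt S = 0" using less.prems True by (auto simp: even_homog_def homog_def)
      then show False using that fwt_eq_0 by blast
    qed
    then have "y {} \<noteq> 0" using less.prems(2) by (metis ext zero_fun_apply)
    moreover have "weight_sets 0 = {{}}" using fwt_eq_0 by (auto simp: weight_sets_def)
    ultimately show ?thesis
      by (intro exI[of _ "[]"]) (simp add: True fpair_def evac_def)
  next
    case False
    then have "n > 0" by simp
    from even_homog_lowering[OF less.prems this]
    obtain k m where k: "int m = int n - k" "m < n" "vir_op k y \<in> even_homog m" "vir_op k y \<noteq> 0"
      by blast
    then obtain ms where ms: "sum_list ms = - int m"
        "fpair (2 * int m) (vir_fock (vir_word ms)) (vir_op k y) \<noteq> 0"
      using less.IH by blast
    have "2 * int m + 2 * k = 2 * int n" using k(1) by simp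
    then have "fpair (2 * int n) (vir_fock (vir_word (- k # ms))) y \<noteq> 0"
      using ms(2) fpair_vir_op[of "2 * int m" "vir_fock (vir_word ms)" k y] by (simp add: vir_fock_L)
    moreover have "sum_list (- k # ms) = - int n" using ms(1) k(1) by simp
    ultimately show ?thesis by blast
  qed
qed

lemma even_sets_fwt: "S \<in> even_sets n \<longleftrightarrow> finite S \<and> even (card S) \<and> fwt S = 2 * int n"
proof -
  have "fwt S = int (\<Sum>i\<in>S. 2 * i + 1)" by (simp add: fwt_def add.commute)
  then have "fwt S = 2 * int n \<longleftrightarrow> (\<Sum>i\<in>S. 2 * i + 1) = 2 * n" by linarith
  then show ?thesis unfolding even_sets_def mem_Collect_eq by blast
qed

lemma even_homog_expand: "u \<in> even_homog n \<Longrightarrow> u = (\<Sum>S\<in>even_sets n. fock_scale (u S) (evac S))"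
proof
  fix T assume u: "u \<in> even_homog n"
  have "(\<Sum>S\<in>even_sets n. fock_scale (u S) (evac S)) T = (\<Sum>S\<in>even_sets n. if T = S then u S else 0)"
    unfolding sum_fock_apply by (intro sum.cong) (auto simp: evac_def)
  also have "\<dots> = (if T \<in> even_sets n then u T else 0)" by (simp add: finite_even_sets)
  also have "\<dots> = u T" using u by (auto simp: even_homog_def homog_def even_sets_fwt)
  finally show "u T = (\<Sum>S\<in>even_sets n. fock_scale (u S) (evac S)) T" by simp
qed

lemma evac_even_homog: "S \<in> even_sets n \<Longrightarrow> evac S \<in> even_homog n"
  by (auto simp: even_homog_def homog_def evac_def even_sets_fwt)

interpretation fock_dual: vector_space_pair fock_scale "(*) :: complex \<Rightarrow> complex \<Rightarrow> complex"
  by unfold_locales (simp_all add: algebra_simps)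

lemma subspace_image_component: "fock.subspace (vir_fock ` vir_component n)"
proof -
  interpret Vector_Spaces.linear vir_scale fock_scale vir_fock by (rule linear_vir_fock)
  show ?thesis by (rule subspace_image) (simp add: vir_component_def vir.subspace_span)
qed

text \<open>If the image were smaller, some functional would vanish on it but not on the weight
  space. On the weight space the functional is pairing with a nonzero vector \<open>y\<close> of its
  values at the basis, and \<open>fpair_words\<close> finds a word in the image not orthogonal to
  \<open>y\<close>.\<close>

lemma vir_fock_image_component: "vir_fock ` vir_component n = even_homog n"
proof (rule equalityI)
  show "vir_fock ` vir_component n \<subseteq> even_homog n" using vir_fock_component by blast
  show "even_homog n \<subseteq> vir_fock ` vir_component n"
  proof (rule ccontr)
    let ?W = "vir_fock ` vir_component n"
    assume "\<not> even_homog n \<subseteq> ?W"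
    then obtain x where x: "x \<in> even_homog n" "x \<notin> ?W" by blast
    obtain B where B: "B \<subseteq> ?W" "fock.independent B" "?W \<subseteq> fock.span B"
      using fock.maximal_independent_subset[of ?W] by metis
    have "fock.span B \<subseteq> ?W" using B(1) subspace_image_component by (rule fock.span_minimal)
    then have "x \<notin> fock.span B" using x(2) by blast
    then have "fock.independent (insert x B)" by (rule fock.independent_insertI) (rule B(2))
    from fock_dual.linear_independent_extend[OF this, of "\<lambda>y. if y = x then 1 else 0"]
    obtain f where f: "Vector_Spaces.linear fock_scale (*) f"
      and fB: "\<forall>y\<in>insert x B. f y = (if y = x then 1 else 0)"
      by blast
    interpret f: Vector_Spaces.linear fock_scale "(*) :: complex \<Rightarrow> complex \<Rightarrow> complex" f by (rule f)
    have xB: "x \<notin> B" using \<open>x \<notin> fock.span B\<close> fock.span_base by blast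
    have fW: "f w = 0" if "w \<in> ?W" for w
    proof -
      have "w \<in> fock.span B" using that B(3) by blast
      then show ?thesis
      proof (induction rule: fock.span_induct_alt)
        case (step c u v)
        then have "u \<noteq> x" "f u = (if u = x then 1 else 0)" using fB xB by blast+
        then have "f u = 0" by simp
        then show ?case unfolding f.add f.scale using step.IH by simp
      qed (rule f.zero)
    qed
    define y where "y S = (if S \<in> even_sets n then f (evac S) else 0)" for S
    have y: "y \<in> even_homog n"
      by (auto simp: y_def even_homog_def homog_def even_sets_fwt)
    have pair: "fpair (2 * int n) u y = f u" if "u \<in> even_homog n" for u
    proof -
      have "f u = (\<Sum>S\<in>even_sets n. u S * f (evac S))"
        by (subst even_homog_expand[OF that]) (simp add: f.sum f.scale)
      also have "\<dots> = fpair (2 * int n) u y"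
        unfolding fpair_def
        by (rule sum.mono_neutral_cong_left)
          (auto simp: y_def finite_weight_sets weight_sets_def[of "2 * int n"] even_sets_fwt
            finite_weight_sets[unfolded weight_sets_def])
      finally show ?thesis by simp
    qed
    have "f x = 1" using fB by simp
    have "y \<noteq> 0"
    proof
      assume "y = 0"
      then have "fpair (2 * int n) x y = 0" by (simp add: fpair_def)
      then show False using pair[OF x(1)] \<open>f x = 1\<close> by simp
    qed
    then obtain ms where ms: "sum_list ms = - int n" "fpair (2 * int n) (vir_fock (vir_word ms)) y \<noteq> 0"
      using fpair_words[OF y] by blast
    have "vir_word ms \<in> vir_component n" using vir_word_graded[of ms] ms(1) by (simp add: graded_def)
    then have "vir_fock (vir_word ms) \<in> ?W" by blast
    then have "fpair (2 * int n) (vir_fock (vir_word ms)) y = 0"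
      using pair[OF vir_fock_component[OF \<open>vir_word ms \<in> vir_component n\<close>]] fW by simp
    then show False using ms(2) by simp
  qed
qed

subsection \<open>The maximal submodule\<close>

lemma vir_component_0: "v \<in> vir_component 0 \<Longrightarrow> \<exists>a. v = vir_scale a vacuum"
proof -
  assume v: "v \<in> vir_component 0"
  have "{vir_monomial ns | ns. sorted_wrt (\<ge>) ns \<and> (\<forall>k\<in>set ns. k \<ge> 2) \<and> sum_list ns = 0} \<subseteq> {vacuum}"
  proof clarify
    fix ns :: "nat list" assume ns: "\<forall>k\<in>set ns. k \<ge> 2" "sum_list ns = 0"
    then have "ns = []" by (cases ns) auto
    then show "vir_monomial ns = vacuum" by simp
  qed
  then have "v \<in> vir.span {vacuum}" using v vir.span_mono unfolding vir_component_def by blast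
  then show ?thesis by (auto simp: vir.span_singleton)
qed

text \<open>L_0 - M removes the top summand and multiplies the n-th one by n - M, which is nonzero
  for n < M; induction on the number of summands isolates each component.\<close>

lemma subspace_eigen_component:
  assumes N: "vir.subspace N" and L0: "\<And>v. v \<in> N \<Longrightarrow> vir_L 0 v \<in> N"
    and f: "\<And>n. f n \<in> vir_component n" and sum: "(\<Sum>n<(M::nat). f n) \<in> N" and "k < M"
  shows "f k \<in> N"
  using f sum \<open>k < M\<close>
proof (induction M arbitrary: f k)
  case (Suc M)
  let ?g = "\<lambda>n. vir_scale (of_nat n - of_nat M) (f n)"
  have "vir_L 0 (\<Sum>n<K. f n) = (\<Sum>n<K. vir_scale (of_nat n) (f n))" for K
    by (induction K) (simp_all add: vir_L_add vir_L_0_component[OF Suc.prems(1)])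
  then have "(\<Sum>n<Suc M. ?g n) = vir_L 0 (\<Sum>n<Suc M. f n) - vir_scale (of_nat M) (\<Sum>n<Suc M. f n)"
    by (simp only: vir.scale_sum_right vir.scale_left_diff_distrib sum_subtractf)
  moreover have "(\<Sum>n<Suc M. ?g n) = (\<Sum>n<M. ?g n)" by simp
  ultimately have gN: "(\<Sum>n<M. ?g n) \<in> N"
    using Suc.prems(2) L0 vir.subspace_diff[OF N] vir.subspace_scale[OF N] by metis
  have gc: "?g n \<in> vir_component n" for n
    using Suc.prems(1) by (simp add: vir_component_def vir.span_scale)
  have below: "f j \<in> N" if "j < M" for j
  proof -
    have "?g j \<in> N" by (rule Suc.IH[OF gc gN that])
    then have "vir_scale (1 / (of_nat j - of_nat M)) (?g j) \<in> N" by (rule vir.subspace_scale[OF N])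
    then show ?thesis using that by simp
  qed
  show ?case
  proof (cases "k < M")
    case False
    then have k: "k = M" using Suc.prems(3) by simp
    have "(\<Sum>n<M. f n) \<in> N" by (rule vir.subspace_sum[OF N]) (use below in simp)
    then have "(\<Sum>n<Suc M. f n) - (\<Sum>n<M. f n) \<in> N" by (rule vir.subspace_diff[OF N Suc.prems(2)])
    then show ?thesis by (simp add: k)
  qed (rule below)
qed simp

lemma submodule_UNIV:
  assumes N: "vir_submodule N" and "vacuum \<in> N" shows "N = UNIV"
  using vir_induct_generators[of N] assms by (auto simp: vir_submodule_def)

text \<open>Some L_k lowers the degree while the image in Fock space stays nonzero; at degree 0 only
  multiples of the vacuum remain.\<close>

lemma submodule_contains_vacuum:
  assumes N: "vir_submodule N" and v: "v \<in> N" "v \<in> vir_component n" "vir_fock v \<noteq> 0"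
  shows "vacuum \<in> N"
  using v
proof (induction n arbitrary: v rule: less_induct)
  case (less n)
  have sub: "vir.subspace N" and act: "vir_L m v \<in> N" if "v \<in> N" for m v
    using N that by (auto simp: vir_submodule_def vir_L_def)
  show ?case
  proof (cases "n = 0")
    case True
    then obtain a where a: "v = vir_scale a vacuum" using vir_component_0 less.prems(2) by blast
    then have "a \<noteq> 0" using less.prems(3) by auto
    then have "vir_scale (1 / a) v = vacuum" by (simp add: a)
    then show ?thesis using vir.subspace_scale[OF sub[OF less.prems(1)] less.prems(1)] by metis
  next
    case False
    then have "n > 0" by simp
    from even_homog_lowering[OF vir_fock_component[OF less.prems(2)] less.prems(3) this]
    obtain k m where k: "int m = int n - k" "m < n" "vir_op k (vir_fock v) \<noteq> 0"
      by blast
    have "vir_L k v \<in> vir_component m"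
      using vir_L_component[OF less.prems(2), of k] by (simp add: graded_def flip: k(1))
    moreover have "vir_fock (vir_L k v) \<noteq> 0" using k(3) unfolding vir_fock_L .
    ultimately show ?thesis
      using less.IH[OF k(2), of "vir_L k v"] act[OF less.prems(1)] by blast
  qed
qed

definition fock_kernel :: "vir set" where
  "fock_kernel = {v. vir_fock v = 0}"

lemma vir_submodule_fock_kernel: "vir_submodule fock_kernel"
  by (auto simp: vir_submodule_def fock_kernel_def vir.subspace_def vir_fock_add vir_fock_scale
      vir_fock_act lie_op_def lin_ext_def)

lemma fock_kernel_proper: "fock_kernel \<noteq> UNIV"
proof -
  have "fvac \<noteq> 0" by (simp add: fun_eq_iff evac_def)
  then have "vacuum \<notin> fock_kernel" by (simp add: fock_kernel_def)
  then show ?thesis by blast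
qed

text \<open>A submodule contains the homogeneous components of its members, and one component
  outside the kernel would already bring in the vacuum.\<close>

lemma proper_submodule_subset:
  assumes N: "vir_submodule N" "N \<noteq> UNIV" shows "N \<subseteq> fock_kernel"
proof
  fix v assume v: "v \<in> N"
  obtain f M where f: "\<And>n. f n \<in> vir_component n" "v = (\<Sum>n<M. f n)"
    using vir_component_sum by blast
  have sub: "vir.subspace N" and L0: "\<And>v. v \<in> N \<Longrightarrow> vir_L 0 v \<in> N"
    using N by (auto simp: vir_submodule_def vir_L_def)
  have "vir_fock (f n) = 0" if "n < M" for n
  proof (rule ccontr)
    assume "vir_fock (f n) \<noteq> 0"
    moreover have "f n \<in> N"
      by (rule subspace_eigen_component[OF sub L0 f(1) _ that]) (use v f(2) in auto)
    ultimately have "vacuum \<in> N" using submodule_contains_vacuum[OF N(1)] f(1) by blast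
    then show False using submodule_UNIV[OF N(1)] N(2) by blast
  qed
  then have "(\<Sum>n<M. vir_fock (f n)) = 0" by (intro sum.neutral) simp
  moreover have "vir_fock (\<Sum>n<K. f n) = (\<Sum>n<K. vir_fock (f n))" for K
    by (induction K) (simp_all add: vir_fock_add)
  ultimately show "v \<in> fock_kernel" by (simp add: fock_kernel_def f(2))
qed

text \<open>Being the greatest proper submodule, the kernel is the only maximal one, so the definite
  description denotes it.\<close>

lemma submod_set_max_submod: "submod_set max_submod = fock_kernel"
proof -
  define K where "K = Abs_vir_submod fock_kernel"
  have K: "submod_set K = fock_kernel"
    unfolding K_def by (rule Abs_vir_submod_inverse) (simp add: vir_submodule_fock_kernel)
  have sub: "submod_set N \<subseteq> submod_set K" if "submod_set N \<noteq> UNIV" for N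
    using proper_submodule_subset[of "submod_set N"] submod_set[of N] that by (simp add: K)
  have "maximal_proper K"
    unfolding maximal_proper_def using fock_kernel_proper sub
    by (auto simp: K submod_set_inject[symmetric])
  moreover have "N = K" if "maximal_proper N" for N
    using that sub[of N] fock_kernel_proper K unfolding maximal_proper_def by metis
  ultimately have max: "max_submod = K" unfolding max_submod_def by (rule the_equality)
  show ?thesis unfolding max by (rule K)
qed

lift_definition ising_fock :: "ising \<Rightarrow> fock" is vir_fock
  by (simp add: ising_rel_def submod_set_max_submod fock_kernel_def vir_fock_diff)

lemma ising_fock_proj: "ising_fock (ising_proj v) = vir_fock v"
  by (simp add: ising_proj_def ising_fock.abs_eq)

lemma linear_ising_fock: "Vector_Spaces.linear ising_scale fock_scale ising_fock"
  by unfold_locales (transfer, rule vir_fock_add, transfer, rule vir_fock_scale)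

lemma inj_ising_fock: "inj ising_fock"
proof (rule injI)
  fix x y assume "ising_fock x = ising_fock y"
  then show "x = y"
    by transfer (simp add: ising_rel_def submod_set_max_submod fock_kernel_def vir_fock_diff)
qed

text \<open>\<open>ising_fock\<close> is injective and maps the component onto
  \<open>even_homog n\<close>, so the vectors \<open>evac S\<close> with \<open>S\<close> in
  \<open>even_sets n\<close> pull back to a basis.\<close>

lemma dim_ising_component: "ising.dim (ising_component n) = card (even_sets n)"
proof -
  interpret f: Vector_Spaces.linear ising_scale fock_scale ising_fock by (rule linear_ising_fock)
  interpret p: vector_space_pair ising_scale fock_scale by unfold_locales
  have image: "ising_fock ` ising_component n = even_homog n"
    by (simp add: ising_component_def image_image ising_fock_proj vir_fock_image_component)
  define g where "g = inv ising_fock"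
  have g: "ising_fock (g v) = v" "g v \<in> ising_component n" if "v \<in> even_homog n" for v
  proof -
    have "v \<in> ising_fock ` ising_component n" using that unfolding image .
    then obtain x where x: "x \<in> ising_component n" "ising_fock x = v" by (auto elim!: imageE)
    have "g (ising_fock x) = x" unfolding g_def by (rule inv_f_f[OF inj_ising_fock])
    then have "g v = x" unfolding x(2) .
    then show "ising_fock (g v) = v" "g v \<in> ising_component n" using x by auto
  qed
  define B where "B = (\<lambda>S. g (evac S)) ` even_sets n"
  have inj: "inj_on (\<lambda>S. g (evac S)) (even_sets n)"
  proof (rule inj_onI)
    fix S T assume "S \<in> even_sets n" "T \<in> even_sets n" "g (evac S) = g (evac T)"
    then have "evac S = evac T" using g(1)[OF evac_even_homog] by metis
    then show "S = T" by (metis evac_def zero_neq_one)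
  qed
  have cardB: "card B = card (even_sets n)" unfolding B_def by (rule card_image[OF inj])
  have indep: "ising.independent B"
  proof (rule ising.independent_if_scalars_zero)
    show "finite B" by (simp add: B_def finite_even_sets)
    fix u x assume 0: "(\<Sum>x\<in>B. ising_scale (u x) x) = 0" and "x \<in> B"
    then obtain T where T: "T \<in> even_sets n" "x = g (evac T)" by (auto simp: B_def)
    have "ising_fock (\<Sum>x\<in>B. ising_scale (u x) x) = (\<Sum>S\<in>even_sets n. fock_scale (u (g (evac S))) (evac S))"
      unfolding B_def sum.reindex[OF inj] o_def f.sum f.scale
      by (intro sum.cong refl) (simp only: g(1)[OF evac_even_homog])
    then have "(\<Sum>S\<in>even_sets n. fock_scale (u (g (evac S))) (evac S)) = 0"
      unfolding 0 f.zero by (rule sym)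
    then have "0 = (\<Sum>S\<in>even_sets n. fock_scale (u (g (evac S))) (evac S)) T"
      by (simp only: zero_fun_apply)
    also have "\<dots> = (\<Sum>S\<in>even_sets n. if T = S then u (g (evac S)) else 0)"
      unfolding sum_fock_apply by (intro sum.cong) (auto simp: evac_def)
    finally show "u x = 0" using T by (simp add: finite_even_sets)
  qed
  have "ising.span B = ising.span (ising_component n)"
  proof (rule equalityI)
    show "ising.span B \<subseteq> ising.span (ising_component n)"
      by (rule ising.span_mono) (auto simp: B_def g(2)[OF evac_even_homog])
    have "ising_component n \<subseteq> ising.span B"
    proof
      fix x assume "x \<in> ising_component n"
      then have "ising_fock x \<in> even_homog n" unfolding image[symmetric] by (rule imageI)
      then have "ising_fock x = (\<Sum>S\<in>even_sets n. fock_scale (ising_fock x S) (evac S))"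
        by (rule even_homog_expand)
      also have "\<dots> = ising_fock (\<Sum>S\<in>even_sets n. ising_scale (ising_fock x S) (g (evac S)))"
        unfolding f.sum f.scale by (intro sum.cong refl) (simp add: g(1)[OF evac_even_homog])
      finally have "x = (\<Sum>S\<in>even_sets n. ising_scale (ising_fock x S) (g (evac S)))"
        using inj_ising_fock by (simp add: inj_eq)
      also have "\<dots> \<in> ising.span B"
        by (intro ising.span_sum ising.span_scale ising.span_base) (auto simp: B_def)
      finally show "x \<in> ising.span B" .
    qed
    then show "ising.span (ising_component n) \<subseteq> ising.span B"
      using ising.span_minimal ising.subspace_span by blast
  qed
  then show ?thesis using ising.dim_eq_card indep cardB by metis
qed

theorem theorem1:
  shows "((\<lambda>(k1 :: nat, k2 :: nat).
            fps_X ^ (4 * k1\<^sup>2 + 3 * k1 * k2 + k2\<^sup>2) / (qfact k1 * qfact k2)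
              * (1 - fps_X ^ k1 + fps_X ^ (k1 + k2)))
          has_sum ising_character) UNIV"
proof -
  have "ising_character = fps_fsum (\<lambda>m. fps_X ^ (2 * m\<^sup>2) * iqfact (2 * m)) UNIV"
    unfolding ising_character_def dim_ising_component by (rule even_sets_genfun)
  then show ?thesis using has_sum_nahm by simp
qed

end
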